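(* Let $c\colon C_*\to C$ be a polynomial in a category $\mathcal{E}$ with finite limits. Then there is a bijection between $\triangleleft$-comonoid structures on $c$ in $\mathbf{Poly}_{\mathcal{E}}$ and categories internal to $\mathcal{E}$ with $c$ as their source morphism (so with object of objects $C_0=C$, object of morphisms $C_1=C_*$ and $s=c$).
   Context: For $f\colon B\to A$ in $\mathcal{E}$, $\Delta_f\colon\mathcal{E}/A\to\mathcal{E}/B$ denotes pullback along $f$; $f$ is exponentiable if $\Delta_f$ has a right adjoint $\Pi_f$. A polynomial in $\mathcal{E}$ is an exponentiable morphism $p\colon P_*\to P$. A morphism of polynomials $\phi\colon p\to q$ is a pair $\phi_1\colon P\to Q$, $\phi^\sharp\colon P\times_Q Q_*\to P_*$ with $p\circ\phi^\sharp$ the projection to $P$, up to isomorphism of the choice of pullback. Composition is $(\psi\circ\phi)_1=\psi_1\circ\phi_1$, $(\psi\circ\phi)^\sharp=\phi^\sharp\circ(P\times_Q\psi^\sharp)$ (using $P\times_R R_*\cong P\times_Q(Q\times_R R_* )$). This gives the category $\mathbf{Poly}_{\mathcal{E}}$. It is monoidal under $(y,\triangleleft)$, where $y=\mathrm{id}_1$ and $p\triangleleft q$ is the composite of projections $(\Pi_p(Q\times P_* )\times_P P_* )\times_Q Q_*\to\Pi_p(Q\times P_* )\times_P P_*\to\Pi_p(Q\times P_* )$, with $\Pi_p(Q\times P_* )\times_P P_*\to Q$ the counit of $\Delta_p\dashv\Pi_p$ followed by projection. In terms of generalized elements, positions are pairs $(x\colon X\to P,\ f\colon X\times_PP_*\to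 Q)$ and a direction at $(x,f)$ is a pair $(y,z)$ with $y$ in $P_*$ over $x$ and $z$ in $Q_*$ over $f(y)$. On morphisms, $\phi\triangleleft\psi$ sends $(x,f)$ to $(\phi_1x,\psi_1\circ f\circ\phi^\sharp(x,-))$ and a direction $(y',z')$ there to $(\phi^\sharp(x,y'),\psi^\sharp(f(\phi^\sharp(x,y')),z'))$; associators and unitors are the canonical isomorphisms. A $\triangleleft$-comonoid structure on $c$ consists of morphisms $\epsilon\colon c\to y$ and $\delta\colon c\to c\triangleleft c$ in $\mathbf{Poly}_{\mathcal{E}}$ satisfying the counit and coassociativity equations: $(\epsilon\triangleleft\mathrm{id}_c)\circ\delta$ and $(\mathrm{id}_c\triangleleft\epsilon)\circ\delta$ are the canonical isomorphisms $c\cong y\triangleleft c$ and $c\cong c\triangleleft y$, and $(\delta\triangleleft\mathrm{id}_c)\circ\delta=(\mathrm{id}_c\triangleleft\delta)\circ\delta$ up to the associator. A category internal to $\mathcal{E}$ consists of morphisms $s,t\colon C_1\to C_0$, an identity map $i\colon C_0\to C_1$ with $s\circ i=\mathrm{id}=t\circ i$, and a composition map $k\colon C_1\times_{t,C_0,s}C_1\to C_1$ with $s\circ k=s\circ\pi_1$ and $t\circ k=t\circ\pi_2$, satisfying the usual left and right unit laws and associativity law. *)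

theory Defs
  imports Main
begin

section \<open>Categories, functors, adjunctions, limits\<close>

record ('o, 'm) category =
  Obj :: "'o set"
  Arr :: "'m set"
  Dom :: "'m \<Rightarrow> 'o"
  Cod :: "'m \<Rightarrow> 'o"
  Ident :: "'o \<Rightarrow> 'm"
  Comp :: "'m \<Rightarrow> 'm \<Rightarrow> 'm"  (infixr "\<cdot>\<index>" 70)

definition Hom :: "('o, 'm) category \<Rightarrow> 'o \<Rightarrow> 'o \<Rightarrow> 'm set" where
  "Hom E X Y = {f \<in> Arr E. Dom E f = X \<and> Cod E f = Y}"

definition is_category :: "('o, 'm) category \<Rightarrow> bool" where
  "is_category E \<longleftrightarrow>
     (\<forall>f \<in> Arr E. Dom E f \<in> Obj E \<and> Cod E f \<in> Obj E) \<and>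
     (\<forall>X \<in> Obj E. Ident E X \<in> Hom E X X) \<and>
     (\<forall>f \<in> Arr E. \<forall>g \<in> Arr E. Cod E f = Dom E g \<longrightarrow>
        g \<cdot>\<^bsub>E\<^esub> f \<in> Hom E (Dom E f) (Cod E g)) \<and>
     (\<forall>f \<in> Arr E. f \<cdot>\<^bsub>E\<^esub> Ident E (Dom E f) = f \<and> Ident E (Cod E f) \<cdot>\<^bsub>E\<^esub> f = f) \<and>
     (\<forall>f \<in> Arr E. \<forall>g \<in> Arr E. \<forall>h \<in> Arr E. Cod E f = Dom E g \<and> Cod E g = Dom E h \<longrightarrow>
        h \<cdot>\<^bsub>E\<^esub> (g \<cdot>\<^bsub>E\<^esub> f) = (h \<cdot>\<^bsub>E\<^esub> g) \<cdot>\<^bsub>E\<^esub> f)"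

record ('o1, 'm1, 'o2, 'm2) cfunctor =
  on_obj :: "'o1 \<Rightarrow> 'o2"
  on_arr :: "'m1 \<Rightarrow> 'm2"

definition is_functor ::
  "('o1, 'm1) category \<Rightarrow> ('o2, 'm2) category \<Rightarrow> ('o1, 'm1, 'o2, 'm2) cfunctor \<Rightarrow> bool" where
  "is_functor C D F \<longleftrightarrow>
     (\<forall>X \<in> Obj C. on_obj F X \<in> Obj D) \<and>
     (\<forall>f \<in> Arr C. on_arr F f \<in> Hom D (on_obj F (Dom C f)) (on_obj F (Cod C f))) \<and>
     (\<forall>X \<in> Obj C. on_arr F (Ident C X) = Ident D (on_obj F X)) \<and>
     (\<forall>f \<in> Arr C. \<forall>g \<in> Arr C. Cod C f = Dom C g \<longrightarrow>
        on_arr F (g \<cdot>\<^bsub>C\<^esub> f) = on_arr F g \<cdot>\<^bsub>D\<^esub> on_arr F f)"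

definition id_functor :: "('o, 'm, 'o, 'm) cfunctor" where
  "id_functor = \<lparr>on_obj = (\<lambda>X. X), on_arr = (\<lambda>f. f)\<rparr>"

definition comp_functor ::
  "('o2, 'm2, 'o3, 'm3) cfunctor \<Rightarrow> ('o1, 'm1, 'o2, 'm2) cfunctor \<Rightarrow> ('o1, 'm1, 'o3, 'm3) cfunctor"
  where
  "comp_functor G F = \<lparr>on_obj = on_obj G \<circ> on_obj F, on_arr = on_arr G \<circ> on_arr F\<rparr>"

definition is_nat_trans ::
  "('o1, 'm1) category \<Rightarrow> ('o2, 'm2) category \<Rightarrow> ('o1, 'm1, 'o2, 'm2) cfunctor \<Rightarrow>
   ('o1, 'm1, 'o2, 'm2) cfunctor \<Rightarrow> ('o1 \<Rightarrow> 'm2) \<Rightarrow> bool" where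
  "is_nat_trans C D F G \<tau> \<longleftrightarrow>
     is_functor C D F \<and> is_functor C D G \<and>
     (\<forall>X \<in> Obj C. \<tau> X \<in> Hom D (on_obj F X) (on_obj G X)) \<and>
     (\<forall>f \<in> Arr C. on_arr G f \<cdot>\<^bsub>D\<^esub> \<tau> (Dom C f) = \<tau> (Cod C f) \<cdot>\<^bsub>D\<^esub> on_arr F f)"

definition is_adjunction ::
  "('o1, 'm1) category \<Rightarrow> ('o2, 'm2) category \<Rightarrow> ('o1, 'm1, 'o2, 'm2) cfunctor \<Rightarrow>
   ('o2, 'm2, 'o1, 'm1) cfunctor \<Rightarrow> ('o1 \<Rightarrow> 'm1) \<Rightarrow> ('o2 \<Rightarrow> 'm2) \<Rightarrow> bool" where
  "is_adjunction C D F G \<eta> \<epsilon> \<longleftrightarrow>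
     is_functor C D F \<and> is_functor D C G \<and>
     is_nat_trans C C id_functor (comp_functor G F) \<eta> \<and>
     is_nat_trans D D (comp_functor F G) id_functor \<epsilon> \<and>
     (\<forall>X \<in> Obj C. \<epsilon> (on_obj F X) \<cdot>\<^bsub>D\<^esub> on_arr F (\<eta> X) = Ident D (on_obj F X)) \<and>
     (\<forall>Y \<in> Obj D. on_arr G (\<epsilon> Y) \<cdot>\<^bsub>C\<^esub> \<eta> (on_obj G Y) = Ident C (on_obj G Y))"

definition is_cone ::
  "('i, 'j) category \<Rightarrow> ('o, 'm) category \<Rightarrow> ('i, 'j, 'o, 'm) cfunctor \<Rightarrow> 'o \<Rightarrow> ('i \<Rightarrow> 'm) \<Rightarrow> bool"
  where
  "is_cone J E F L \<pi> \<longleftrightarrow>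
     L \<in> Obj E \<and> (\<forall>i \<in> Obj J. \<pi> i \<in> Hom E L (on_obj F i)) \<and>
     (\<forall>a \<in> Arr J. on_arr F a \<cdot>\<^bsub>E\<^esub> \<pi> (Dom J a) = \<pi> (Cod J a))"

definition is_limit ::
  "('i, 'j) category \<Rightarrow> ('o, 'm) category \<Rightarrow> ('i, 'j, 'o, 'm) cfunctor \<Rightarrow> 'o \<Rightarrow> ('i \<Rightarrow> 'm) \<Rightarrow> bool"
  where
  "is_limit J E F L \<pi> \<longleftrightarrow>
     is_cone J E F L \<pi> \<and>
     (\<forall>X \<tau>. is_cone J E F X \<tau> \<longrightarrow>
        (\<exists>!u. u \<in> Hom E X L \<and> (\<forall>i \<in> Obj J. \<pi> i \<cdot>\<^bsub>E\<^esub> u = \<tau> i)))"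

text \<open>Every finite category is isomorphic to one whose objects and arrows are natural numbers,
  so it suffices to let the diagram shapes range over those.\<close>

definition has_finite_limits :: "('o, 'm) category \<Rightarrow> bool" where
  "has_finite_limits E \<longleftrightarrow>
     (\<forall>(J :: (nat, nat) category) F.
        is_category J \<and> finite (Obj J) \<and> finite (Arr J) \<and> is_functor J E F \<longrightarrow>
        (\<exists>L \<pi>. is_limit J E F L \<pi>))"


section \<open>Chosen terminal object, products and pullbacks\<close>

definition is_terminal :: "('o, 'm) category \<Rightarrow> 'o \<Rightarrow> bool" where
  "is_terminal E T \<longleftrightarrow> T \<in> Obj E \<and> (\<forall>X \<in> Obj E. \<exists>!u. u \<in> Hom E X T)"

definition terminal_obj :: "('o, 'm) category \<Rightarrow> 'o" where
  "terminal_obj E = (SOME T. is_terminal E T)"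

definition bang :: "('o, 'm) category \<Rightarrow> 'o \<Rightarrow> 'm" where
  "bang E X = (THE u. u \<in> Hom E X (terminal_obj E))"

definition is_product :: "('o, 'm) category \<Rightarrow> 'o \<Rightarrow> 'o \<Rightarrow> 'm \<Rightarrow> 'm \<Rightarrow> bool" where
  "is_product E X Y a b \<longleftrightarrow>
     a \<in> Arr E \<and> b \<in> Arr E \<and> Dom E a = Dom E b \<and> Cod E a = X \<and> Cod E b = Y \<and>
     (\<forall>Z. \<forall>h \<in> Hom E Z X. \<forall>k \<in> Hom E Z Y.
        \<exists>!u. u \<in> Hom E Z (Dom E a) \<and> a \<cdot>\<^bsub>E\<^esub> u = h \<and> b \<cdot>\<^bsub>E\<^esub> u = k)"

definition chosen_product :: "('o, 'm) category \<Rightarrow> 'o \<Rightarrow> 'o \<Rightarrow> 'm \<times> 'm" where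
  "chosen_product E X Y = (SOME (a, b). is_product E X Y a b)"

abbreviation "prod_fst E X Y \<equiv> fst (chosen_product E X Y)"
abbreviation "prod_snd E X Y \<equiv> snd (chosen_product E X Y)"

definition is_pullback :: "('o, 'm) category \<Rightarrow> 'm \<Rightarrow> 'm \<Rightarrow> 'm \<Rightarrow> 'm \<Rightarrow> bool" where
  "is_pullback E f g a b \<longleftrightarrow>
     f \<in> Arr E \<and> g \<in> Arr E \<and> Cod E f = Cod E g \<and>
     a \<in> Arr E \<and> b \<in> Arr E \<and> Dom E a = Dom E b \<and> Cod E a = Dom E f \<and> Cod E b = Dom E g \<and>
     f \<cdot>\<^bsub>E\<^esub> a = g \<cdot>\<^bsub>E\<^esub> b \<and>
     (\<forall>Z. \<forall>h \<in> Hom E Z (Dom E f). \<forall>k \<in> Hom E Z (Dom E g). f \<cdot>\<^bsub>E\<^esub> h = g \<cdot>\<^bsub>E\<^esub> k \<longrightarrow>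
        (\<exists>!u. u \<in> Hom E Z (Dom E a) \<and> a \<cdot>\<^bsub>E\<^esub> u = h \<and> b \<cdot>\<^bsub>E\<^esub> u = k))"

text \<open>\<open>pullback E f g\<close> is the pair of projections of the chosen pullback of \<open>f\<close> and \<open>g\<close>, with apex
  \<open>pb E f g\<close>; \<open>pb_pair E f g h k\<close> is the arrow \<open>\<langle>h, k\<rangle>\<close> into that apex.\<close>

definition pullback :: "('o, 'm) category \<Rightarrow> 'm \<Rightarrow> 'm \<Rightarrow> 'm \<times> 'm" where
  "pullback E f g = (SOME (a, b). is_pullback E f g a b)"

abbreviation "pb_fst E f g \<equiv> fst (pullback E f g)"
abbreviation "pb_snd E f g \<equiv> snd (pullback E f g)"

definition pb :: "('o, 'm) category \<Rightarrow> 'm \<Rightarrow> 'm \<Rightarrow> 'o" where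
  "pb E f g = Dom E (pb_fst E f g)"

definition pb_pair :: "('o, 'm) category \<Rightarrow> 'm \<Rightarrow> 'm \<Rightarrow> 'm \<Rightarrow> 'm \<Rightarrow> 'm" where
  "pb_pair E f g h k =
     (THE u. u \<in> Hom E (Dom E h) (pb E f g) \<and>
             pb_fst E f g \<cdot>\<^bsub>E\<^esub> u = h \<and> pb_snd E f g \<cdot>\<^bsub>E\<^esub> u = k)"


section \<open>Slice categories and exponentiable arrows\<close>

text \<open>An arrow \<open>x \<rightarrow> y\<close> of \<open>E/A\<close> is a triple \<open>(x, h, y)\<close> with \<open>y \<circ> h = x\<close>.\<close>

definition slice :: "('o, 'm) category \<Rightarrow> 'o \<Rightarrow> ('m, 'm \<times> 'm \<times> 'm) category" where
  "slice E A =
     \<lparr>Obj = {x \<in> Arr E. Cod E x = A},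
      Arr = {(x, h, y). x \<in> Arr E \<and> y \<in> Arr E \<and> Cod E x = A \<and> Cod E y = A \<and>
                        h \<in> Hom E (Dom E x) (Dom E y) \<and> y \<cdot>\<^bsub>E\<^esub> h = x},
      Dom = (\<lambda>(x, h, y). x),
      Cod = (\<lambda>(x, h, y). y),
      Ident = (\<lambda>x. (x, Ident E (Dom E x), x)),
      Comp = (\<lambda>(y, k, z) (x, h, y'). (x, k \<cdot>\<^bsub>E\<^esub> h, z))\<rparr>"

definition pullback_functor ::
  "('o, 'm) category \<Rightarrow> 'm \<Rightarrow> ('m, 'm \<times> 'm \<times> 'm, 'm, 'm \<times> 'm \<times> 'm) cfunctor"  ("\<Delta>\<index>") where
  "pullback_functor E f =
     \<lparr>on_obj = (\<lambda>x. pb_snd E x f),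
      on_arr = (\<lambda>(x, h, y).
        (pb_snd E x f,
         pb_pair E y f (h \<cdot>\<^bsub>E\<^esub> pb_fst E x f) (pb_snd E x f),
         pb_snd E y f))\<rparr>"

definition exponentiable :: "('o, 'm) category \<Rightarrow> 'm \<Rightarrow> bool" where
  "exponentiable E f \<longleftrightarrow>
     f \<in> Arr E \<and>
     (\<exists>G \<eta> \<epsilon>. is_adjunction (slice E (Cod E f)) (slice E (Dom E f)) (\<Delta>\<^bsub>E\<^esub> f) G \<eta> \<epsilon>)"

text \<open>A chosen right adjoint of \<open>\<Delta> f\<close> together with its counit.\<close>

definition Pi_data ::
  "('o, 'm) category \<Rightarrow> 'm \<Rightarrow>
   ('m, 'm \<times> 'm \<times> 'm, 'm, 'm \<times> 'm \<times> 'm) cfunctor \<times> ('m \<Rightarrow> 'm \<times> 'm \<times> 'm)" where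
  "Pi_data E f =
     (SOME (G, \<epsilon>). \<exists>\<eta>. is_adjunction (slice E (Cod E f)) (slice E (Dom E f)) (\<Delta>\<^bsub>E\<^esub> f) G \<eta> \<epsilon>)"

abbreviation Pi_functor ("\<Pi>\<index>") where "\<Pi>\<^bsub>E\<^esub> f \<equiv> fst (Pi_data E f)"
abbreviation "Pi_counit E f \<equiv> snd (Pi_data E f)"


section \<open>The category of polynomials\<close>

text \<open>A morphism from \<open>p : P\<^sub>* \<rightarrow> P\<close> to \<open>q : Q\<^sub>* \<rightarrow> Q\<close> has \<open>on_pos : P \<rightarrow> Q\<close> and
  \<open>on_dir : P \<times>\<^sub>Q Q\<^sub>* \<rightarrow> P\<^sub>*\<close>, the latter with respect to the chosen pullback.\<close>

record 'm poly_mor =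
  p_src :: 'm
  p_tgt :: 'm
  on_pos :: 'm
  on_dir :: 'm

definition is_poly_mor :: "('o, 'm) category \<Rightarrow> 'm poly_mor \<Rightarrow> bool" where
  "is_poly_mor E \<phi> \<longleftrightarrow>
     exponentiable E (p_src \<phi>) \<and> exponentiable E (p_tgt \<phi>) \<and>
     on_pos \<phi> \<in> Hom E (Cod E (p_src \<phi>)) (Cod E (p_tgt \<phi>)) \<and>
     on_dir \<phi> \<in> Hom E (pb E (on_pos \<phi>) (p_tgt \<phi>)) (Dom E (p_src \<phi>)) \<and>
     p_src \<phi> \<cdot>\<^bsub>E\<^esub> on_dir \<phi> = pb_fst E (on_pos \<phi>) (p_tgt \<phi>)"

text \<open>\<open>dir_at E \<phi> x y\<close> is the generalized element \<open>\<phi>\<^sup>\<sharp>(x, y)\<close> of \<open>P\<^sub>*\<close>, for generalized elements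
  \<open>x\<close> of \<open>P\<close> and \<open>y\<close> of \<open>Q\<^sub>*\<close> over \<open>\<phi>\<^sub>1(x)\<close>.\<close>

definition dir_at :: "('o, 'm) category \<Rightarrow> 'm poly_mor \<Rightarrow> 'm \<Rightarrow> 'm \<Rightarrow> 'm" where
  "dir_at E \<phi> x y = on_dir \<phi> \<cdot>\<^bsub>E\<^esub> pb_pair E (on_pos \<phi>) (p_tgt \<phi>) x y"

definition poly_id :: "('o, 'm) category \<Rightarrow> 'm \<Rightarrow> 'm poly_mor" where
  "poly_id E p =
     \<lparr>p_src = p, p_tgt = p, on_pos = Ident E (Cod E p), on_dir = pb_snd E (Ident E (Cod E p)) p\<rparr>"

text \<open>With \<open>x\<close>, \<open>z\<close> the projections of \<open>P \<times>\<^sub>R R\<^sub>*\<close>, the second component is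
  \<open>\<phi>\<^sup>\<sharp>(x, \<psi>\<^sup>\<sharp>(\<phi>\<^sub>1(x), z))\<close>, that is, \<open>\<phi>\<^sup>\<sharp> \<circ> (P \<times>\<^sub>Q \<psi>\<^sup>\<sharp>)\<close> up to
  \<open>P \<times>\<^sub>R R\<^sub>* \<cong> P \<times>\<^sub>Q (Q \<times>\<^sub>R R\<^sub>*)\<close>.\<close>

definition poly_comp :: "('o, 'm) category \<Rightarrow> 'm poly_mor \<Rightarrow> 'm poly_mor \<Rightarrow> 'm poly_mor" where
  "poly_comp E \<psi> \<phi> =
     (let m = on_pos \<psi> \<cdot>\<^bsub>E\<^esub> on_pos \<phi>;
          x = pb_fst E m (p_tgt \<psi>);
          z = pb_snd E m (p_tgt \<psi>)
      in \<lparr>p_src = p_src \<phi>, p_tgt = p_tgt \<psi>, on_pos = m,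
          on_dir = dir_at E \<phi> x (dir_at E \<psi> (on_pos \<phi> \<cdot>\<^bsub>E\<^esub> x) z)\<rparr>)"

definition Poly :: "('o, 'm) category \<Rightarrow> ('m, 'm poly_mor) category" where
  "Poly E =
     \<lparr>Obj = {p. exponentiable E p},
      Arr = {\<phi>. is_poly_mor E \<phi>},
      Dom = p_src,
      Cod = p_tgt,
      Ident = poly_id E,
      Comp = poly_comp E\<rparr>"


section \<open>The composition product\<close>

definition y_poly :: "('o, 'm) category \<Rightarrow> 'm" where
  "y_poly E = Ident E (terminal_obj E)"

text \<open>\<open>tri_base E p q : T \<rightarrow> P\<close> is \<open>\<Pi> p\<close> applied to the projection \<open>Q \<times> P\<^sub>* \<rightarrow> P\<^sub>*\<close>;
  \<open>tri_ev E p q : T \<times>\<^sub>P P\<^sub>* \<rightarrow> Q\<close> is the counit (an arrow \<open>T \<times>\<^sub>P P\<^sub>* \<rightarrow> Q \<times> P\<^sub>*\<close>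
  of \<open>E/P\<^sub>*\<close>) followed by the projection to \<open>Q\<close>.\<close>

definition tri_base :: "('o, 'm) category \<Rightarrow> 'm \<Rightarrow> 'm \<Rightarrow> 'm" where
  "tri_base E p q = on_obj (\<Pi>\<^bsub>E\<^esub> p) (prod_snd E (Cod E q) (Dom E p))"

definition tri_ev :: "('o, 'm) category \<Rightarrow> 'm \<Rightarrow> 'm \<Rightarrow> 'm" where
  "tri_ev E p q =
     prod_fst E (Cod E q) (Dom E p) \<cdot>\<^bsub>E\<^esub>
     fst (snd (Pi_counit E p (prod_snd E (Cod E q) (Dom E p))))"

definition tri :: "('o, 'm) category \<Rightarrow> 'm \<Rightarrow> 'm \<Rightarrow> 'm"  ("(_ \<triangleleft>\<index> _)" [71, 71] 70) where
  "p \<triangleleft>\<^bsub>E\<^esub> q = pb_fst E (tri_base E p q) p \<cdot>\<^bsub>E\<^esub> pb_fst E (tri_ev E p q) q"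

text \<open>Generalized elements of the positions of \<open>p \<triangleleft> q\<close>: the arrow \<open>X \<rightarrow> T\<close> corresponding to
  \<open>x : X \<rightarrow> P\<close> and \<open>f : X \<times>\<^sub>P P\<^sub>* \<rightarrow> Q\<close>, and (for \<open>u : X \<rightarrow> T\<close>) the two components \<open>x\<close> and \<open>f\<close>
  of \<open>u\<close>.\<close>

definition pos_fst :: "('o, 'm) category \<Rightarrow> 'm \<Rightarrow> 'm \<Rightarrow> 'm \<Rightarrow> 'm" where
  "pos_fst E p q u = tri_base E p q \<cdot>\<^bsub>E\<^esub> u"

definition pos_snd :: "('o, 'm) category \<Rightarrow> 'm \<Rightarrow> 'm \<Rightarrow> 'm \<Rightarrow> 'm" where
  "pos_snd E p q u =
     (let x = pos_fst E p q u
      in tri_ev E p q \<cdot>\<^bsub>E\<^esub>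
         pb_pair E (tri_base E p q) p (u \<cdot>\<^bsub>E\<^esub> pb_fst E x p) (pb_snd E x p))"

definition pos_pair :: "('o, 'm) category \<Rightarrow> 'm \<Rightarrow> 'm \<Rightarrow> 'm \<Rightarrow> 'm \<Rightarrow> 'm" where
  "pos_pair E p q x f =
     (THE u. u \<in> Hom E (Dom E x) (Cod E (p \<triangleleft>\<^bsub>E\<^esub> q)) \<and> pos_fst E p q u = x \<and> pos_snd E p q u = f)"

text \<open>Generalized elements of the directions of \<open>p \<triangleleft> q\<close>: the element over \<open>u : X \<rightarrow> T\<close> given by
  \<open>y : X \<rightarrow> P\<^sub>*\<close> and \<open>z : X \<rightarrow> Q\<^sub>*\<close>, and the two components of \<open>d : X \<rightarrow> (p \<triangleleft> q)\<^sub>*\<close>.\<close>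

definition dir_pair :: "('o, 'm) category \<Rightarrow> 'm \<Rightarrow> 'm \<Rightarrow> 'm \<Rightarrow> 'm \<Rightarrow> 'm \<Rightarrow> 'm" where
  "dir_pair E p q u y z = pb_pair E (tri_ev E p q) q (pb_pair E (tri_base E p q) p u y) z"

definition dir_fst :: "('o, 'm) category \<Rightarrow> 'm \<Rightarrow> 'm \<Rightarrow> 'm \<Rightarrow> 'm" where
  "dir_fst E p q d = pb_snd E (tri_base E p q) p \<cdot>\<^bsub>E\<^esub> (pb_fst E (tri_ev E p q) q \<cdot>\<^bsub>E\<^esub> d)"

definition dir_snd :: "('o, 'm) category \<Rightarrow> 'm \<Rightarrow> 'm \<Rightarrow> 'm \<Rightarrow> 'm" where
  "dir_snd E p q d = pb_snd E (tri_ev E p q) q \<cdot>\<^bsub>E\<^esub> d"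

text \<open>For \<open>\<phi> : p \<rightarrow> p'\<close> and \<open>\<psi> : q \<rightarrow> q'\<close>, the following two definitions give \<open>\<phi> \<triangleleft> \<psi>\<close> on the
  universal position (the identity of \<open>T\<close>, with components \<open>x\<close> and \<open>f\<close>) and on the universal
  direction \<open>(y', z')\<close> over its image.\<close>

definition tri_pos :: "('o, 'm) category \<Rightarrow> 'm poly_mor \<Rightarrow> 'm poly_mor \<Rightarrow> 'm" where
  "tri_pos E \<phi> \<psi> =
     (let p = p_src \<phi>; p' = p_tgt \<phi>; q = p_src \<psi>; q' = p_tgt \<psi>;
          x = tri_base E p q;
          f = tri_ev E p q;
          x' = on_pos \<phi> \<cdot>\<^bsub>E\<^esub> x;
          \<comment> \<open>\<open>(\<tau>, y') \<mapsto> (\<tau>, \<phi>\<^sup>\<sharp>(x(\<tau>), y'))\<close>, an arrow \<open>T \<times>\<^bsub>P'\<^esub> P'\<^sub>* \<rightarrow> T \<times>\<^sub>P P\<^sub>*\<close>\<close>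
          s = pb_pair E x p (pb_fst E x' p')
                (dir_at E \<phi> (x \<cdot>\<^bsub>E\<^esub> pb_fst E x' p') (pb_snd E x' p'))
      in pos_pair E p' q' x' (on_pos \<psi> \<cdot>\<^bsub>E\<^esub> (f \<cdot>\<^bsub>E\<^esub> s)))"

definition tri_dir :: "('o, 'm) category \<Rightarrow> 'm poly_mor \<Rightarrow> 'm poly_mor \<Rightarrow> 'm" where
  "tri_dir E \<phi> \<psi> =
     (let p = p_src \<phi>; p' = p_tgt \<phi>; q = p_src \<psi>; q' = p_tgt \<psi>;
          u = tri_pos E \<phi> \<psi>;
          a = pb_fst E u (p' \<triangleleft>\<^bsub>E\<^esub> q');
          d = pb_snd E u (p' \<triangleleft>\<^bsub>E\<^esub> q');
          y' = dir_fst E p' q' d;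
          z' = dir_snd E p' q' d;
          y = dir_at E \<phi> (tri_base E p q \<cdot>\<^bsub>E\<^esub> a) y';
          fy = tri_ev E p q \<cdot>\<^bsub>E\<^esub> pb_pair E (tri_base E p q) p a y;
          z = dir_at E \<psi> fy z'
      in dir_pair E p q a y z)"

definition tri_mor ::
  "('o, 'm) category \<Rightarrow> 'm poly_mor \<Rightarrow> 'm poly_mor \<Rightarrow> 'm poly_mor"  ("(_ \<triangleleft>m\<index> _)" [71, 71] 70) where
  "\<phi> \<triangleleft>m\<^bsub>E\<^esub> \<psi> =
     \<lparr>p_src = p_src \<phi> \<triangleleft>\<^bsub>E\<^esub> p_src \<psi>, p_tgt = p_tgt \<phi> \<triangleleft>\<^bsub>E\<^esub> p_tgt \<psi>,
      on_pos = tri_pos E \<phi> \<psi>, on_dir = tri_dir E \<phi> \<psi>\<rparr>"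

text \<open>\<open>c \<cong> y \<triangleleft> c\<close>: \<open>x \<mapsto> (*, \<lambda>_. x)\<close> on positions, \<open>(*, z) \<mapsto> z\<close> on directions.\<close>

definition left_unitor :: "('o, 'm) category \<Rightarrow> 'm \<Rightarrow> 'm poly_mor" where
  "left_unitor E c =
     (let y = y_poly E;
          b = bang E (Cod E c);
          u = pos_pair E y c b (pb_fst E b y)
      in \<lparr>p_src = c, p_tgt = y \<triangleleft>\<^bsub>E\<^esub> c, on_pos = u,
          on_dir = dir_snd E y c (pb_snd E u (y \<triangleleft>\<^bsub>E\<^esub> c))\<rparr>)"

text \<open>\<open>c \<cong> c \<triangleleft> y\<close>: \<open>x \<mapsto> (x, \<lambda>_. *)\<close> on positions, \<open>(y, *) \<mapsto> y\<close> on directions.\<close>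

definition right_unitor :: "('o, 'm) category \<Rightarrow> 'm \<Rightarrow> 'm poly_mor" where
  "right_unitor E c =
     (let y = y_poly E;
          i = Ident E (Cod E c);
          u = pos_pair E c y i (bang E (pb E i c))
      in \<lparr>p_src = c, p_tgt = c \<triangleleft>\<^bsub>E\<^esub> y, on_pos = u,
          on_dir = dir_fst E c y (pb_snd E u (c \<triangleleft>\<^bsub>E\<^esub> y))\<rparr>)"

text \<open>\<open>(p \<triangleleft> q) \<triangleleft> r \<cong> p \<triangleleft> (q \<triangleleft> r)\<close>: \<open>((x, f), g) \<mapsto> (x, \<lambda>y. (f(y), \<lambda>z. g(y, z)))\<close> on positions,
  \<open>(y, (z, w)) \<mapsto> ((y, z), w)\<close> on directions.\<close>

definition assoc_pos :: "('o, 'm) category \<Rightarrow> 'm \<Rightarrow> 'm \<Rightarrow> 'm \<Rightarrow> 'm" where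
  "assoc_pos E p q r =
     (let a = tri_base E (p \<triangleleft>\<^bsub>E\<^esub> q) r;
          g = tri_ev E (p \<triangleleft>\<^bsub>E\<^esub> q) r;
          x = pos_fst E p q a;
          f = pos_snd E p q a;
          \<comment> \<open>components of the universal element \<open>(\<tau>, y, z)\<close> of the pullback of \<open>f\<close> and \<open>q\<close>\<close>
          \<tau> = pb_fst E x p \<cdot>\<^bsub>E\<^esub> pb_fst E f q;
          y = pb_snd E x p \<cdot>\<^bsub>E\<^esub> pb_fst E f q;
          z = pb_snd E f q;
          g' = g \<cdot>\<^bsub>E\<^esub> pb_pair E a (p \<triangleleft>\<^bsub>E\<^esub> q) \<tau> (dir_pair E p q (a \<cdot>\<^bsub>E\<^esub> \<tau>) y z)
      in pos_pair E p (q \<triangleleft>\<^bsub>E\<^esub> r) x (pos_pair E q r f g'))"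

definition assoc_dir :: "('o, 'm) category \<Rightarrow> 'm \<Rightarrow> 'm \<Rightarrow> 'm \<Rightarrow> 'm" where
  "assoc_dir E p q r =
     (let u = assoc_pos E p q r;
          \<tau> = pb_fst E u (p \<triangleleft>\<^bsub>E\<^esub> (q \<triangleleft>\<^bsub>E\<^esub> r));
          d = pb_snd E u (p \<triangleleft>\<^bsub>E\<^esub> (q \<triangleleft>\<^bsub>E\<^esub> r));
          y = dir_fst E p (q \<triangleleft>\<^bsub>E\<^esub> r) d;
          v = dir_snd E p (q \<triangleleft>\<^bsub>E\<^esub> r) d;
          z = dir_fst E q r v;
          w = dir_snd E q r v
      in dir_pair E (p \<triangleleft>\<^bsub>E\<^esub> q) r \<tau>
           (dir_pair E p q (tri_base E (p \<triangleleft>\<^bsub>E\<^esub> q) r \<cdot>\<^bsub>E\<^esub> \<tau>) y z) w)"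

definition associator :: "('o, 'm) category \<Rightarrow> 'm \<Rightarrow> 'm \<Rightarrow> 'm \<Rightarrow> 'm poly_mor" where
  "associator E p q r =
     \<lparr>p_src = (p \<triangleleft>\<^bsub>E\<^esub> q) \<triangleleft>\<^bsub>E\<^esub> r, p_tgt = p \<triangleleft>\<^bsub>E\<^esub> (q \<triangleleft>\<^bsub>E\<^esub> r),
      on_pos = assoc_pos E p q r, on_dir = assoc_dir E p q r\<rparr>"


section \<open>Comonoids and internal categories\<close>

definition comonoid_structures :: "('o, 'm) category \<Rightarrow> 'm \<Rightarrow> ('m poly_mor \<times> 'm poly_mor) set" where
  "comonoid_structures E c =
     {(\<epsilon>, \<delta>).
        \<epsilon> \<in> Hom (Poly E) c (y_poly E) \<and>
        \<delta> \<in> Hom (Poly E) c (c \<triangleleft>\<^bsub>E\<^esub> c) \<and>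
        (\<epsilon> \<triangleleft>m\<^bsub>E\<^esub> Ident (Poly E) c) \<cdot>\<^bsub>Poly E\<^esub> \<delta> = left_unitor E c \<and>
        (Ident (Poly E) c \<triangleleft>m\<^bsub>E\<^esub> \<epsilon>) \<cdot>\<^bsub>Poly E\<^esub> \<delta> = right_unitor E c \<and>
        associator E c c c \<cdot>\<^bsub>Poly E\<^esub> ((\<delta> \<triangleleft>m\<^bsub>E\<^esub> Ident (Poly E) c) \<cdot>\<^bsub>Poly E\<^esub> \<delta>)
          = (Ident (Poly E) c \<triangleleft>m\<^bsub>E\<^esub> \<delta>) \<cdot>\<^bsub>Poly E\<^esub> \<delta>}"

text \<open>The pullback of \<open>t\<close> and \<open>s\<close> consists of the pairs \<open>(a, b)\<close> with \<open>t(a) = s(b)\<close>, and \<open>k(a, b)\<close> is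
  ``first \<open>a\<close>, then \<open>b\<close>''. Associativity is stated on the object of composable triples
  \<open>(C\<^sub>1 \<times> C\<^sub>1) \<times> C\<^sub>1\<close>, with projections \<open>a\<close>, \<open>b\<close>, \<open>d\<close>.\<close>

definition is_internal_category ::
  "('o, 'm) category \<Rightarrow> 'o \<Rightarrow> 'o \<Rightarrow> 'm \<Rightarrow> 'm \<Rightarrow> 'm \<Rightarrow> 'm \<Rightarrow> bool" where
  "is_internal_category E C\<^sub>0 C\<^sub>1 s t i k \<longleftrightarrow>
     C\<^sub>0 \<in> Obj E \<and> C\<^sub>1 \<in> Obj E \<and>
     s \<in> Hom E C\<^sub>1 C\<^sub>0 \<and> t \<in> Hom E C\<^sub>1 C\<^sub>0 \<and> i \<in> Hom E C\<^sub>0 C\<^sub>1 \<and> k \<in> Hom E (pb E t s) C\<^sub>1 \<and>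
     s \<cdot>\<^bsub>E\<^esub> i = Ident E C\<^sub>0 \<and> t \<cdot>\<^bsub>E\<^esub> i = Ident E C\<^sub>0 \<and>
     s \<cdot>\<^bsub>E\<^esub> k = s \<cdot>\<^bsub>E\<^esub> pb_fst E t s \<and> t \<cdot>\<^bsub>E\<^esub> k = t \<cdot>\<^bsub>E\<^esub> pb_snd E t s \<and>
     k \<cdot>\<^bsub>E\<^esub> pb_pair E t s (i \<cdot>\<^bsub>E\<^esub> s) (Ident E C\<^sub>1) = Ident E C\<^sub>1 \<and>
     k \<cdot>\<^bsub>E\<^esub> pb_pair E t s (Ident E C\<^sub>1) (i \<cdot>\<^bsub>E\<^esub> t) = Ident E C\<^sub>1 \<and>
     (let ab = pb_fst E (t \<cdot>\<^bsub>E\<^esub> pb_snd E t s) s;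
          d = pb_snd E (t \<cdot>\<^bsub>E\<^esub> pb_snd E t s) s;
          a = pb_fst E t s \<cdot>\<^bsub>E\<^esub> ab;
          b = pb_snd E t s \<cdot>\<^bsub>E\<^esub> ab
      in k \<cdot>\<^bsub>E\<^esub> pb_pair E t s (k \<cdot>\<^bsub>E\<^esub> ab) d = k \<cdot>\<^bsub>E\<^esub> pb_pair E t s a (k \<cdot>\<^bsub>E\<^esub> pb_pair E t s b d))"

definition internal_categories_with_source :: "('o, 'm) category \<Rightarrow> 'm \<Rightarrow> ('m \<times> 'm \<times> 'm) set" where
  "internal_categories_with_source E c =
     {(t, i, k). is_internal_category E (Cod E c) (Dom E c) c t i k}"

end

theory Submission
  imports Defs
begin

text \<open>Everything is computed on generalized elements. A morphism \<open>X \<rightarrow> T\<close> into the positions of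
  \<open>p \<triangleleft> q\<close> is a pair of \<open>x : X \<rightarrow> P\<close> and \<open>f : X \<times>\<^sub>P P\<^sub>* \<rightarrow> Q\<close>, and two such morphisms agree as soon as they
  lie over the same \<open>x\<close> and take the same values \<open>f(y)\<close> on all generalized elements \<open>y\<close> over \<open>x\<close>.
  This applies to \<open>(c \<triangleleft> c) \<triangleleft> c\<close> because exponentiable arrows are closed under pullback and composition.

  For a comonoid \<open>(\<epsilon>, \<delta>)\<close> on \<open>c\<close>, \<open>\<epsilon>\<close> amounts to a section \<open>i\<close> of \<open>c\<close>. The right counit law on
  positions forces the first component of \<open>\<delta>\<^sub>1\<close> to be the identity, so \<open>\<delta>\<^sub>1(x) = (x, t)\<close> for an arrow
  \<open>t : C\<^sub>* \<rightarrow> C\<close>, and \<open>\<delta>\<^sup>\<sharp>\<close> becomes an arrow \<open>k\<close> on the pairs \<open>(a, b)\<close> with \<open>t(a) = c(b)\<close> such that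
  \<open>c(k(a, b)) = c(a)\<close>. Under this translation the position parts of the left counit and
  coassociativity laws are \<open>t \<circ> i = id\<close> and \<open>t(k(a, b)) = t(b)\<close>, and the direction parts of the three
  laws are the unit and associativity laws of \<open>k\<close>.\<close>

section \<open>Categories with finite limits\<close>

text \<open>Pullbacks, the terminal object and the right adjoint of \<open>\<Delta> c\<close> are
  arbitrary choices, so \<open>c \<triangleleft> c\<close> is known only through universal
  properties, while morphisms of polynomials are compared as actual arrows relative to these
  choices. Generalized elements avoid all transport along comparison isomorphisms: an arrow out of a
  pullback is the same as a natural operation on pairs, and an equation of such arrows holds once it
  holds on the generic pair of projections. The category is not assumed locally cartesian closed, so
  each right adjoint beyond the one for \<open>c\<close> has to be constructed. The right counit law
  fixes the first component of \<open>\<delta>\<close> because tensoring with the identity on the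
  left leaves first components alone, and the right unitor has the identity there. In the left
  counit law the position \<open>(x, t)\<close> is evaluated at the direction \<open>i(x)\<close>,
  and in coassociativity the two sides evaluate at \<open>(a, b)\<close> to
  \<open>t(k(a, b))\<close> and to \<open>t(b)\<close>; this is where the codomain equations come
  from.\<close>

locale cat =
  fixes E :: "('o, 'm) category" (structure)
  assumes category: "is_category E"
begin

abbreviation "arr \<equiv> \<lambda>f. f \<in> Arr E"
abbreviation "obj \<equiv> \<lambda>X. X \<in> Obj E"
abbreviation "src \<equiv> Dom E"
abbreviation "tgt \<equiv> Cod E"
abbreviation "ide \<equiv> Ident E"
lemma obj_src_tgt [simp]: "arr f \<Longrightarrow> obj (src f)" "arr f \<Longrightarrow> obj (tgt f)"
  using category by (auto simp: is_category_def)

lemma ide_simps [simp]: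
  assumes "obj X"
  shows "arr (ide X)" "src (ide X) = X" "tgt (ide X) = X"
  using category assms by (auto simp: is_category_def Hom_def)

lemma comp_simps [simp]:
  assumes "arr f" "arr g" "tgt f = src g"
  shows "arr (g \<cdot> f)" "src (g \<cdot> f) = src f" "tgt (g \<cdot> f) = tgt g"
  using category assms by (auto simp: is_category_def Hom_def)

lemma comp_ide [simp]:
  "arr f \<Longrightarrow> X = src f \<Longrightarrow> f \<cdot> ide X = f" "arr f \<Longrightarrow> Y = tgt f \<Longrightarrow> ide Y \<cdot> f = f"
  using category by (auto simp: is_category_def)

lemma comp_assoc [simp]:
  assumes "arr f" "arr g" "arr h" "tgt f = src g" "tgt g = src h"
  shows "(h \<cdot> g) \<cdot> f = h \<cdot> (g \<cdot> f)"
  using category assms by (auto simp: is_category_def)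

text \<open>Composites are kept bracketed to the right, so an equation for
  \<open>g \<cdot> f\<close> does not match inside \<open>g \<cdot> (f \<cdot> x)\<close>. This
  supplies the prolonged form for rewriting.\<close>

lemma reassoc:
  assumes "g \<cdot> f = h" "arr f" "arr g" "tgt f = src g" "arr x" "tgt x = src f"
  shows "g \<cdot> (f \<cdot> x) = h \<cdot> x"
  using assms comp_assoc[of x f g] by simp

end

locale finlim = cat E
  for E :: "('o, 'm) category" (structure) +
  assumes finite_limits: "has_finite_limits E"
begin

abbreviation "pair \<equiv> pb_pair E"
abbreviation "p1 \<equiv> pb_fst E"
abbreviation "p2 \<equiv> pb_snd E"
abbreviation "one \<equiv> terminal_obj E"

lemma terminal: "is_terminal E one"
proof -
  \<comment> \<open>Over the empty shape a cone is just an object, so a limit is a terminal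
    object.\<close>
  define J :: "(nat, nat) category" where
    "J = \<lparr>Obj = {}, Arr = {}, Dom = id, Cod = id, Ident = id, Comp = \<lambda>g f. f\<rparr>"
  define F :: "(nat, nat, 'o, 'm) cfunctor" where
    "F = \<lparr>on_obj = \<lambda>_. undefined, on_arr = \<lambda>_. undefined\<rparr>"
  have "is_category J" "is_functor J E F" "finite (Obj J)" "finite (Arr J)"
    by (auto simp: is_category_def is_functor_def J_def)
  then obtain L \<pi> where "is_limit J E F L \<pi>"
    using finite_limits unfolding has_finite_limits_def by blast
  then have "is_terminal E L"
    by (auto simp: is_limit_def is_cone_def is_terminal_def J_def)
  then show ?thesis
    unfolding terminal_obj_def by (rule someI)
qed

lemma obj_one [simp]: "obj one"
  using terminal by (auto simp: is_terminal_def)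

lemma bang_simps [simp]:
  assumes "obj X"
  shows "arr (bang E X)" "src (bang E X) = X" "tgt (bang E X) = one"
proof -
  have "\<exists>!u. u \<in> Hom E X one"
    using terminal assms by (simp add: is_terminal_def)
  then have "bang E X \<in> Hom E X one"
    unfolding bang_def by (rule theI')
  then show "arr (bang E X)" "src (bang E X) = X" "tgt (bang E X) = one"
    by (auto simp: Hom_def)
qed

lemma terminal_unique:
  assumes "arr f" "arr g" "src f = src g" "tgt f = one" "tgt g = one"
  shows "f = g"
proof -
  have "\<exists>!u. u \<in> Hom E (src f) one"
    using terminal assms by (auto simp: is_terminal_def)
  then show ?thesis using assms by (auto simp: Hom_def)
qed

lemma bang_comp [simp]: "arr f \<Longrightarrow> tgt f = X \<Longrightarrow> bang E X \<cdot> f = bang E (src f)"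
  by (rule terminal_unique) auto

lemma pullback_exists:
  assumes "arr f" "arr g" "tgt f = tgt g"
  shows "\<exists>a b. is_pullback E f g a b"
proof -
  \<comment> \<open>The cospan shape: \<open>3\<close> goes from \<open>0\<close> to
    \<open>2\<close>, \<open>4\<close> goes from \<open>1\<close> to \<open>2\<close>, and each
    object is its own identity. Of two composable arrows at least one is an identity, so
    \<open>Comp\<close> merely picks the other.\<close>
  define J :: "(nat, nat) category" where
    "J = \<lparr>Obj = {0, 1, 2}, Arr = {0, 1, 2, 3, 4},
          Dom = (\<lambda>n. if n = 3 then 0 else if n = 4 then 1 else n),
          Cod = (\<lambda>n. if n = 3 \<or> n = 4 then 2 else n), Ident = id,
          Comp = \<lambda>n m. if m = 3 \<or> m = 4 then m else n\<rparr>"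
  define F :: "(nat, nat, 'o, 'm) cfunctor" where
    "F = \<lparr>on_obj = \<lambda>n. if n = 0 then src f else if n = 1 then src g else tgt f,
          on_arr = \<lambda>n. if n = 0 then ide (src f) else if n = 1 then ide (src g)
            else if n = 2 then ide (tgt f) else if n = 3 then f else g\<rparr>"
  have J: "is_category J" "finite (Obj J)" "finite (Arr J)"
    by (auto simp: is_category_def J_def Hom_def)
  have F: "is_functor J E F"
    using assms by (auto simp: is_functor_def J_def F_def Hom_def)
  obtain L \<pi> where L: "is_limit J E F L \<pi>"
    using finite_limits J F unfolding has_finite_limits_def by blast
  have cone: "is_cone J E F L \<pi>"
    using L by (simp add: is_limit_def)
  have "is_pullback E f g (\<pi> 0) (\<pi> 1)"
    unfolding is_pullback_def
  proof (intro conjI allI ballI impI)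
    fix Z h k
    assume hk: "h \<in> Hom E Z (src f)" "k \<in> Hom E Z (src g)" "f \<cdot> h = g \<cdot> k"
    \<comment> \<open>The leg at \<open>2\<close> is forced to be the common composite
      \<open>f \<cdot> h = g \<cdot> k\<close>; likewise the leg of the limit at \<open>2\<close> is
      \<open>f \<cdot> \<pi> 0\<close>, so only the legs at \<open>0\<close> and \<open>1\<close>
      carry information.\<close>
    define \<tau> where "\<tau> = (\<lambda>n::nat. if n = 0 then h else if n = 1 then k else f \<cdot> h)"
    have "is_cone J E F Z \<tau>"
      using hk assms by (auto simp: is_cone_def J_def F_def \<tau>_def Hom_def)
    then have ex1: "\<exists>!u. u \<in> Hom E Z L \<and> (\<forall>i \<in> Obj J. \<pi> i \<cdot> u = \<tau> i)"
      using L by (simp add: is_limit_def)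
    have "(\<forall>i \<in> Obj J. \<pi> i \<cdot> u = \<tau> i) \<longleftrightarrow> \<pi> 0 \<cdot> u = h \<and> \<pi> 1 \<cdot> u = k"
      if u: "u \<in> Hom E Z L" for u
    proof -
      have "\<pi> 2 = f \<cdot> \<pi> 0"
        using cone by (force simp: is_cone_def J_def F_def)
      then have "\<pi> 2 \<cdot> u = f \<cdot> (\<pi> 0 \<cdot> u)"
        using cone u assms by (auto simp: is_cone_def J_def F_def Hom_def)
      then show ?thesis by (auto simp: J_def \<tau>_def)
    qed
    then have "(u \<in> Hom E Z L \<and> (\<forall>i \<in> Obj J. \<pi> i \<cdot> u = \<tau> i)) \<longleftrightarrow>
        (u \<in> Hom E Z L \<and> \<pi> 0 \<cdot> u = h \<and> \<pi> 1 \<cdot> u = k)" for u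
      by blast
    moreover have "src (\<pi> 0) = L"
      using cone by (auto simp: is_cone_def J_def F_def Hom_def)
    ultimately show "\<exists>!u. u \<in> Hom E Z (src (\<pi> 0)) \<and> \<pi> 0 \<cdot> u = h \<and> \<pi> 1 \<cdot> u = k"
      using ex1 by simp
  qed (use cone assms in \<open>force simp: is_cone_def J_def F_def Hom_def\<close>)+
  then show ?thesis by blast
qed

lemma is_pullback_pullback:
  assumes "arr f" "arr g" "tgt f = tgt g"
  shows "is_pullback E f g (p1 f g) (p2 f g)"
proof -
  obtain a b where "is_pullback E f g a b"
    using pullback_exists[OF assms] by blast
  then have "case pullback E f g of (a, b) \<Rightarrow> is_pullback E f g a b"
    unfolding pullback_def
    using someI[where P = "\<lambda>(a, b). is_pullback E f g a b" and x = "(a, b)"] by simp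
  then show ?thesis by (simp add: case_prod_beta)
qed

lemma pb_simps [simp]:
  assumes "arr f" "arr g" "tgt f = tgt g"
  shows "arr (p1 f g)" "arr (p2 f g)" "src (p1 f g) = pb E f g" "src (p2 f g) = pb E f g"
    "tgt (p1 f g) = src f" "tgt (p2 f g) = src g"
  using is_pullback_pullback[OF assms] by (auto simp: is_pullback_def pb_def)

lemma obj_pb [simp]: "arr f \<Longrightarrow> arr g \<Longrightarrow> tgt f = tgt g \<Longrightarrow> obj (pb E f g)"
  using obj_src_tgt(1)[of "p1 f g"] by simp

lemma pb_commutes: "arr f \<Longrightarrow> arr g \<Longrightarrow> tgt f = tgt g \<Longrightarrow> f \<cdot> p1 f g = g \<cdot> p2 f g"
  using is_pullback_pullback by (simp add: is_pullback_def)

text \<open>\<open>(h, k)\<close> is a generalized element of the pullback of \<open>f\<close> and \<open>g\<close>.\<close>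

definition over :: "'m \<Rightarrow> 'm \<Rightarrow> 'm \<Rightarrow> 'm \<Rightarrow> bool" where
  "over f g h k \<longleftrightarrow> arr h \<and> arr k \<and> src h = src k \<and> tgt h = src f \<and> tgt k = src g \<and> f \<cdot> h = g \<cdot> k"

lemma pair_ex1:
  assumes "arr f" "arr g" "tgt f = tgt g" "over f g h k"
  shows "\<exists>!u. u \<in> Hom E (src h) (pb E f g) \<and> p1 f g \<cdot> u = h \<and> p2 f g \<cdot> u = k"
proof -
  have "\<forall>Z. \<forall>h \<in> Hom E Z (src f). \<forall>k \<in> Hom E Z (src g). f \<cdot> h = g \<cdot> k \<longrightarrow>
      (\<exists>!u. u \<in> Hom E Z (pb E f g) \<and> p1 f g \<cdot> u = h \<and> p2 f g \<cdot> u = k)"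
    using is_pullback_pullback[OF assms(1-3)] assms(1-3) by (simp add: is_pullback_def)
  moreover have "h \<in> Hom E (src h) (src f)" "k \<in> Hom E (src h) (src g)" "f \<cdot> h = g \<cdot> k"
    using assms(4) by (auto simp: Hom_def over_def)
  ultimately show ?thesis by blast
qed

lemma pair:
  assumes "arr f" "arr g" "tgt f = tgt g" "over f g h k"
  shows "arr (pair f g h k)" "src (pair f g h k) = src h" "tgt (pair f g h k) = pb E f g"
    "p1 f g \<cdot> pair f g h k = h" "p2 f g \<cdot> pair f g h k = k"
  using theI'[OF pair_ex1[OF assms]] unfolding pb_pair_def[symmetric] by (auto simp: Hom_def)

lemma pb_eqI:
  assumes "p1 f g \<cdot> u = p1 f g \<cdot> v" "p2 f g \<cdot> u = p2 f g \<cdot> v"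
    "arr f" "arr g" "tgt f = tgt g" "arr u" "arr v" "src u = src v"
    "tgt u = pb E f g" "tgt v = pb E f g"
  shows "u = v"
proof -
  have "f \<cdot> (p1 f g \<cdot> v) = g \<cdot> (p2 f g \<cdot> v)"
    using assms by (simp add: pb_commutes flip: comp_assoc)
  then have "over f g (p1 f g \<cdot> v) (p2 f g \<cdot> v)"
    using assms by (simp add: over_def)
  from pair_ex1[OF assms(3-5) this] show ?thesis
    using assms by (auto simp: Hom_def)
qed

lemmas pb_commutes' = reassoc[OF pb_commutes]

lemma pair_simps [simp]:
  assumes "arr f" "arr g" "tgt f = tgt g"
    "arr h" "arr k" "src h = src k" "tgt h = src f" "tgt k = src g" "f \<cdot> h = g \<cdot> k"
  shows "arr (pair f g h k)" "src (pair f g h k) = src h" "tgt (pair f g h k) = pb E f g"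
    "p1 f g \<cdot> pair f g h k = h" "p2 f g \<cdot> pair f g h k = k"
  using pair[OF assms(1-3)] assms by (auto simp: over_def)

lemmas pair_simps' [simp] = pair_simps(4,5)[THEN reassoc]

text \<open>Pairing is natural in its source, so restricting a generalized element along
  \<open>x\<close> means restricting its two components.\<close>

lemma pair_comp [simp]:
  assumes "arr f" "arr g" "tgt f = tgt g"
    "arr h" "arr k" "src h = src k" "tgt h = src f" "tgt k = src g" "f \<cdot> h = g \<cdot> k"
    "arr x" "tgt x = src h"
  shows "pair f g h k \<cdot> x = pair f g (h \<cdot> x) (k \<cdot> x)"
  by (rule pb_eqI[of f g]) (use assms reassoc[of f h "g \<cdot> k" x] in simp_all)

lemma pair_p1_p2 [simp]:
  assumes "arr f" "arr g" "tgt f = tgt g"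
  shows "pair f g (p1 f g) (p2 f g) = ide (pb E f g)"
  by (rule pb_eqI[of f g]) (use assms pb_commutes in simp_all)

lemma pair_eta:
  assumes "arr f" "arr g" "tgt f = tgt g" "arr u" "tgt u = pb E f g"
  shows "pair f g (p1 f g \<cdot> u) (p2 f g \<cdot> u) = u"
  by (rule pb_eqI[of f g]) (use assms pb_commutes' in simp_all)

end

section \<open>Adjunctions and universal arrows\<close>

lemma HomD: "f \<in> Hom E X Y \<Longrightarrow> f \<in> Arr E \<and> Dom E f = X \<and> Cod E f = Y"
  by (simp add: Hom_def)

lemma HomI: "f \<in> Arr E \<Longrightarrow> Dom E f = X \<Longrightarrow> Cod E f = Y \<Longrightarrow> f \<in> Hom E X Y"
  by (simp add: Hom_def)

locale cfun = C: cat C + D: cat D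
  for C :: "('o1, 'm1) category" and D :: "('o2, 'm2) category" +
  fixes F :: "('o1, 'm1, 'o2, 'm2) cfunctor"
  assumes functorial: "is_functor C D F"
begin

lemma obj [simp]: "X \<in> Obj C \<Longrightarrow> on_obj F X \<in> Obj D"
  using functorial by (simp add: is_functor_def)

lemma arr [simp]:
  assumes "f \<in> Arr C"
  shows "on_arr F f \<in> Arr D" "Dom D (on_arr F f) = on_obj F (Dom C f)"
    "Cod D (on_arr F f) = on_obj F (Cod C f)"
  using functorial assms by (auto simp: is_functor_def Hom_def)

lemma ide [simp]: "X \<in> Obj C \<Longrightarrow> on_arr F (Ident C X) = Ident D (on_obj F X)"
  using functorial by (simp add: is_functor_def)

lemma comp:
  "f \<in> Arr C \<Longrightarrow> g \<in> Arr C \<Longrightarrow> Cod C f = Dom C g \<Longrightarrow>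
    on_arr F (g \<cdot>\<^bsub>C\<^esub> f) = on_arr F g \<cdot>\<^bsub>D\<^esub> on_arr F f"
  using functorial by (simp add: is_functor_def)

text \<open>The transpose of \<open>h\<close> is \<open>on_arr G h\<close> after the unit.
  Naturality of the counit and one triangle identity give the factorization; naturality of the unit
  and the other triangle identity give uniqueness.\<close>

lemma adjunction_universal:
  assumes adj: "is_adjunction C D F G \<eta> \<epsilon>"
    and X: "X \<in> Obj C" and Y: "Y \<in> Obj D" and h: "h \<in> Hom D (on_obj F X) Y"
  shows "\<exists>!u. u \<in> Hom C X (on_obj G Y) \<and> \<epsilon> Y \<cdot>\<^bsub>D\<^esub> on_arr F u = h"
proof -
  interpret G: cfun D C G
    using adj by unfold_locales (simp add: is_adjunction_def)
  have \<eta>: "\<eta> Z \<in> Arr C" "Dom C (\<eta> Z) = Z" "Cod C (\<eta> Z) = on_obj G (on_obj F Z)" if "Z \<in> Obj C" for Z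
    using adj that by (auto simp: is_adjunction_def is_nat_trans_def id_functor_def comp_functor_def Hom_def)
  have \<epsilon>: "\<epsilon> Z \<in> Arr D" "Cod D (\<epsilon> Z) = Z" "Dom D (\<epsilon> Z) = on_obj F (on_obj G Z)" if "Z \<in> Obj D" for Z
    using adj that by (auto simp: is_adjunction_def is_nat_trans_def id_functor_def comp_functor_def Hom_def)
  have nat\<eta>: "on_arr G (on_arr F f) \<cdot>\<^bsub>C\<^esub> \<eta> (Dom C f) = \<eta> (Cod C f) \<cdot>\<^bsub>C\<^esub> f" if "f \<in> Arr C" for f
    using adj that by (auto simp: is_adjunction_def is_nat_trans_def id_functor_def comp_functor_def)
  have nat\<epsilon>: "f \<cdot>\<^bsub>D\<^esub> \<epsilon> (Dom D f) = \<epsilon> (Cod D f) \<cdot>\<^bsub>D\<^esub> on_arr F (on_arr G f)" if "f \<in> Arr D" for f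
    using adj that by (auto simp: is_adjunction_def is_nat_trans_def id_functor_def comp_functor_def)
  have t1: "\<epsilon> (on_obj F X) \<cdot>\<^bsub>D\<^esub> on_arr F (\<eta> X) = Ident D (on_obj F X)"
    using adj X by (simp add: is_adjunction_def)
  have t2: "on_arr G (\<epsilon> Y) \<cdot>\<^bsub>C\<^esub> \<eta> (on_obj G Y) = Ident C (on_obj G Y)"
    using adj Y by (simp add: is_adjunction_def)
  note h = HomD[OF h]
  show ?thesis
  proof (rule ex1I[of _ "on_arr G h \<cdot>\<^bsub>C\<^esub> \<eta> X"])
    have "\<epsilon> Y \<cdot>\<^bsub>D\<^esub> on_arr F (on_arr G h \<cdot>\<^bsub>C\<^esub> \<eta> X)
        = (\<epsilon> Y \<cdot>\<^bsub>D\<^esub> on_arr F (on_arr G h)) \<cdot>\<^bsub>D\<^esub> on_arr F (\<eta> X)"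
      using X Y h \<eta> \<epsilon> by (simp add: comp)
    also have "\<dots> = (h \<cdot>\<^bsub>D\<^esub> \<epsilon> (on_obj F X)) \<cdot>\<^bsub>D\<^esub> on_arr F (\<eta> X)"
      using nat\<epsilon>[of h] h by simp
    also have "\<dots> = h"
      using X Y h \<eta> \<epsilon> t1 by simp
    finally show "on_arr G h \<cdot>\<^bsub>C\<^esub> \<eta> X \<in> Hom C X (on_obj G Y) \<and>
        \<epsilon> Y \<cdot>\<^bsub>D\<^esub> on_arr F (on_arr G h \<cdot>\<^bsub>C\<^esub> \<eta> X) = h"
      using X Y h \<eta> by (auto intro!: HomI)
  next
    fix u assume "u \<in> Hom C X (on_obj G Y) \<and> \<epsilon> Y \<cdot>\<^bsub>D\<^esub> on_arr F u = h"
    then have u: "u \<in> Arr C" "Dom C u = X" "Cod C u = on_obj G Y" "\<epsilon> Y \<cdot>\<^bsub>D\<^esub> on_arr F u = h"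
      by (auto dest: HomD)
    have "on_arr G h \<cdot>\<^bsub>C\<^esub> \<eta> X = on_arr G (\<epsilon> Y) \<cdot>\<^bsub>C\<^esub> (on_arr G (on_arr F u) \<cdot>\<^bsub>C\<^esub> \<eta> X)"
      unfolding u(4)[symmetric] using X Y u(1-3) \<eta> \<epsilon> by (simp add: G.comp)
    also have "\<dots> = (on_arr G (\<epsilon> Y) \<cdot>\<^bsub>C\<^esub> \<eta> (on_obj G Y)) \<cdot>\<^bsub>C\<^esub> u"
      using nat\<eta>[of u] X Y u(1-3) \<eta> \<epsilon> by simp
    also have "\<dots> = u"
      using t2 u(1-3) by simp
    finally show "u = on_arr G h \<cdot>\<^bsub>C\<^esub> \<eta> X" by simp
  qed
qed

text \<open>Exponentiability asks for a whole adjunction, whereas the constructions below produce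
  the right adjoint on objects together with its counit. Its action on arrows and the unit are then
  forced as transposes.\<close>

lemma adjunction_from_universal:
  assumes G: "\<And>Y. Y \<in> Obj D \<Longrightarrow> G Y \<in> Obj C"
    and \<epsilon>: "\<And>Y. Y \<in> Obj D \<Longrightarrow> \<epsilon> Y \<in> Hom D (on_obj F (G Y)) Y"
    and univ: "\<And>X Y h. X \<in> Obj C \<Longrightarrow> Y \<in> Obj D \<Longrightarrow> h \<in> Hom D (on_obj F X) Y \<Longrightarrow>
      \<exists>!u. u \<in> Hom C X (G Y) \<and> \<epsilon> Y \<cdot>\<^bsub>D\<^esub> on_arr F u = h"
  shows "\<exists>G' \<eta>. is_adjunction C D F G' \<eta> \<epsilon>"
proof -
  define tr where "tr = (\<lambda>X Y h. THE u. u \<in> Hom C X (G Y) \<and> \<epsilon> Y \<cdot>\<^bsub>D\<^esub> on_arr F u = h)"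
  have \<epsilon>_simps [simp]: "\<epsilon> Y \<in> Arr D" "Dom D (\<epsilon> Y) = on_obj F (G Y)" "Cod D (\<epsilon> Y) = Y"
    if "Y \<in> Obj D" for Y
    using \<epsilon>[OF that] by (auto dest: HomD)
  have tr_simps [simp]: "tr X Y h \<in> Arr C" "Dom C (tr X Y h) = X" "Cod C (tr X Y h) = G Y"
    "\<epsilon> Y \<cdot>\<^bsub>D\<^esub> on_arr F (tr X Y h) = h"
    if "X \<in> Obj C" "Y \<in> Obj D" "h \<in> Arr D" "Dom D h = on_obj F X" "Cod D h = Y" for X Y h
    using theI'[OF univ, of X Y h] that unfolding tr_def by (auto intro: HomI dest: HomD)
  have tr_reassoc [simp]: "\<epsilon> Y \<cdot>\<^bsub>D\<^esub> (on_arr F (tr X Y h) \<cdot>\<^bsub>D\<^esub> k) = h \<cdot>\<^bsub>D\<^esub> k"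
    if "X \<in> Obj C" "Y \<in> Obj D" "h \<in> Arr D" "Dom D h = on_obj F X" "Cod D h = Y"
      "k \<in> Arr D" "Cod D k = on_obj F X" for X Y h k
    using D.reassoc[OF tr_simps(4)[OF that(1-5)]] that by simp
  \<comment> \<open>Every remaining law is an equation of arrows into some \<open>G Y\<close>, so it
    is checked after applying \<open>F\<close> and composing with the counit.\<close>
  have tr_eqI: "u = v" if "\<epsilon> Y \<cdot>\<^bsub>D\<^esub> on_arr F u = \<epsilon> Y \<cdot>\<^bsub>D\<^esub> on_arr F v" "Y \<in> Obj D"
    "u \<in> Arr C" "v \<in> Arr C" "Dom C u = Dom C v" "Cod C u = G Y" "Cod C v = G Y" for u v Y
  proof -
    have "\<exists>!w. w \<in> Hom C (Dom C v) (G Y) \<and> \<epsilon> Y \<cdot>\<^bsub>D\<^esub> on_arr F w = \<epsilon> Y \<cdot>\<^bsub>D\<^esub> on_arr F v"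
      by (rule univ) (use that in \<open>auto intro!: HomI\<close>)
    then show ?thesis using that by (auto simp: Hom_def)
  qed
  define G' where "G' = \<lparr>on_obj = G, on_arr = \<lambda>f. tr (G (Dom D f)) (Cod D f) (f \<cdot>\<^bsub>D\<^esub> \<epsilon> (Dom D f))\<rparr>"
  define \<eta> where "\<eta> = (\<lambda>X. tr X (on_obj F X) (Ident D (on_obj F X)))"
  have G': "is_functor D C G'"
    unfolding is_functor_def
  proof (intro conjI ballI impI)
    fix X assume "X \<in> Obj D"
    with G show "on_arr G' (Ident D X) = Ident C (on_obj G' X)"
      by - (rule tr_eqI[of X], auto simp: G'_def)
  next
    fix f g assume "f \<in> Arr D" "g \<in> Arr D" "Cod D f = Dom D g"
    with G show "on_arr G' (g \<cdot>\<^bsub>D\<^esub> f) = on_arr G' g \<cdot>\<^bsub>C\<^esub> on_arr G' f"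
      by - (rule tr_eqI[of "Cod D g"], auto simp: G'_def comp)
  qed (use G in \<open>auto simp: G'_def intro!: HomI\<close>)
  interpret G': cfun D C G'
    by unfold_locales (rule G')
  have "is_nat_trans C C id_functor (comp_functor G' F) \<eta>"
    unfolding is_nat_trans_def
  proof (intro conjI ballI)
    fix f assume "f \<in> Arr C"
    with G show "on_arr (comp_functor G' F) f \<cdot>\<^bsub>C\<^esub> \<eta> (Dom C f) = \<eta> (Cod C f) \<cdot>\<^bsub>C\<^esub> on_arr id_functor f"
      by - (rule tr_eqI[of "on_obj F (Cod C f)"], auto simp: G'_def comp comp_functor_def id_functor_def \<eta>_def)
  next
    show "is_functor C C (comp_functor G' F)"
      unfolding is_functor_def by (auto simp: comp_functor_def comp G'.comp intro!: HomI)
  qed (use G in \<open>auto simp: G'_def comp_functor_def id_functor_def is_functor_def \<eta>_def intro!: HomI\<close>)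
  moreover have "is_nat_trans D D (comp_functor F G') id_functor \<epsilon>"
    unfolding is_nat_trans_def
  proof (intro conjI ballI)
    show "is_functor D D (comp_functor F G')"
      unfolding is_functor_def by (auto simp: comp_functor_def comp G'.comp intro!: HomI)
  qed (use G in \<open>auto simp: G'_def comp_functor_def id_functor_def is_functor_def intro!: HomI\<close>)
  moreover have "on_arr G' (\<epsilon> Y) \<cdot>\<^bsub>C\<^esub> \<eta> (on_obj G' Y) = Ident C (on_obj G' Y)" if "Y \<in> Obj D" for Y
    by (rule tr_eqI[of Y]) (use that G in \<open>auto simp: G'_def \<eta>_def comp\<close>)
  moreover have "\<epsilon> (on_obj F X) \<cdot>\<^bsub>D\<^esub> on_arr F (\<eta> X) = Ident D (on_obj F X)" if "X \<in> Obj C" for X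
    using that by (simp add: \<eta>_def)
  ultimately show ?thesis
    using functorial G' unfolding is_adjunction_def by blast
qed

end

section \<open>Slice categories and the pullback functor\<close>

context finlim
begin

lemma slice_simps:
  "x \<in> Obj (slice E A) \<longleftrightarrow> arr x \<and> tgt x = A"
  "(x, h, y) \<in> Arr (slice E A) \<longleftrightarrow>
    arr x \<and> arr y \<and> arr h \<and> tgt x = A \<and> tgt y = A \<and> src x = src h \<and> src y = tgt h \<and> y \<cdot> h = x"
  "Dom (slice E A) (x, h, y) = x" "Cod (slice E A) (x, h, y) = y"
  "Ident (slice E A) x = (x, ide (src x), x)"
  "Comp (slice E A) (y', k, z) (x, h, y) = (x, k \<cdot> h, z)"
  unfolding slice_def Hom_def by (simp_all, metis)

text \<open>Exposes the three components of a slice arrow, so that the laws of slices and functors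
  become equations in \<open>E\<close>.\<close>

lemma slice_ball:
  "(\<forall>f \<in> Arr (slice E A). P f) \<longleftrightarrow>
    (\<forall>x h y. arr x \<and> arr y \<and> arr h \<and> tgt x = A \<and> tgt y = A \<and> src x = src h \<and> src y = tgt h \<and> y \<cdot> h = x
      \<longrightarrow> P (x, h, y))"
  by (metis slice_simps(2) prod_cases3)

lemma pullback_functor_simps:
  "on_obj (\<Delta> p) x = p2 x p"
  "on_arr (\<Delta> p) (x, h, y) = (p2 x p, pair y p (h \<cdot> p1 x p) (p2 x p), p2 y p)"
  by (auto simp: pullback_functor_def)

lemma slice_category: "is_category (slice E A)"
  unfolding is_category_def Hom_def slice_ball
proof (intro conjI allI ballI impI)
  fix x h y x' h' y'
  assume "arr x \<and> arr y \<and> arr h \<and> tgt x = A \<and> tgt y = A \<and> src x = src h \<and> src y = tgt h \<and> y \<cdot> h = x"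
    and "arr x' \<and> arr y' \<and> arr h' \<and> tgt x' = A \<and> tgt y' = A \<and> src x' = src h' \<and> src y' = tgt h' \<and> y' \<cdot> h' = x'"
    and "Cod (slice E A) (x, h, y) = Dom (slice E A) (x', h', y')"
  then show "(x', h', y') \<cdot>\<^bsub>slice E A\<^esub> (x, h, y) \<in>
      {f \<in> Arr (slice E A). Dom (slice E A) f = Dom (slice E A) (x, h, y) \<and>
        Cod (slice E A) f = Cod (slice E A) (x', h', y')}"
    by (simp add: slice_simps, elim conjE, metis comp_assoc comp_simps)
qed (auto simp: slice_simps)

lemma pullback_functor:
  assumes p: "arr p"
  shows "is_functor (slice E (tgt p)) (slice E (src p)) (\<Delta> p)"
proof -
  \<comment> \<open>The commuting square under which the pairing in \<open>pullback_functor\<close>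
    is defined.\<close>
  have c: "y \<cdot> (h \<cdot> p1 x p) = p \<cdot> p2 x p"
    if "arr y" "arr h" "tgt h = src y" "tgt y = tgt p" "y \<cdot> h = x" "arr x" for x y h
    using pb_commutes[of "x" p] that p by (metis comp_assoc comp_simps pb_simps)
  show ?thesis
    using p unfolding is_functor_def Hom_def slice_ball
    by (intro conjI allI ballI impI) (auto simp: slice_simps pullback_functor_simps c)
qed


section \<open>Exponentiable arrows\<close>

text \<open>\<open>b\<close> is \<open>\<Pi> p\<close> applied to \<open>s\<close>, and \<open>e\<close> is the underlying arrow of the counit at \<open>s\<close>.\<close>

definition is_pi :: "'m \<Rightarrow> 'm \<Rightarrow> 'm \<Rightarrow> 'm \<Rightarrow> bool" where
  "is_pi p s b e \<longleftrightarrow>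
     arr b \<and> tgt b = tgt p \<and> arr e \<and> src e = pb E b p \<and> tgt e = src s \<and> s \<cdot> e = p2 b p \<and>
     (\<forall>x h. arr x \<and> tgt x = tgt p \<and> arr h \<and> src h = pb E x p \<and> tgt h = src s \<and> s \<cdot> h = p2 x p \<longrightarrow>
        (\<exists>!u. u \<in> Hom E (src x) (src b) \<and> b \<cdot> u = x \<and> e \<cdot> pair b p (u \<cdot> p1 x p) (p2 x p) = h))"

lemma is_pi_simps:
  assumes "is_pi p s b e"
  shows "arr b" "tgt b = tgt p" "arr e" "src e = pb E b p" "tgt e = src s" "s \<cdot> e = p2 b p"
  using assms by (auto simp: is_pi_def)

text \<open>A pair \<open>(g, y)\<close> over \<open>x\<close> and \<open>p\<close> is the generic
  pair of projections restricted along \<open>pair x p g y\<close>, so evaluation at it is the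
  restriction of the generic evaluation.\<close>

lemma eval_at:
  assumes "arr b" "tgt b = tgt p" "arr e" "src e = pb E b p" "arr p" "arr u" "tgt u = src b" "b \<cdot> u = x"
    "over x p g y"
  shows "e \<cdot> pair b p (u \<cdot> g) y = (e \<cdot> pair b p (u \<cdot> p1 x p) (p2 x p)) \<cdot> pair x p g y"
proof -
  have x: "arr x" "src x = src u" "tgt x = tgt p"
    using assms by auto
  have "b \<cdot> (u \<cdot> p1 x p) = p \<cdot> p2 x p" "b \<cdot> (u \<cdot> g) = x \<cdot> g"
    using pb_commutes[of x p] reassoc[OF assms(8)] assms x by (auto simp: over_def)
  then show ?thesis
    using assms(1-7,9) x by (simp add: over_def)
qed

text \<open>\<open>is_pi\<close> describes the transpose at the generic direction only;
  \<open>eval_at\<close> spreads this to every direction \<open>y\<close> over a restriction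
  \<open>g\<close>.\<close>

lemma is_pi_exists:
  assumes "is_pi p s b e" "arr p" "arr x" "tgt x = tgt p"
    "arr h" "src h = pb E x p" "tgt h = src s" "s \<cdot> h = p2 x p"
  obtains u where "arr u" "src u = src x" "tgt u = src b" "b \<cdot> u = x"
    "\<And>g y. over x p g y \<Longrightarrow> e \<cdot> pair b p (u \<cdot> g) y = h \<cdot> pair x p g y"
proof -
  obtain u where u: "u \<in> Hom E (src x) (src b)" "b \<cdot> u = x" "e \<cdot> pair b p (u \<cdot> p1 x p) (p2 x p) = h"
    using assms unfolding is_pi_def by blast
  show thesis
  proof
    show "e \<cdot> pair b p (u \<cdot> g) y = h \<cdot> pair x p g y" if "over x p g y" for g y
      using eval_at[of b p e u x g y] is_pi_simps[OF assms(1)] assms(2) that u by (auto dest: HomD)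
  qed (use u in \<open>auto dest: HomD\<close>)
qed

text \<open>Extensionality: among the directions quantified over is the generic one, and agreement
  there is what the uniqueness in \<open>is_pi\<close> requires.\<close>

lemma is_pi_unique:
  assumes pi: "is_pi p s b e" and p: "arr p" and s: "arr s"
    and u: "arr u" "tgt u = src b" and v: "arr v" "tgt v = src b"
    and eq: "src u = src v" "b \<cdot> u = b \<cdot> v"
      "\<And>g y. over (b \<cdot> v) p g y \<Longrightarrow> e \<cdot> pair b p (u \<cdot> g) y = e \<cdot> pair b p (v \<cdot> g) y"
  shows "u = v"
proof -
  note b = is_pi_simps[OF pi]
  define x where "x = b \<cdot> v"
  define h where "h = e \<cdot> pair b p (v \<cdot> p1 x p) (p2 x p)"
  have x: "arr x" "tgt x = tgt p" "src x = src v"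
    using b v by (auto simp: x_def)
  have c: "b \<cdot> (v \<cdot> p1 x p) = p \<cdot> p2 x p"
    using pb_commutes[of x p] b p v x by (metis comp_assoc comp_simps pb_simps x_def)
  have "over x p (p1 x p) (p2 x p)"
    using x p pb_commutes by (simp add: over_def)
  then have eh: "e \<cdot> pair b p (u \<cdot> p1 x p) (p2 x p) = h"
    using eq(3) by (simp add: x_def h_def)
  have "s \<cdot> h = p2 x p"
    using b s p v x c reassoc[OF b(6)] by (simp add: h_def)
  moreover have "arr h" "src h = pb E x p" "tgt h = src s"
    using b s p v x c by (auto simp: h_def)
  ultimately have "\<exists>!u. u \<in> Hom E (src x) (src b) \<and> b \<cdot> u = x \<and> e \<cdot> pair b p (u \<cdot> p1 x p) (p2 x p) = h"
    using pi x unfolding is_pi_def by blast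
  then show ?thesis
    using u v eq(1,2) x eh unfolding Hom_def by (auto simp: x_def h_def)
qed

text \<open>The elementwise form of the universal property. The proofs that arrows are exponentiable
  use it, so that they never mention the comparison isomorphisms between iterated pullbacks.\<close>

lemma is_piI:
  assumes p: "arr p" and b: "arr b" "tgt b = tgt p" "arr e" "src e = pb E b p" "tgt e = src s" "s \<cdot> e = p2 b p"
    and ex: "\<And>x h. \<lbrakk>arr x; tgt x = tgt p; arr h; src h = pb E x p; tgt h = src s; s \<cdot> h = p2 x p\<rbrakk> \<Longrightarrow>
      \<exists>u. arr u \<and> src u = src x \<and> tgt u = src b \<and> b \<cdot> u = x \<and>
        (\<forall>g y. over x p g y \<longrightarrow> e \<cdot> pair b p (u \<cdot> g) y = h \<cdot> pair x p g y)"
    and uniq: "\<And>u v. \<lbrakk>arr u; tgt u = src b; arr v; tgt v = src b; src u = src v; b \<cdot> u = b \<cdot> v;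
      \<And>g y. over (b \<cdot> v) p g y \<Longrightarrow> e \<cdot> pair b p (u \<cdot> g) y = e \<cdot> pair b p (v \<cdot> g) y\<rbrakk> \<Longrightarrow> u = v"
  shows "is_pi p s b e"
proof -
  have "\<exists>!u. u \<in> Hom E (src x) (src b) \<and> b \<cdot> u = x \<and> e \<cdot> pair b p (u \<cdot> p1 x p) (p2 x p) = h"
    if xh: "arr x" "tgt x = tgt p" "arr h" "src h = pb E x p" "tgt h = src s" "s \<cdot> h = p2 x p" for x h
  proof -
    have gen: "over x p (p1 x p) (p2 x p)"
      using p xh pb_commutes by (simp add: over_def)
    obtain u where u: "arr u" "src u = src x" "tgt u = src b" "b \<cdot> u = x"
      "\<And>g y. over x p g y \<Longrightarrow> e \<cdot> pair b p (u \<cdot> g) y = h \<cdot> pair x p g y"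
      using ex[OF xh] by blast
    show ?thesis
    proof (rule ex1I[of _ u])
      show "u \<in> Hom E (src x) (src b) \<and> b \<cdot> u = x \<and> e \<cdot> pair b p (u \<cdot> p1 x p) (p2 x p) = h"
        using u gen xh p by (auto intro!: HomI)
    next
      fix v assume "v \<in> Hom E (src x) (src b) \<and> b \<cdot> v = x \<and> e \<cdot> pair b p (v \<cdot> p1 x p) (p2 x p) = h"
      then have v: "arr v" "src v = src x" "tgt v = src b" "b \<cdot> v = x"
          "e \<cdot> pair b p (v \<cdot> p1 x p) (p2 x p) = h"
        by (auto dest: HomD)
      have c: "b \<cdot> (v \<cdot> p1 x p) = p \<cdot> p2 x p"
        using pb_commutes[of x p] reassoc[OF v(4)] b p v xh by simp
      show "v = u"
      proof (rule uniq)
        fix g y assume "over (b \<cdot> u) p g y"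
        then have o: "over x p g y" using u by simp
        have "e \<cdot> pair b p (v \<cdot> g) y = (e \<cdot> pair b p (v \<cdot> p1 x p) (p2 x p)) \<cdot> pair x p g y"
          using eval_at[of b p e v x g y] b p v o by simp
        then show "e \<cdot> pair b p (v \<cdot> g) y = e \<cdot> pair b p (u \<cdot> g) y"
          using u(5)[OF o] v by simp
      qed (use u v in auto)
    qed
  qed
  then show ?thesis
    using b unfolding is_pi_def by blast
qed

lemma ex1_triple:
  assumes "\<And>w. P w \<Longrightarrow> \<exists>u. w = (x, u, y)"
  shows "(\<exists>!w. P w) \<longleftrightarrow> (\<exists>!u. P (x, u, y))"
  using assms by blast

text \<open>A slice arrow with fixed endpoints is determined by its middle component. Hence the
  universal arrow in the slices and the one in \<open>E\<close> are interchangeable; this is used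
  both to read off \<open>is_pi\<close> from an adjunction and to build an adjunction from
  it.\<close>

lemma pi_slice_ex1:
  assumes "arr p" "arr b" "tgt b = tgt p" "arr s" "tgt s = src p" "arr x" "tgt x = tgt p"
    "arr e" "src e = pb E b p" "tgt e = src s" "s \<cdot> e = p2 b p"
  shows "(\<exists>!w. w \<in> Hom (slice E (tgt p)) x b \<and>
      (p2 b p, e, s) \<cdot>\<^bsub>slice E (src p)\<^esub> on_arr (\<Delta> p) w = (p2 x p, h, s))
    \<longleftrightarrow> (\<exists>!u. u \<in> Hom E (src x) (src b) \<and> b \<cdot> u = x \<and> e \<cdot> pair b p (u \<cdot> p1 x p) (p2 x p) = h)"
proof -
  have iff: "((x, u, b) \<in> Hom (slice E (tgt p)) x b \<and>
      (p2 b p, e, s) \<cdot>\<^bsub>slice E (src p)\<^esub> on_arr (\<Delta> p) (x, u, b) = (p2 x p, h, s))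
    \<longleftrightarrow> u \<in> Hom E (src x) (src b) \<and> b \<cdot> u = x \<and> e \<cdot> pair b p (u \<cdot> p1 x p) (p2 x p) = h" for u
    unfolding Hom_def mem_Collect_eq slice_simps pullback_functor_simps prod.inject
    using assms(2,3,6,7) by metis
  have "\<exists>u. w = (x, u, b)" if "w \<in> Hom (slice E (tgt p)) x b" for w
    using that by (cases w) (simp add: Hom_def slice_simps)
  then show ?thesis
    unfolding iff[symmetric] by (intro ex1_triple) blast
qed

lemma exponentiable_arr: "exponentiable E p \<Longrightarrow> arr p"
  by (simp add: exponentiable_def)

lemma cfun_pullback: "arr p \<Longrightarrow> cfun (slice E (tgt p)) (slice E (src p)) (\<Delta> p)"
  using slice_category pullback_functor by unfold_locales

text \<open>Extracts from the chosen adjunction the universal property through which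
  \<open>tri_base\<close> and \<open>tri_ev\<close> are handled below.\<close>

lemma Pi_data_is_pi:
  assumes p: "exponentiable E p" and s: "arr s" "tgt s = src p"
  shows "is_pi p s (on_obj (\<Pi> p) s) (fst (snd (Pi_counit E p s)))"
proof -
  have "\<exists>z. case z of (G, \<epsilon>) \<Rightarrow> \<exists>\<eta>. is_adjunction (slice E (tgt p)) (slice E (src p)) (\<Delta> p) G \<eta> \<epsilon>"
    using p unfolding exponentiable_def by auto
  from someI_ex[OF this]
  obtain \<eta> where adj: "is_adjunction (slice E (tgt p)) (slice E (src p)) (\<Delta> p) (\<Pi> p) \<eta> (Pi_counit E p)"
    unfolding Pi_data_def[symmetric] by (auto simp: case_prod_beta)
  have [simp]: "arr p" using p by (rule exponentiable_arr)
  interpret cfun "slice E (tgt p)" "slice E (src p)" "\<Delta> p"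
    by (rule cfun_pullback) simp
  define b where "b = on_obj (\<Pi> p) s"
  have "b \<in> Obj (slice E (tgt p))"
    using adj s by (auto simp: is_adjunction_def is_functor_def b_def slice_simps)
  then have b: "arr b" "tgt b = tgt p"
    by (auto simp: slice_simps)
  have "Pi_counit E p s \<in> Hom (slice E (src p)) (p2 b p) s"
    using adj s by (auto simp: is_adjunction_def is_nat_trans_def slice_simps b_def
        comp_functor_def id_functor_def pullback_functor_simps)
  then obtain e where e: "Pi_counit E p s = (p2 b p, e, s)"
    "arr e" "src e = pb E b p" "tgt e = src s" "s \<cdot> e = p2 b p"
    using b by (cases "Pi_counit E p s") (auto simp: slice_simps Hom_def)
  have "\<exists>!u. u \<in> Hom E (src x) (src b) \<and> b \<cdot> u = x \<and> e \<cdot> pair b p (u \<cdot> p1 x p) (p2 x p) = h"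
    if xh: "arr x" "tgt x = tgt p" "arr h" "src h = pb E x p" "tgt h = src s" "s \<cdot> h = p2 x p" for x h
  proof -
    have "(p2 x p, h, s) \<in> Hom (slice E (src p)) (on_obj (\<Delta> p) x) s"
      using xh s by (auto simp: Hom_def slice_simps pullback_functor_simps)
    then have "\<exists>!w. w \<in> Hom (slice E (tgt p)) x b \<and>
      (p2 b p, e, s) \<cdot>\<^bsub>slice E (src p)\<^esub> on_arr (\<Delta> p) w = (p2 x p, h, s)"
      using adjunction_universal[OF adj, of x s] xh s e(1) by (simp add: slice_simps b_def)
    then show ?thesis
      using pi_slice_ex1[of p b s x e h, OF \<open>arr p\<close> b s xh(1,2) e(2-5)] by simp
  qed
  then show ?thesis
    using b e unfolding is_pi_def b_def by simp
qed

lemma exponentiableI: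
  assumes p: "arr p" and ex: "\<And>s. arr s \<Longrightarrow> tgt s = src p \<Longrightarrow> \<exists>b e. is_pi p s b e"
  shows "exponentiable E p"
proof -
  interpret cfun "slice E (tgt p)" "slice E (src p)" "\<Delta> p"
    by (rule cfun_pullback) (rule p)
  \<comment> \<open>Choice turns the separate existence statements into one family of objects
    \<open>B s\<close> with evaluations \<open>e s\<close>.\<close>
  obtain B e where pi: "is_pi p s (B s) (e s)" if "arr s" "tgt s = src p" for s
    using ex by metis
  note B = is_pi_simps[OF pi]
  have "\<exists>G' \<eta>. is_adjunction (slice E (tgt p)) (slice E (src p)) (\<Delta> p) G' \<eta> (\<lambda>s. (p2 (B s) p, e s, s))"
  proof (rule adjunction_from_universal[where G = B])
    show "B s \<in> Obj (slice E (tgt p))" if "s \<in> Obj (slice E (src p))" for s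
      using that B by (auto simp: slice_simps)
    show "(p2 (B s) p, e s, s) \<in> Hom (slice E (src p)) (on_obj (\<Delta> p) (B s)) s"
      if "s \<in> Obj (slice E (src p))" for s
      using that B p by (auto simp: slice_simps Hom_def pullback_functor_simps)
    show "\<exists>!w. w \<in> Hom (slice E (tgt p)) x (B s) \<and>
        (p2 (B s) p, e s, s) \<cdot>\<^bsub>slice E (src p)\<^esub> on_arr (\<Delta> p) w = h"
      if "x \<in> Obj (slice E (tgt p))" "s \<in> Obj (slice E (src p))"
        "h \<in> Hom (slice E (src p)) (on_obj (\<Delta> p) x) s" for x s h
    proof -
      note h = that(3)
      have xs: "arr x" "tgt x = tgt p" "arr s" "tgt s = src p"
        using that by (auto simp: slice_simps)
      obtain h' where h': "h = (p2 x p, h', s)" "arr h'" "src h' = pb E x p" "tgt h' = src s" "s \<cdot> h' = p2 x p"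
        using h xs p by (cases h) (auto simp: slice_simps Hom_def pullback_functor_simps)
      have "\<exists>!u. u \<in> Hom E (src x) (src (B s)) \<and> B s \<cdot> u = x \<and>
          e s \<cdot> pair (B s) p (u \<cdot> p1 x p) (p2 x p) = h'"
        using pi[OF xs(3,4)] xs h' unfolding is_pi_def by blast
      then show ?thesis
        unfolding h'(1)
        using pi_slice_ex1[of p "B s" s x "e s" h'] p B[of s] xs by simp
    qed
  qed
  then show ?thesis
    using p unfolding exponentiable_def by blast
qed


text \<open>Pulling back along an identity is an equivalence, so \<open>s\<close> itself serves as
  the right adjoint's value, with the first projection as evaluation. This makes the unit polynomial
  an object of \<open>Poly E\<close>.\<close>

lemma exponentiable_ide:
  assumes A: "obj A"
  shows "exponentiable E (ide A)"
proof (rule exponentiableI)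
  fix s assume s: "arr s" "tgt s = src (ide A)"
  have "is_pi (ide A) s s (p1 s (ide A))"
  proof (rule is_piI)
    show "s \<cdot> p1 s (ide A) = p2 s (ide A)"
      using s A pb_commutes[of s "ide A"] by simp
  next
    fix x h assume xh: "arr x" "tgt x = tgt (ide A)" "arr h" "src h = pb E x (ide A)" "tgt h = src s"
      "s \<cdot> h = p2 x (ide A)"
    show "\<exists>u. arr u \<and> src u = src x \<and> tgt u = src s \<and> s \<cdot> u = x \<and>
        (\<forall>g y. over x (ide A) g y \<longrightarrow> p1 s (ide A) \<cdot> pair s (ide A) (u \<cdot> g) y = h \<cdot> pair x (ide A) g y)"
      \<comment> \<open>The witness restricts \<open>h\<close> along the pair of the identity and
        \<open>x\<close>, which inverts the first projection of the pullback of \<open>x\<close>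
        along \<open>ide A\<close>.\<close>
      using s A xh reassoc[OF xh(6)]
      by (intro exI[of _ "h \<cdot> pair x (ide A) (ide (src x)) x"]) (auto simp: over_def)
  next
    fix u v assume uv: "arr u" "tgt u = src s" "arr v" "tgt v = src s" "src u = src v" "s \<cdot> u = s \<cdot> v"
      and eq: "\<And>g y. over (s \<cdot> v) (ide A) g y \<Longrightarrow>
        p1 s (ide A) \<cdot> pair s (ide A) (u \<cdot> g) y = p1 s (ide A) \<cdot> pair s (ide A) (v \<cdot> g) y"
    \<comment> \<open>Evaluating at this element returns \<open>u\<close> and \<open>v\<close>
      themselves.\<close>
    have "over (s \<cdot> v) (ide A) (ide (src v)) (s \<cdot> v)"
      using s A uv by (simp add: over_def)
    from eq[OF this] show "u = v"
      using s A uv by simp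
  qed (use s A in auto)
  then show "\<exists>b e. is_pi (ide A) s b e" by blast
qed (use A in simp)

lemma exponentiable_is_pi:
  assumes "exponentiable E p" "arr s" "tgt s = src p"
  obtains b e where "is_pi p s b e"
  using Pi_data_is_pi[OF assms] by blast

text \<open>\<open>\<Pi> (p \<circ> q) = \<Pi> p \<circ> \<Pi> q\<close>.\<close>

lemma exponentiable_comp:
  assumes p: "exponentiable E p" and q: "exponentiable E q" and pq: "tgt q = src p"
  shows "exponentiable E (p \<cdot> q)"
proof (rule exponentiableI)
  note [simp] = exponentiable_arr[OF p] exponentiable_arr[OF q] pq
  show "arr (p \<cdot> q)" by simp
  fix s assume "arr s" "tgt s = src (p \<cdot> q)"
  then have s [simp]: "arr s" "tgt s = src q" by auto
  obtain b' e' where pi': "is_pi q s b' e'"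
    using exponentiable_is_pi[OF q s] .
  note b' [simp] = is_pi_simps[OF pi']
  note [simp] = reassoc[OF b'(6)]
  obtain b e where pi: "is_pi p b' b e"
    using exponentiable_is_pi[OF p, of b'] by auto
  note b [simp] = is_pi_simps[OF pi]
  note [simp] = reassoc[OF b(6)]
  \<comment> \<open>Evaluation in two stages: at the direction \<open>q \<cdot> y\<close> of
    \<open>p\<close>, which yields an element of \<open>b'\<close>, and then at the direction
    \<open>y\<close> of \<open>q\<close>.\<close>
  define ev where "ev = e' \<cdot> pair b' q (e \<cdot> pair b p (p1 b (p \<cdot> q)) (q \<cdot> p2 b (p \<cdot> q))) (p2 b (p \<cdot> q))"
  have [simp]: "b \<cdot> p1 b (p \<cdot> q) = p \<cdot> (q \<cdot> p2 b (p \<cdot> q))"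
    using pb_commutes[of b "p \<cdot> q"] by simp
  have ev_pair: "ev \<cdot> pair b (p \<cdot> q) v y = e' \<cdot> pair b' q (e \<cdot> pair b p v (q \<cdot> y)) y"
    if "over b (p \<cdot> q) v y" for v y
    using that by (simp add: ev_def over_def)
  have "is_pi (p \<cdot> q) s b ev"
  proof (rule is_piI)
    show "s \<cdot> ev = p2 b (p \<cdot> q)" by (simp add: ev_def)
    show "arr ev" "src ev = pb E b (p \<cdot> q)" "tgt ev = src s" by (simp_all add: ev_def)
  next
    fix x h assume xh: "arr x" "tgt x = tgt (p \<cdot> q)" "arr h" "src h = pb E x (p \<cdot> q)" "tgt h = src s"
      "s \<cdot> h = p2 x (p \<cdot> q)"
    then have x [simp]: "arr x" "tgt x = tgt p" "arr h" "src h = pb E x (p \<cdot> q)" "tgt h = src s"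
      "s \<cdot> h = p2 x (p \<cdot> q)"
      by auto
    note [simp] = reassoc[OF x(6)]
    \<comment> \<open>\<open>h\<close> is reindexed along the isomorphism between pulling back along
      \<open>p\<close> and then \<open>q\<close> and pulling back along \<open>p \<cdot> q\<close>,
      so that it can be transposed once along \<open>q\<close> and once along
      \<open>p\<close>.\<close>
    define h' where "h' = h \<cdot> pair x (p \<cdot> q) (p1 x p \<cdot> p1 (p2 x p) q) (p2 (p2 x p) q)"
    have c [simp]: "x \<cdot> (p1 x p \<cdot> p1 (p2 x p) q) = p \<cdot> (q \<cdot> p2 (p2 x p) q)"
      using pb_commutes'[of x p] pb_commutes[of "p2 x p" q] by simp
    obtain u' where u': "arr u'" "src u' = src (p2 x p)" "tgt u' = src b'" "b' \<cdot> u' = p2 x p"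
      "\<And>g y. over (p2 x p) q g y \<Longrightarrow> e' \<cdot> pair b' q (u' \<cdot> g) y = h' \<cdot> pair (p2 x p) q g y"
      by (rule is_pi_exists[OF pi', of "p2 x p" h']) (auto simp: h'_def)
    obtain u where u: "arr u" "src u = src x" "tgt u = src b" "b \<cdot> u = x"
      "\<And>g y. over x p g y \<Longrightarrow> e \<cdot> pair b p (u \<cdot> g) y = u' \<cdot> pair x p g y"
      by (rule is_pi_exists[OF pi, of x u']) (use u' in auto)
    have "ev \<cdot> pair b (p \<cdot> q) (u \<cdot> g) y = h \<cdot> pair x (p \<cdot> q) g y" if o: "over x (p \<cdot> q) g y" for g y
    proof -
      have o': "over b (p \<cdot> q) (u \<cdot> g) y" "over x p g (q \<cdot> y)" "over (p2 x p) q (pair x p g (q \<cdot> y)) y"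
        using o u reassoc[OF u(4)] by (auto simp: over_def)
      show ?thesis
        using o u(1-3) u'(1-3) unfolding ev_pair[OF o'(1)] u(5)[OF o'(2)] u'(5)[OF o'(3)]
        by (simp add: over_def h'_def)
    qed
    then show "\<exists>u. arr u \<and> src u = src x \<and> tgt u = src b \<and> b \<cdot> u = x \<and>
        (\<forall>g y. over x (p \<cdot> q) g y \<longrightarrow> ev \<cdot> pair b (p \<cdot> q) (u \<cdot> g) y = h \<cdot> pair x (p \<cdot> q) g y)"
      using u by blast
  next
    fix u v assume uv: "arr u" "tgt u = src b" "arr v" "tgt v = src b" "src u = src v" "b \<cdot> u = b \<cdot> v"
      and eq: "\<And>g y. over (b \<cdot> v) (p \<cdot> q) g y \<Longrightarrow>
        ev \<cdot> pair b (p \<cdot> q) (u \<cdot> g) y = ev \<cdot> pair b (p \<cdot> q) (v \<cdot> g) y"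
    note bu = reassoc[OF uv(6)]
    show "u = v"
    proof (rule is_pi_unique[OF pi])
      fix g y assume o: "over (b \<cdot> v) p g y"
      \<comment> \<open>The values are themselves elements of \<open>b'\<close>, so a second
        extensionality, now along \<open>q\<close>, compares them.\<close>
      show "e \<cdot> pair b p (u \<cdot> g) y = e \<cdot> pair b p (v \<cdot> g) y"
      proof (rule is_pi_unique[OF pi'])
        fix k z assume oe: "over (b' \<cdot> (e \<cdot> pair b p (v \<cdot> g) y)) q k z"
        have "b' \<cdot> (e \<cdot> pair b p (v \<cdot> g) y) = y"
          using o uv by (auto simp: over_def)
        then have o2: "over y q k z"
          using oe by simp
        then have o3: "over (b \<cdot> v) (p \<cdot> q) (g \<cdot> k) z" "over b (p \<cdot> q) (v \<cdot> (g \<cdot> k)) z" "over b (p \<cdot> q) (u \<cdot> (g \<cdot> k)) z"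
          using o uv bu reassoc[of b "v \<cdot> g" "p \<cdot> y" k] by (auto simp: over_def)
        have oz: "q \<cdot> z = y \<cdot> k" using o2 by (simp add: over_def)
        show "e' \<cdot> pair b' q ((e \<cdot> pair b p (u \<cdot> g) y) \<cdot> k) z = e' \<cdot> pair b' q ((e \<cdot> pair b p (v \<cdot> g) y) \<cdot> k) z"
          using eq[OF o3(1)] o o2 uv bu unfolding ev_pair[OF o3(2)] ev_pair[OF o3(3)] oz
          by (auto simp: over_def)
      qed (use o uv bu in \<open>auto simp: over_def\<close>)
    qed (use uv in simp_all)
  qed simp_all
  then show "\<exists>b e. is_pi (p \<cdot> q) s b e" by blast
qed

text \<open>Write \<open>p' : B' \<rightarrow> A'\<close> and \<open>f' : B' \<rightarrow> B\<close> for the pullbacks of \<open>p\<close> and \<open>f\<close>. Then \<open>\<Pi> p'\<close> of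
  \<open>s : S \<rightarrow> B'\<close> is the pullback of the image \<open>m\<close> under \<open>\<Pi> p\<close> of \<open>s : f' \<circ> s \<rightarrow> f'\<close> along the arrow
  \<open>n : A' \<rightarrow> \<Pi> p f'\<close> that corresponds to the identity of \<open>B'\<close>.\<close>

lemma exponentiable_pullback:
  assumes p: "exponentiable E p" and f: "arr f" "tgt f = tgt p"
  shows "exponentiable E (p1 f p)"
proof (rule exponentiableI)
  note [simp] = exponentiable_arr[OF p] f
  define p' where "p' = p1 f p"
  define f' where "f' = p2 f p"
  have [simp]: "arr p'" "arr f'" "src p' = pb E f p" "src f' = pb E f p" "tgt p' = src f" "tgt f' = src p"
    by (simp_all add: p'_def f'_def)
  have comm: "f \<cdot> p' = p \<cdot> f'"
    using pb_commutes[of f p] by (simp add: p'_def f'_def)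
  note comm' = reassoc[OF comm]
  have pr [simp]: "p' \<cdot> pair f p h k = h" "f' \<cdot> pair f p h k = k" if "over f p h k" for h k
    using that by (simp_all add: p'_def f'_def over_def)
  show "arr (p1 f p)" by simp
  fix s assume "arr s" "tgt s = src (p1 f p)"
  then have s [simp]: "arr s" "tgt s = pb E f p" by auto
  obtain b1 e1 where pi1: "is_pi p (f' \<cdot> s) b1 e1"
    using exponentiable_is_pi[OF p, of "f' \<cdot> s"] by auto
  note b1 [simp] = is_pi_simps[OF pi1, simplified]
  have se1: "f' \<cdot> (s \<cdot> (e1 \<cdot> pair b1 p h k)) = k" if "over b1 p h k" for h k
    using reassoc[OF b1(6), of "pair b1 p h k"] that by (simp add: over_def)
  obtain b0 e0 where pi0: "is_pi p f' b0 e0"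
    using exponentiable_is_pi[OF p, of f'] by auto
  note b0 [simp] = is_pi_simps[OF pi0, simplified]
  obtain m where m: "arr m" "src m = src b1" "tgt m = src b0" "b0 \<cdot> m = b1"
    "\<And>g y. over b1 p g y \<Longrightarrow> e0 \<cdot> pair b0 p (m \<cdot> g) y = (s \<cdot> e1) \<cdot> pair b1 p g y"
    by (rule is_pi_exists[OF pi0, of b1 "s \<cdot> e1"]) auto
  obtain n where n: "arr n" "src n = src f" "tgt n = src b0" "b0 \<cdot> n = f"
    "\<And>g y. over f p g y \<Longrightarrow> e0 \<cdot> pair b0 p (n \<cdot> g) y = ide (pb E f p) \<cdot> pair f p g y"
    by (rule is_pi_exists[OF pi0, of f "ide (pb E f p)"]) (auto simp: f'_def)
  note [simp] = m(1-3) n(1-3)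
  define b where "b = p1 n m"
  define b' where "b' = p2 n m"
  have [simp]: "arr b" "arr b'" "src b = pb E n m" "src b' = pb E n m" "tgt b = src f" "tgt b' = src b1"
    by (simp_all add: b_def b'_def)
  have nb: "n \<cdot> b = m \<cdot> b'"
    using pb_commutes[of n m] by (simp add: b_def b'_def)
  note nb' = reassoc[OF nb]
  \<comment> \<open>\<open>n\<close> and \<open>m\<close> are arrows over \<open>tgt p\<close>, via
    \<open>b0\<close>; so the two legs of their pullback lie over the same element there.\<close>
  have fb: "f \<cdot> (b \<cdot> v) = b1 \<cdot> (b' \<cdot> v)" if "arr v" "tgt v = pb E n m" for v
  proof -
    have "f \<cdot> (b \<cdot> v) = b0 \<cdot> (n \<cdot> (b \<cdot> v))"
      using that reassoc[OF n(4)] by simp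
    also have "\<dots> = b1 \<cdot> (b' \<cdot> v)"
      using that nb' reassoc[OF m(4)] by simp
    finally show ?thesis .
  qed
  have o1: "over b1 p (b' \<cdot> v) (f' \<cdot> y)" if "over b p' v y" for v y
    using that comm'[of y] by (auto simp: over_def simp flip: fb)
  define ev where "ev = e1 \<cdot> pair b1 p (b' \<cdot> p1 b p') (f' \<cdot> p2 b p')"
  have gen: "over b p' (p1 b p') (p2 b p')"
    using pb_commutes by (simp add: over_def)
  have ev_pair: "ev \<cdot> pair b p' v y = e1 \<cdot> pair b1 p (b' \<cdot> v) (f' \<cdot> y)" if "over b p' v y" for v y
    using that o1[OF gen] by (simp add: ev_def over_def)
  \<comment> \<open>By \<open>b1\<close> alone, applying \<open>s\<close> to the value gives
    \<open>y\<close> only after composing with \<open>f'\<close>. The condition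
    \<open>n \<cdot> b = m \<cdot> b'\<close> upgrades this to an equality in the pullback, because
    \<open>n\<close> evaluates to the identity and \<open>m\<close> to the \<open>s\<close>-image of
    the value.\<close>
  have s_ev: "s \<cdot> (e1 \<cdot> pair b1 p (b' \<cdot> v) (f' \<cdot> y)) = y" if o: "over b p' v y" for v y
  proof -
    have o2: "over f p (b \<cdot> v) (f' \<cdot> y)"
      using o1[OF o] o comm'[of y] by (simp add: over_def)
    have "s \<cdot> (e1 \<cdot> pair b1 p (b' \<cdot> v) (f' \<cdot> y)) = e0 \<cdot> pair b0 p (m \<cdot> (b' \<cdot> v)) (f' \<cdot> y)"
      using m(5)[OF o1[OF o]] o1[OF o] by (simp add: over_def)
    also have "\<dots> = e0 \<cdot> pair b0 p (n \<cdot> (b \<cdot> v)) (f' \<cdot> y)"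
    proof -
      have "arr v" "tgt v = pb E n m"
        using o by (auto simp: over_def)
      then show ?thesis using nb'[of v] by simp
    qed
    also have "\<dots> = pair f p (b \<cdot> v) (f' \<cdot> y)"
      using n(5)[OF o2] o2 by (simp add: over_def)
    also have "\<dots> = y"
      using o pair_eta[of f p y] by (simp add: over_def p'_def f'_def)
    finally show ?thesis .
  qed
  have "is_pi p' s b ev"
  proof (rule is_piI)
    show "s \<cdot> ev = p2 b p'" "arr ev" "src ev = pb E b p'" "tgt ev = src s"
      using s_ev[OF gen] o1[OF gen] by (simp_all add: ev_def over_def)
  next
    fix x h assume x [simp]: "arr x" "tgt x = tgt p'" "arr h" "src h = pb E x p'" "tgt h = src s"
      "s \<cdot> h = p2 x p'"
    \<comment> \<open>The comparison arrow from the pullback of \<open>f \<cdot> x\<close> to that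
      of \<open>f\<close>. With it \<open>h\<close> is moved to the pullback of
      \<open>f \<cdot> x\<close> along \<open>p\<close>, where it has a transpose along
      \<open>p\<close>.\<close>
    define y where "y = pair f p (x \<cdot> p1 (f \<cdot> x) p) (p2 (f \<cdot> x) p)"
    have fx: "f \<cdot> (x \<cdot> p1 (f \<cdot> x) p) = p \<cdot> p2 (f \<cdot> x) p"
      using pb_commutes[of "f \<cdot> x" p] by simp
    then have "over f p (x \<cdot> p1 (f \<cdot> x) p) (p2 (f \<cdot> x) p)"
      by (simp add: over_def)
    note y = pr[OF this, folded y_def]
    have [simp]: "arr y" "src y = pb E (f \<cdot> x) p" "tgt y = pb E f p"
      using fx by (simp_all add: y_def)
    define h1 where "h1 = h \<cdot> pair x p' (p1 (f \<cdot> x) p) y"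
    have h1 [simp]: "arr h1" "src h1 = pb E (f \<cdot> x) p" "tgt h1 = src s" "s \<cdot> h1 = y"
      using y reassoc[OF x(6)] by (simp_all add: h1_def)
    obtain u1 where u1: "arr u1" "src u1 = src (f \<cdot> x)" "tgt u1 = src b1" "b1 \<cdot> u1 = f \<cdot> x"
      "\<And>g y. over (f \<cdot> x) p g y \<Longrightarrow> e1 \<cdot> pair b1 p (u1 \<cdot> g) y = h1 \<cdot> pair (f \<cdot> x) p g y"
      by (rule is_pi_exists[OF pi1, of "f \<cdot> x" h1]) (use y in auto)
    have [simp]: "arr u1" "src u1 = src x" "tgt u1 = src b1" using u1 by auto
    \<comment> \<open>Both sides are transposes of \<open>y\<close>; their equality allows
      \<open>x\<close> and \<open>u1\<close> to be paired into the pullback.\<close>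
    have nm: "n \<cdot> x = m \<cdot> u1"
    proof (rule is_pi_unique[OF pi0])
      have b0m: "b0 \<cdot> (m \<cdot> u1) = f \<cdot> x" "b0 \<cdot> (n \<cdot> x) = f \<cdot> x"
        using reassoc[OF m(4), of u1] reassoc[OF n(4), of x] u1(4) by simp_all
      then show "b0 \<cdot> (n \<cdot> x) = b0 \<cdot> (m \<cdot> u1)" by simp
      fix g z assume "over (b0 \<cdot> (m \<cdot> u1)) p g z"
      then have o: "over (f \<cdot> x) p g z" "over f p (x \<cdot> g) z" "over b1 p (u1 \<cdot> g) z"
        using b0m(1) reassoc[OF u1(4), of g] by (auto simp: over_def)
      have "e0 \<cdot> pair b0 p ((m \<cdot> u1) \<cdot> g) z = s \<cdot> (e1 \<cdot> pair b1 p (u1 \<cdot> g) z)"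
        using m(5)[OF o(3)] o(1,3) by (auto simp: over_def)
      also have "\<dots> = y \<cdot> pair (f \<cdot> x) p g z"
        unfolding u1(5)[OF o(1)] using o(1) reassoc[OF h1(4)] by (simp add: over_def)
      also have "\<dots> = e0 \<cdot> pair b0 p (n \<cdot> (x \<cdot> g)) z"
        unfolding n(5)[OF o(2)] using o fx by (simp add: y_def over_def)
      finally show "e0 \<cdot> pair b0 p ((n \<cdot> x) \<cdot> g) z = e0 \<cdot> pair b0 p ((m \<cdot> u1) \<cdot> g) z"
        using o(1) by (simp add: over_def)
    qed simp_all
    define u where "u = pair n m x u1"
    have u: "arr u" "src u = src x" "tgt u = src b" "b \<cdot> u = x" "b' \<cdot> u = u1"
      using nm by (simp_all add: u_def b_def b'_def)
    have "ev \<cdot> pair b p' (u \<cdot> g) z = h \<cdot> pair x p' g z" if o: "over x p' g z" for g z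
    proof -
      have o2: "over b p' (u \<cdot> g) z" "over (f \<cdot> x) p g (f' \<cdot> z)"
        using o u reassoc[OF u(4)] comm'[of z] by (auto simp: over_def)
      have yz: "y \<cdot> pair (f \<cdot> x) p g (f' \<cdot> z) = z"
        using o o2(2) fx pair_eta[of f p z] by (simp add: over_def y_def p'_def f'_def)
      have "ev \<cdot> pair b p' (u \<cdot> g) z = e1 \<cdot> pair b1 p (u1 \<cdot> g) (f' \<cdot> z)"
        using ev_pair[OF o2(1)] o u reassoc[OF u(5)] by (simp add: over_def)
      also have "\<dots> = h1 \<cdot> pair (f \<cdot> x) p g (f' \<cdot> z)"
        by (rule u1(5)[OF o2(2)])
      also have "\<dots> = h \<cdot> pair x p' g z"
        using o o2(2) yz y by (simp add: over_def h1_def)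
      finally show ?thesis .
    qed
    then show "\<exists>u. arr u \<and> src u = src x \<and> tgt u = src b \<and> b \<cdot> u = x \<and>
        (\<forall>g y. over x p' g y \<longrightarrow> ev \<cdot> pair b p' (u \<cdot> g) y = h \<cdot> pair x p' g y)"
      using u by blast
  next
    fix u v assume uv: "arr u" "tgt u = src b" "arr v" "tgt v = src b" "src u = src v" "b \<cdot> u = b \<cdot> v"
      and eq: "\<And>g y. over (b \<cdot> v) p' g y \<Longrightarrow> ev \<cdot> pair b p' (u \<cdot> g) y = ev \<cdot> pair b p' (v \<cdot> g) y"
    have "b' \<cdot> u = b' \<cdot> v"
    proof (rule is_pi_unique[OF pi1])
      show "b1 \<cdot> (b' \<cdot> u) = b1 \<cdot> (b' \<cdot> v)"
        using uv by (simp flip: fb)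
      fix g z assume o: "over (b1 \<cdot> (b' \<cdot> v)) p g z"
      have ff: "f \<cdot> (b \<cdot> (v \<cdot> g)) = p \<cdot> z"
        using o uv fb by (auto simp: over_def)
      \<comment> \<open>Extensionality along \<open>p\<close> provides a direction \<open>z\<close>
        in the source of \<open>p\<close>; it is lifted to a direction of \<open>p'\<close> by
        pairing it with its base point.\<close>
      define y where "y = pair f p (b \<cdot> (v \<cdot> g)) z"
      have y: "arr y" "src y = src g" "tgt y = pb E f p" "p' \<cdot> y = b \<cdot> (v \<cdot> g)" "f' \<cdot> y = z"
        using o ff uv by (simp_all add: y_def over_def p'_def f'_def)
      have oo: "over (b \<cdot> v) p' g y" "over b p' (v \<cdot> g) y" "over b p' (u \<cdot> g) y"
        using o uv y reassoc[OF uv(6), of g] by (auto simp: over_def)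
      show "e1 \<cdot> pair b1 p ((b' \<cdot> u) \<cdot> g) z = e1 \<cdot> pair b1 p ((b' \<cdot> v) \<cdot> g) z"
        using eq[OF oo(1)] o uv unfolding ev_pair[OF oo(2)] ev_pair[OF oo(3)] y(5)
        by (simp add: over_def)
    qed (use uv in simp_all)
    with uv(6) show "u = v"
      unfolding b_def b'_def by (rule pb_eqI) (use uv in simp_all)
  qed simp_all
  then show "\<exists>b e. is_pi (p1 f p) s b e" unfolding p'_def by blast
qed


section \<open>Positions and directions\<close>

declare over_def [simp] exponentiable_arr [simp]

text \<open>A product is a pullback over the terminal object, so no further diagram shape is
  needed.\<close>

lemma chosen_product:
  assumes "obj X" "obj Y"
  shows "is_product E X Y (prod_fst E X Y) (prod_snd E X Y)"
proof -
  obtain a b where ab: "is_pullback E (bang E X) (bang E Y) a b"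
    using pullback_exists[of "bang E X" "bang E Y"] assms by auto
  have "is_product E X Y a b"
    unfolding is_product_def
  proof (intro conjI allI ballI)
    fix Z h k assume hk: "h \<in> Hom E Z X" "k \<in> Hom E Z Y"
    then have "bang E X \<cdot> h = bang E Y \<cdot> k"
      using assms by (auto simp: Hom_def)
    moreover have "\<forall>Z. \<forall>h \<in> Hom E Z X. \<forall>k \<in> Hom E Z Y. bang E X \<cdot> h = bang E Y \<cdot> k \<longrightarrow>
        (\<exists>!u. u \<in> Hom E Z (src a) \<and> a \<cdot> u = h \<and> b \<cdot> u = k)"
      using ab unfolding is_pullback_def bang_simps(2)[OF assms(1)] bang_simps(2)[OF assms(2)] by blast
    ultimately show "\<exists>!u. u \<in> Hom E Z (src a) \<and> a \<cdot> u = h \<and> b \<cdot> u = k"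
      using hk by blast
  qed (use ab assms in \<open>auto simp: is_pullback_def\<close>)
  then show ?thesis
    unfolding chosen_product_def
    using someI[where P = "\<lambda>(a, b). is_product E X Y a b" and x = "(a, b)"] by (simp add: case_prod_beta)
qed

lemma product:
  assumes "obj X" "obj Y"
  shows "arr (prod_fst E X Y)" "arr (prod_snd E X Y)" "src (prod_fst E X Y) = src (prod_snd E X Y)"
    "tgt (prod_fst E X Y) = X" "tgt (prod_snd E X Y) = Y"
    "\<lbrakk>arr h; arr k; src h = src k; tgt h = X; tgt k = Y\<rbrakk> \<Longrightarrow>
      \<exists>!u. u \<in> Hom E (src h) (src (prod_fst E X Y)) \<and> prod_fst E X Y \<cdot> u = h \<and> prod_snd E X Y \<cdot> u = k"
proof -
  note P = chosen_product[OF assms, unfolded is_product_def]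
  show "arr (prod_fst E X Y)" "arr (prod_snd E X Y)" "src (prod_fst E X Y) = src (prod_snd E X Y)"
    "tgt (prod_fst E X Y) = X" "tgt (prod_snd E X Y) = Y"
    using P by simp_all
  assume "arr h" "arr k" "src h = src k" "tgt h = X" "tgt k = Y"
  then have "h \<in> Hom E (src h) X" "k \<in> Hom E (src h) Y"
    by (auto intro: HomI)
  then show "\<exists>!u. u \<in> Hom E (src h) (src (prod_fst E X Y)) \<and> prod_fst E X Y \<cdot> u = h \<and> prod_snd E X Y \<cdot> u = k"
    using P by blast
qed

lemma product_eqI:
  assumes XY: "obj X" "obj Y"
    and uv: "arr u" "arr v" "src u = src v" "tgt u = src (prod_snd E X Y)" "tgt v = src (prod_snd E X Y)"
    and eq: "prod_fst E X Y \<cdot> u = prod_fst E X Y \<cdot> v" "prod_snd E X Y \<cdot> u = prod_snd E X Y \<cdot> v"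
  shows "u = v"
proof -
  note P = product[OF XY]
  have "\<exists>!w. w \<in> Hom E (src (prod_fst E X Y \<cdot> v)) (src (prod_fst E X Y)) \<and>
      prod_fst E X Y \<cdot> w = prod_fst E X Y \<cdot> v \<and> prod_snd E X Y \<cdot> w = prod_snd E X Y \<cdot> v"
    by (rule P(6)) (use P(1-5) uv in simp_all)
  then show ?thesis
    using uv eq P(1-5) by (auto simp: Hom_def)
qed

lemma tri_pi:
  assumes p: "exponentiable E p" and q: "arr q"
  shows "\<exists>e. is_pi p (prod_snd E (tgt q) (src p)) (tri_base E p q) e \<and>
    tri_ev E p q = prod_fst E (tgt q) (src p) \<cdot> e"
proof -
  have "obj (tgt q)" "obj (src p)"
    using exponentiable_arr[OF p] q by auto
  from Pi_data_is_pi[OF p product(2,5)[OF this]] show ?thesis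
    unfolding tri_base_def tri_ev_def by blast
qed

lemma tri_base_simps [simp]:
  assumes "exponentiable E p" "arr q"
  shows "arr (tri_base E p q)" "tgt (tri_base E p q) = tgt p"
  using tri_pi[OF assms] is_pi_simps by blast+

lemma tri_ev_simps [simp]:
  assumes "exponentiable E p" "arr q"
  shows "arr (tri_ev E p q)" "src (tri_ev E p q) = pb E (tri_base E p q) p" "tgt (tri_ev E p q) = tgt q"
proof -
  obtain e where "is_pi p (prod_snd E (tgt q) (src p)) (tri_base E p q) e"
    and e: "tri_ev E p q = prod_fst E (tgt q) (src p) \<cdot> e"
    using tri_pi[OF assms] by blast
  note is_pi_simps[OF this(1)]
  then show "arr (tri_ev E p q)" "src (tri_ev E p q) = pb E (tri_base E p q) p" "tgt (tri_ev E p q) = tgt q"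
    using assms e product[of "tgt q" "src p"] by simp_all
qed

text \<open>The value \<open>f(y)\<close> of the position \<open>u = (x, f)\<close> at a direction \<open>y\<close> over \<open>x\<close>.\<close>

definition pos_at :: "'m \<Rightarrow> 'm \<Rightarrow> 'm \<Rightarrow> 'm \<Rightarrow> 'm" where
  "pos_at p q u y = tri_ev E p q \<cdot> pair (tri_base E p q) p u y"

lemma pos_at_simps [simp]:
  assumes "exponentiable E p" "arr q" "over (tri_base E p q) p u y"
  shows "arr (pos_at p q u y)" "src (pos_at p q u y) = src y" "tgt (pos_at p q u y) = tgt q"
    "arr g \<Longrightarrow> tgt g = src y \<Longrightarrow> pos_at p q u y \<cdot> g = pos_at p q (u \<cdot> g) (y \<cdot> g)"
  using assms by (auto simp: pos_at_def)

text \<open>An arrow to \<open>Q\<close> is the same as an arrow to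
  \<open>Q \<times> P\<^sub>*\<close> over \<open>P\<^sub>*\<close>. So \<open>f\<close> is first
  paired with the projection to the directions of \<open>p\<close>, and the pair is
  transposed.\<close>

lemma position_exists:
  assumes p: "exponentiable E p" and q: "arr q"
    and xf: "arr x" "tgt x = tgt p" "arr f" "src f = pb E x p" "tgt f = tgt q"
  obtains u where "arr u" "src u = src x" "tgt u = src (tri_base E p q)" "tri_base E p q \<cdot> u = x"
    "\<And>g y. over x p g y \<Longrightarrow> pos_at p q (u \<cdot> g) y = f \<cdot> pair x p g y"
proof -
  obtain e where pi: "is_pi p (prod_snd E (tgt q) (src p)) (tri_base E p q) e"
    and ev: "tri_ev E p q = prod_fst E (tgt q) (src p) \<cdot> e"
    using tri_pi[OF p q] by blast
  have o: "obj (tgt q)" "obj (src p)" using p q by auto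
  note [simp] = product(1-5)[OF o]
  note e [simp] = is_pi_simps[OF pi]
  have "\<exists>!h. h \<in> Hom E (src f) (src (prod_fst E (tgt q) (src p))) \<and> prod_fst E (tgt q) (src p) \<cdot> h = f
      \<and> prod_snd E (tgt q) (src p) \<cdot> h = p2 x p"
    by (rule product(6)[OF o]) (use p xf in auto)
  then obtain h where h [simp]: "arr h" "src h = pb E x p" "tgt h = src (prod_snd E (tgt q) (src p))"
    "prod_fst E (tgt q) (src p) \<cdot> h = f" "prod_snd E (tgt q) (src p) \<cdot> h = p2 x p"
    using xf by (auto simp: Hom_def)
  obtain u where u: "arr u" "src u = src x" "tgt u = src (tri_base E p q)" "tri_base E p q \<cdot> u = x"
    "\<And>g y. over x p g y \<Longrightarrow> e \<cdot> pair (tri_base E p q) p (u \<cdot> g) y = h \<cdot> pair x p g y"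
    by (rule is_pi_exists[OF pi, of x h]) (use p xf in auto)
  have "pos_at p q (u \<cdot> g) y = f \<cdot> pair x p g y" if "over x p g y" for g y
  proof -
    have "pos_at p q (u \<cdot> g) y = prod_fst E (tgt q) (src p) \<cdot> (e \<cdot> pair (tri_base E p q) p (u \<cdot> g) y)"
      using that u(1-4) reassoc[OF u(4), of g] p q by (simp add: pos_at_def ev)
    also have "\<dots> = f \<cdot> pair x p g y"
      unfolding u(5)[OF that] using that reassoc[OF h(4), of "pair x p g y"] p xf by simp
    finally show ?thesis .
  qed
  then show thesis using u that by blast
qed

text \<open>A position behaves like a point together with a function. Of the two components of the
  evaluation, the one in \<open>P\<^sub>*\<close> is always \<open>y\<close>, so agreement of the
  values in \<open>Q\<close> suffices.\<close>

lemma position_eqI: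
  assumes p: "exponentiable E p" and q: "arr q"
    and eq: "tri_base E p q \<cdot> u = tri_base E p q \<cdot> v"
      "\<And>g y. over (tri_base E p q \<cdot> v) p g y \<Longrightarrow> pos_at p q (u \<cdot> g) y = pos_at p q (v \<cdot> g) y"
    and uv: "arr u" "tgt u = src (tri_base E p q)" "arr v" "tgt v = src (tri_base E p q)" "src u = src v"
  shows "u = v"
proof -
  obtain e where pi: "is_pi p (prod_snd E (tgt q) (src p)) (tri_base E p q) e"
    and ev: "tri_ev E p q = prod_fst E (tgt q) (src p) \<cdot> e"
    using tri_pi[OF p q] by blast
  have o: "obj (tgt q)" "obj (src p)" using p q by auto
  note [simp] = product(1-5)[OF o]
  note e [simp] = is_pi_simps[OF pi]
  show ?thesis
  proof (rule is_pi_unique[OF pi])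
    fix g y assume o1: "over (tri_base E p q \<cdot> v) p g y"
    then have o2: "over (tri_base E p q) p (v \<cdot> g) y" "over (tri_base E p q) p (u \<cdot> g) y"
      using uv p q reassoc[OF eq(1), of g] by auto
    have fst: "prod_fst E (tgt q) (src p) \<cdot> (e \<cdot> pair (tri_base E p q) p w y) = pos_at p q w y"
      and snd: "prod_snd E (tgt q) (src p) \<cdot> (e \<cdot> pair (tri_base E p q) p w y) = y"
      if "over (tri_base E p q) p w y" for w
      using that p q reassoc[OF e(6), of "pair (tri_base E p q) p w y"] by (auto simp: pos_at_def ev)
    show "e \<cdot> pair (tri_base E p q) p (u \<cdot> g) y = e \<cdot> pair (tri_base E p q) p (v \<cdot> g) y"
    proof (rule product_eqI[OF o])
      show "prod_fst E (tgt q) (src p) \<cdot> (e \<cdot> pair (tri_base E p q) p (u \<cdot> g) y)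
          = prod_fst E (tgt q) (src p) \<cdot> (e \<cdot> pair (tri_base E p q) p (v \<cdot> g) y)"
        unfolding o2[THEN fst] by (rule eq(2)) (rule o1)
      show "prod_snd E (tgt q) (src p) \<cdot> (e \<cdot> pair (tri_base E p q) p (u \<cdot> g) y)
          = prod_snd E (tgt q) (src p) \<cdot> (e \<cdot> pair (tri_base E p q) p (v \<cdot> g) y)"
        unfolding o2[THEN snd] ..
    qed (use o2 p q in auto)
  qed (use p q eq(1) uv in auto)
qed

text \<open>Justifies the definite description in \<open>pos_pair\<close>.\<close>

lemma pos_pair_ex1:
  assumes p: "exponentiable E p" and q: "arr q"
    and xf: "arr x" "tgt x = tgt p" "arr f" "src f = pb E x p" "tgt f = tgt q"
  shows "\<exists>!u. u \<in> Hom E (src x) (tgt (p \<triangleleft> q)) \<and> pos_fst E p q u = x \<and> pos_snd E p q u = f"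
proof -
  obtain u where u: "arr u" "src u = src x" "tgt u = src (tri_base E p q)" "tri_base E p q \<cdot> u = x"
    "\<And>g y. over x p g y \<Longrightarrow> pos_at p q (u \<cdot> g) y = f \<cdot> pair x p g y"
    using position_exists[OF assms] by blast
  have t: "tgt (p \<triangleleft> q) = src (tri_base E p q)"
    using p q by (simp add: tri_def)
  have gen: "over x p (p1 x p) (p2 x p)"
    using xf p pb_commutes by simp
  show ?thesis
    unfolding t pos_snd_def pos_fst_def Let_def pos_at_def[symmetric]
  proof (rule ex1I[of _ u])
    show "u \<in> Hom E (src x) (src (tri_base E p q)) \<and> tri_base E p q \<cdot> u = x \<and>
        pos_at p q (u \<cdot> p1 (tri_base E p q \<cdot> u) p) (p2 (tri_base E p q \<cdot> u) p) = f"
      using u(1-4) u(5)[OF gen] xf p by (auto intro!: HomI)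
  next
    fix v
    assume "v \<in> Hom E (src x) (src (tri_base E p q)) \<and> tri_base E p q \<cdot> v = x \<and>
        pos_at p q (v \<cdot> p1 (tri_base E p q \<cdot> v) p) (p2 (tri_base E p q \<cdot> v) p) = f"
    then have v: "arr v" "src v = src x" "tgt v = src (tri_base E p q)" "tri_base E p q \<cdot> v = x"
      "pos_at p q (v \<cdot> p1 x p) (p2 x p) = f"
      by (auto dest: HomD)
    show "v = u"
    proof (rule position_eqI[OF p q])
      fix g y assume "over (tri_base E p q \<cdot> u) p g y"
      then have o: "over x p g y" by (simp add: u(4))
      have "pos_at p q (v \<cdot> g) y = f \<cdot> pair x p g y"
        using eval_at[of "tri_base E p q" p "tri_ev E p q" v x g y] p q v o by (simp add: pos_at_def)
      then show "pos_at p q (v \<cdot> g) y = pos_at p q (u \<cdot> g) y"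
        using u(5)[OF o] by simp
    qed (use u v in auto)
  qed
qed

lemma pos_pair_simps [simp]:
  assumes p: "exponentiable E p" and q: "arr q"
    and xf: "arr x" "tgt x = tgt p" "arr f" "src f = pb E x p" "tgt f = tgt q"
  shows "arr (pos_pair E p q x f)" "src (pos_pair E p q x f) = src x"
    "tgt (pos_pair E p q x f) = src (tri_base E p q)" "tri_base E p q \<cdot> pos_pair E p q x f = x"
    "over x p g y \<Longrightarrow> pos_at p q (pos_pair E p q x f \<cdot> g) y = f \<cdot> pair x p g y"
proof -
  obtain u where u: "arr u" "src u = src x" "tgt u = src (tri_base E p q)" "tri_base E p q \<cdot> u = x"
    "\<And>g y. over x p g y \<Longrightarrow> pos_at p q (u \<cdot> g) y = f \<cdot> pair x p g y"
    using position_exists[OF assms] by blast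
  have t: "tgt (p \<triangleleft> q) = src (tri_base E p q)"
    using p q by (simp add: tri_def)
  have gen: "over x p (p1 x p) (p2 x p)"
    using xf p pb_commutes by simp
  have "u \<in> Hom E (src x) (tgt (p \<triangleleft> q)) \<and> pos_fst E p q u = x \<and> pos_snd E p q u = f"
    unfolding t pos_snd_def pos_fst_def Let_def pos_at_def[symmetric]
    using u(1-4) u(5)[OF gen] xf p by (auto intro!: HomI)
  then have "pos_pair E p q x f = u"
    unfolding pos_pair_def by (rule the1_equality[OF pos_pair_ex1[OF assms]])
  then show "arr (pos_pair E p q x f)" "src (pos_pair E p q x f) = src x"
    "tgt (pos_pair E p q x f) = src (tri_base E p q)" "tri_base E p q \<cdot> pos_pair E p q x f = x"
    "over x p g y \<Longrightarrow> pos_at p q (pos_pair E p q x f \<cdot> g) y = f \<cdot> pair x p g y"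
    using u by auto
qed

lemma tri_simps [simp]:
  assumes "exponentiable E p" "arr q"
  shows "arr (p \<triangleleft> q)" "src (p \<triangleleft> q) = pb E (tri_ev E p q) q" "tgt (p \<triangleleft> q) = src (tri_base E p q)"
  using assms by (simp_all add: tri_def)

text \<open>By construction \<open>p \<triangleleft> q\<close> is a pullback of \<open>q\<close>
  followed by a pullback of \<open>p\<close>.\<close>

lemma exponentiable_tri [simp]:
  assumes "exponentiable E p" "exponentiable E q"
  shows "exponentiable E (p \<triangleleft> q)"
  unfolding tri_def using assms by (intro exponentiable_comp exponentiable_pullback) simp_all

lemma dir_simps [simp]:
  assumes p: "exponentiable E p" and q: "arr q" and d: "arr d" "tgt d = pb E (tri_ev E p q) q"
  shows "arr (dir_fst E p q d)" "src (dir_fst E p q d) = src d" "tgt (dir_fst E p q d) = src p"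
    "arr (dir_snd E p q d)" "src (dir_snd E p q d) = src d" "tgt (dir_snd E p q d) = src q"
    "arr g \<Longrightarrow> tgt g = src d \<Longrightarrow> dir_fst E p q (d \<cdot> g) = dir_fst E p q d \<cdot> g"
    "arr g \<Longrightarrow> tgt g = src d \<Longrightarrow> dir_snd E p q (d \<cdot> g) = dir_snd E p q d \<cdot> g"
  using assms by (simp_all add: dir_fst_def dir_snd_def)

text \<open>The two pullback squares in the definition of \<open>tri\<close> say that
  \<open>y\<close> lies over \<open>x\<close> and \<open>z\<close> over \<open>f(y)\<close>. These
  equations are the source of the composability conditions in the comonoid calculations.\<close>

lemma dir_over:
  assumes p: "exponentiable E p" and q: "arr q" and d: "arr d" "tgt d = pb E (tri_ev E p q) q"
    and u: "(p \<triangleleft> q) \<cdot> d = u"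
  shows "arr u" "src u = src d" "tgt u = src (tri_base E p q)"
    "tri_base E p q \<cdot> u = p \<cdot> dir_fst E p q d"
    "pos_at p q u (dir_fst E p q d) = q \<cdot> dir_snd E p q d"
proof -
  have eq: "tri_base E p q \<cdot> u = p \<cdot> dir_fst E p q d"
    using p q d pb_commutes'[of "tri_base E p q" p "p1 (tri_ev E p q) q \<cdot> d"]
    unfolding u[symmetric] by (simp add: tri_def dir_fst_def)
  then show "tri_base E p q \<cdot> u = p \<cdot> dir_fst E p q d" .
  show "arr u" "src u = src d" "tgt u = src (tri_base E p q)"
    using p q d unfolding u[symmetric] by simp_all
  have "pair (tri_base E p q) p u (dir_fst E p q d) = p1 (tri_ev E p q) q \<cdot> d"
    using p q d pair_eta[of "tri_base E p q" p "p1 (tri_ev E p q) q \<cdot> d"]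
    unfolding u[symmetric] by (simp add: tri_def dir_fst_def)
  then show "pos_at p q u (dir_fst E p q d) = q \<cdot> dir_snd E p q d"
    using p q d pb_commutes'[of "tri_ev E p q" q d] by (simp add: pos_at_def dir_snd_def)
qed

lemma dir_pair_simps [simp]:
  assumes p: "exponentiable E p" and q: "arr q" and o: "over (tri_base E p q) p u y"
    and z: "arr z" "src z = src y" "tgt z = src q" "pos_at p q u y = q \<cdot> z"
  shows "arr (dir_pair E p q u y z)" "src (dir_pair E p q u y z) = src u"
    "tgt (dir_pair E p q u y z) = pb E (tri_ev E p q) q"
    "(p \<triangleleft> q) \<cdot> dir_pair E p q u y z = u"
    "dir_fst E p q (dir_pair E p q u y z) = y" "dir_snd E p q (dir_pair E p q u y z) = z"
    "arr g \<Longrightarrow> tgt g = src u \<Longrightarrow> dir_pair E p q u y z \<cdot> g = dir_pair E p q (u \<cdot> g) (y \<cdot> g) (z \<cdot> g)"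
  using assms by (auto simp: dir_pair_def pos_at_def tri_def dir_fst_def dir_snd_def)

lemma dir_eta:
  assumes p: "exponentiable E p" and q: "arr q" and d: "arr d" "tgt d = pb E (tri_ev E p q) q"
    and u: "(p \<triangleleft> q) \<cdot> d = u"
  shows "dir_pair E p q u (dir_fst E p q d) (dir_snd E p q d) = d"
proof -
  have "pair (tri_base E p q) p u (dir_fst E p q d) = p1 (tri_ev E p q) q \<cdot> d"
    using p q d pair_eta[of "tri_base E p q" p "p1 (tri_ev E p q) q \<cdot> d"]
    unfolding u[symmetric] by (simp add: tri_def dir_fst_def)
  then show ?thesis
    using p q d pair_eta[of "tri_ev E p q" q d] by (simp add: dir_pair_def dir_snd_def)
qed

lemma dir_at_simps [simp]:
  assumes "is_poly_mor E \<phi>" "over (on_pos \<phi>) (p_tgt \<phi>) x y"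
  shows "arr (dir_at E \<phi> x y)" "src (dir_at E \<phi> x y) = src y" "tgt (dir_at E \<phi> x y) = src (p_src \<phi>)"
    "p_src \<phi> \<cdot> dir_at E \<phi> x y = x"
    "arr g \<Longrightarrow> tgt g = src x \<Longrightarrow> dir_at E \<phi> x y \<cdot> g = dir_at E \<phi> (x \<cdot> g) (y \<cdot> g)"
proof -
  note p = assms(1)[unfolded is_poly_mor_def Hom_def]
  have s: "p_src \<phi> \<cdot> on_dir \<phi> = p1 (on_pos \<phi>) (p_tgt \<phi>)" using p by simp
  show "arr (dir_at E \<phi> x y)" "src (dir_at E \<phi> x y) = src y" "tgt (dir_at E \<phi> x y) = src (p_src \<phi>)"
    "p_src \<phi> \<cdot> dir_at E \<phi> x y = x"
    "arr g \<Longrightarrow> tgt g = src x \<Longrightarrow> dir_at E \<phi> x y \<cdot> g = dir_at E \<phi> (x \<cdot> g) (y \<cdot> g)"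
    using p assms(2) reassoc[OF s, of "pair (on_pos \<phi>) (p_tgt \<phi>) x y"] by (auto simp: dir_at_def)
qed

lemma poly_mor_simps:
  assumes "is_poly_mor E \<phi>"
  shows "exponentiable E (p_src \<phi>)" "exponentiable E (p_tgt \<phi>)" "arr (on_pos \<phi>)"
    "src (on_pos \<phi>) = tgt (p_src \<phi>)" "tgt (on_pos \<phi>) = tgt (p_tgt \<phi>)"
  using assms by (auto simp: is_poly_mor_def Hom_def)

text \<open>\<open>on_dir\<close> is \<open>dir_at\<close> on the generic pair of projections, so
  agreement on all elements determines it.\<close>

lemma poly_mor_eqI:
  assumes m: "is_poly_mor E \<phi>" "is_poly_mor E \<psi>"
    and eq: "p_src \<phi> = p_src \<psi>" "p_tgt \<phi> = p_tgt \<psi>" "on_pos \<phi> = on_pos \<psi>"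
    "\<And>x y. over (on_pos \<psi>) (p_tgt \<psi>) x y \<Longrightarrow> dir_at E \<phi> x y = dir_at E \<psi> x y"
  shows "\<phi> = \<psi>"
proof -
  have "dir_at E \<chi> (p1 (on_pos \<chi>) (p_tgt \<chi>)) (p2 (on_pos \<chi>) (p_tgt \<chi>)) = on_dir \<chi>"
    if "is_poly_mor E \<chi>" for \<chi>
    using that by (auto simp: dir_at_def is_poly_mor_def Hom_def)
  moreover have "over (on_pos \<psi>) (p_tgt \<psi>) (p1 (on_pos \<psi>) (p_tgt \<psi>)) (p2 (on_pos \<psi>) (p_tgt \<psi>))"
    using poly_mor_simps[OF m(2)] pb_commutes by simp
  ultimately have "on_dir \<phi> = on_dir \<psi>"
    using m eq by metis
  then show ?thesis using eq(1-3) by (cases \<phi>; cases \<psi>) simp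
qed

lemma is_poly_morI:
  assumes "exponentiable E (p_src \<phi>)" "exponentiable E (p_tgt \<phi>)" "arr (on_pos \<phi>)"
    "src (on_pos \<phi>) = tgt (p_src \<phi>)" "tgt (on_pos \<phi>) = tgt (p_tgt \<phi>)"
    "arr (on_dir \<phi>)" "src (on_dir \<phi>) = pb E (on_pos \<phi>) (p_tgt \<phi>)" "tgt (on_dir \<phi>) = src (p_src \<phi>)"
    "p_src \<phi> \<cdot> on_dir \<phi> = p1 (on_pos \<phi>) (p_tgt \<phi>)"
  shows "is_poly_mor E \<phi>"
  using assms by (auto simp: is_poly_mor_def Hom_def)


section \<open>Morphisms of polynomials on generalized elements\<close>

text \<open>A Yoneda argument: an operation \<open>D\<close> on pairs that commutes with restriction
  is given by composition with its value on the generic pair. Each morphism whose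
  \<open>on_dir\<close> is defined on projections gets its elementwise formula this way.\<close>

lemma poly_mor_by_elements:
  assumes ty: "exponentiable E (p_src \<chi>)" "exponentiable E (p_tgt \<chi>)" "arr (on_pos \<chi>)"
      "src (on_pos \<chi>) = tgt (p_src \<chi>)" "tgt (on_pos \<chi>) = tgt (p_tgt \<chi>)"
    and D: "on_dir \<chi> = D (p1 (on_pos \<chi>) (p_tgt \<chi>)) (p2 (on_pos \<chi>) (p_tgt \<chi>))"
    and D_typ: "\<And>x y. over (on_pos \<chi>) (p_tgt \<chi>) x y \<Longrightarrow>
      arr (D x y) \<and> src (D x y) = src y \<and> tgt (D x y) = src (p_src \<chi>) \<and> p_src \<chi> \<cdot> D x y = x"
    and D_nat: "\<And>x y g. over (on_pos \<chi>) (p_tgt \<chi>) x y \<Longrightarrow> arr g \<Longrightarrow> tgt g = src y \<Longrightarrow>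
      D x y \<cdot> g = D (x \<cdot> g) (y \<cdot> g)"
  shows "is_poly_mor E \<chi>"
    and "\<And>x y. over (on_pos \<chi>) (p_tgt \<chi>) x y \<Longrightarrow> dir_at E \<chi> x y = D x y"
proof -
  have gen: "over (on_pos \<chi>) (p_tgt \<chi>) (p1 (on_pos \<chi>) (p_tgt \<chi>)) (p2 (on_pos \<chi>) (p_tgt \<chi>))"
    using ty pb_commutes by simp
  show "is_poly_mor E \<chi>"
    using D_typ[OF gen] ty by (intro is_poly_morI) (simp_all add: D)
  show "dir_at E \<chi> x y = D x y" if "over (on_pos \<chi>) (p_tgt \<chi>) x y" for x y
    using D_nat[OF gen, of "pair (on_pos \<chi>) (p_tgt \<chi>) x y"] that ty
    by (simp add: dir_at_def D)
qed

lemma poly_id_sel [simp]: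
  "p_src (poly_id E p) = p" "p_tgt (poly_id E p) = p" "on_pos (poly_id E p) = ide (tgt p)"
  by (simp_all add: poly_id_def)

lemma poly_id:
  assumes "exponentiable E p"
  shows "is_poly_mor E (poly_id E p)"
    and "\<And>x y. over (ide (tgt p)) p x y \<Longrightarrow> dir_at E (poly_id E p) x y = y"
proof -
  note * = poly_mor_by_elements[of "poly_id E p" "\<lambda>x y. y", unfolded poly_id_sel]
  show "is_poly_mor E (poly_id E p)"
    by (rule *(1)) (use assms in \<open>auto simp: poly_id_def\<close>)
  show "dir_at E (poly_id E p) x y = y" if "over (ide (tgt p)) p x y" for x y
    by (rule *(2)) (use assms that in \<open>auto simp: poly_id_def\<close>)
qed

lemma poly_comp_sel [simp]:
  "p_src (poly_comp E \<psi> \<phi>) = p_src \<phi>" "p_tgt (poly_comp E \<psi> \<phi>) = p_tgt \<psi>"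
  "on_pos (poly_comp E \<psi> \<phi>) = on_pos \<psi> \<cdot> on_pos \<phi>"
  by (simp_all add: poly_comp_def Let_def)

lemma poly_comp:
  assumes \<phi>: "is_poly_mor E \<phi>" and \<psi>: "is_poly_mor E \<psi>" and eq: "p_tgt \<phi> = p_src \<psi>"
  shows "is_poly_mor E (poly_comp E \<psi> \<phi>)"
    and "\<And>x z. over (on_pos \<psi> \<cdot> on_pos \<phi>) (p_tgt \<psi>) x z \<Longrightarrow>
      dir_at E (poly_comp E \<psi> \<phi>) x z = dir_at E \<phi> x (dir_at E \<psi> (on_pos \<phi> \<cdot> x) z)"
proof -
  note s = poly_mor_simps[OF \<phi>] poly_mor_simps[OF \<psi>] eq
  define \<chi> where "\<chi> = poly_comp E \<psi> \<phi>"
  have sel: "p_src \<chi> = p_src \<phi>" "p_tgt \<chi> = p_tgt \<psi>" "on_pos \<chi> = on_pos \<psi> \<cdot> on_pos \<phi>"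
    by (simp_all add: \<chi>_def)
  define D where "D = (\<lambda>x z. dir_at E \<phi> x (dir_at E \<psi> (on_pos \<phi> \<cdot> x) z))"
  note * = poly_mor_by_elements[of \<chi> D, unfolded sel]
  have D: "on_dir \<chi> = D (p1 (on_pos \<psi> \<cdot> on_pos \<phi>) (p_tgt \<psi>)) (p2 (on_pos \<psi> \<cdot> on_pos \<phi>) (p_tgt \<psi>))"
    by (simp add: \<chi>_def poly_comp_def Let_def D_def)
  have D_typ: "arr (D x y) \<and> src (D x y) = src y \<and> tgt (D x y) = src (p_src \<phi>) \<and> p_src \<phi> \<cdot> D x y = x"
    and D_nat: "arr g \<Longrightarrow> tgt g = src y \<Longrightarrow> D x y \<cdot> g = D (x \<cdot> g) (y \<cdot> g)"
    if "over (on_pos \<psi> \<cdot> on_pos \<phi>) (p_tgt \<psi>) x y" for x y g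
    using that \<phi> \<psi> s by (auto simp: D_def)
  show "is_poly_mor E (poly_comp E \<psi> \<phi>)"
    unfolding \<chi>_def[symmetric]
    by (rule *(1)) (use s D D_typ D_nat in simp_all)
  show "dir_at E (poly_comp E \<psi> \<phi>) x z = dir_at E \<phi> x (dir_at E \<psi> (on_pos \<phi> \<cdot> x) z)"
    if "over (on_pos \<psi> \<cdot> on_pos \<phi>) (p_tgt \<psi>) x z" for x z
    unfolding \<chi>_def[symmetric]
    by (rule *(2)[unfolded D_def]) (use that s D D_typ D_nat in \<open>simp_all add: D_def\<close>)
qed

text \<open>The definition treats the universal position only. The last clause extends it by
  naturality to every position \<open>u\<close>: a direction is first pulled back along
  \<open>\<phi>\<close>, then the old function is applied, then \<open>\<psi>\<close>.\<close>

lemma tri_pos: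
  assumes \<phi>: "is_poly_mor E \<phi>" and \<psi>: "is_poly_mor E \<psi>"
    and pq: "p_src \<phi> = p" "p_tgt \<phi> = p'" "p_src \<psi> = q" "p_tgt \<psi> = q'"
  shows "arr (tri_pos E \<phi> \<psi>)" "src (tri_pos E \<phi> \<psi>) = src (tri_base E p q)"
    "tgt (tri_pos E \<phi> \<psi>) = src (tri_base E p' q')"
    "tri_base E p' q' \<cdot> tri_pos E \<phi> \<psi> = on_pos \<phi> \<cdot> tri_base E p q"
    "\<And>u y'. over (on_pos \<phi> \<cdot> tri_base E p q) p' u y' \<Longrightarrow>
      pos_at p' q' (tri_pos E \<phi> \<psi> \<cdot> u) y' = on_pos \<psi> \<cdot> pos_at p q u (dir_at E \<phi> (tri_base E p q \<cdot> u) y')"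
proof -
  note s [simp] = poly_mor_simps[OF \<phi>, unfolded pq] poly_mor_simps[OF \<psi>, unfolded pq]
  note [simp] = pq \<phi> \<psi> dir_at_simps(4)[OF \<phi>, unfolded pq] dir_at_simps(4)[OF \<psi>, unfolded pq]
  define x where "x = tri_base E p q"
  define x' where "x' = on_pos \<phi> \<cdot> x"
  have x [simp]: "arr x" "tgt x = tgt p" "arr x'" "src x' = src x" "tgt x' = tgt p'"
    by (simp_all add: x_def x'_def)
  define y where "y = dir_at E \<phi> (x \<cdot> p1 x' p') (p2 x' p')"
  have o: "over (on_pos \<phi>) p' (x \<cdot> p1 x' p') (p2 x' p')"
    using pb_commutes[of x' p'] by (simp add: x'_def)
  have y [simp]: "arr y" "src y = pb E x' p'" "tgt y = src p" "p \<cdot> y = x \<cdot> p1 x' p'"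
    using dir_at_simps[of \<phi> "x \<cdot> p1 x' p'" "p2 x' p'"] o by (simp_all add: y_def)
  have t: "tri_pos E \<phi> \<psi> = pos_pair E p' q' x' (on_pos \<psi> \<cdot> pos_at p q (p1 x' p') y)"
    by (simp add: tri_pos_def Let_def pos_at_def y_def x_def x'_def)
  have P [simp]: "arr (on_pos \<psi> \<cdot> pos_at p q (p1 x' p') y)" "src (on_pos \<psi> \<cdot> pos_at p q (p1 x' p') y) = pb E x' p'"
    "tgt (on_pos \<psi> \<cdot> pos_at p q (p1 x' p') y) = tgt q'"
    using x_def by simp_all
  show "arr (tri_pos E \<phi> \<psi>)" "src (tri_pos E \<phi> \<psi>) = src (tri_base E p q)"
    "tgt (tri_pos E \<phi> \<psi>) = src (tri_base E p' q')"
    "tri_base E p' q' \<cdot> tri_pos E \<phi> \<psi> = on_pos \<phi> \<cdot> tri_base E p q"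
    unfolding t by (simp_all, simp_all add: x_def x'_def)
  fix u y' assume "over (on_pos \<phi> \<cdot> tri_base E p q) p' u y'"
  then have o': "over x' p' u y'"
    by (simp add: x'_def x_def)
  have "pos_at p' q' (tri_pos E \<phi> \<psi> \<cdot> u) y' = (on_pos \<psi> \<cdot> pos_at p q (p1 x' p') y) \<cdot> pair x' p' u y'"
    unfolding t by (rule pos_pair_simps(5)) (use o' in simp_all)
  also have "\<dots> = on_pos \<psi> \<cdot> pos_at p q u (y \<cdot> pair x' p' u y')"
    using o' x_def by simp
  also have "y \<cdot> pair x' p' u y' = dir_at E \<phi> (x \<cdot> u) y'"
    unfolding y_def using o o' by simp
  finally show "pos_at p' q' (tri_pos E \<phi> \<psi> \<cdot> u) y' = on_pos \<psi> \<cdot> pos_at p q u (dir_at E \<phi> (tri_base E p q \<cdot> u) y')"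
    by (simp add: x_def)
qed

lemma tri_mor_sel [simp]:
  "p_src (\<phi> \<triangleleft>m \<psi>) = p_src \<phi> \<triangleleft> p_src \<psi>" "p_tgt (\<phi> \<triangleleft>m \<psi>) = p_tgt \<phi> \<triangleleft> p_tgt \<psi>"
  "on_pos (\<phi> \<triangleleft>m \<psi>) = tri_pos E \<phi> \<psi>"
  by (simp_all add: tri_mor_def)

text \<open>The point to check is that the pulled-back pair is a direction at \<open>u\<close>: its
  first component lies over the base of \<open>u\<close> because \<open>on_dir\<close> is a map over
  positions, and the second lies over the value there by the evaluation formula in
  \<open>tri_pos\<close>.\<close>

lemma tri_mor:
  assumes \<phi>: "is_poly_mor E \<phi>" and \<psi>: "is_poly_mor E \<psi>"
    and pq: "p_src \<phi> = p" "p_tgt \<phi> = p'" "p_src \<psi> = q" "p_tgt \<psi> = q'"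
  shows "is_poly_mor E (\<phi> \<triangleleft>m \<psi>)"
    and "\<And>u d. over (tri_pos E \<phi> \<psi>) (p' \<triangleleft> q') u d \<Longrightarrow>
      dir_at E (\<phi> \<triangleleft>m \<psi>) u d =
        (let y = dir_at E \<phi> (tri_base E p q \<cdot> u) (dir_fst E p' q' d)
         in dir_pair E p q u y (dir_at E \<psi> (pos_at p q u y) (dir_snd E p' q' d)))"
proof -
  note s [simp] = poly_mor_simps[OF \<phi>, unfolded pq] poly_mor_simps[OF \<psi>, unfolded pq]
  note [simp] = pq \<phi> \<psi> dir_at_simps(4)[OF \<phi>, unfolded pq] dir_at_simps(4)[OF \<psi>, unfolded pq]
  note T [simp] = tri_pos[OF \<phi> \<psi> pq]
  define D where "D = (\<lambda>u d. let y = dir_at E \<phi> (tri_base E p q \<cdot> u) (dir_fst E p' q' d)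
         in dir_pair E p q u y (dir_at E \<psi> (pos_at p q u y) (dir_snd E p' q' d)))"
  note * = poly_mor_by_elements[of "\<phi> \<triangleleft>m \<psi>" D, unfolded tri_mor_sel pq]
  have D: "on_dir (\<phi> \<triangleleft>m \<psi>) = D (p1 (tri_pos E \<phi> \<psi>) (p' \<triangleleft> q')) (p2 (tri_pos E \<phi> \<psi>) (p' \<triangleleft> q'))"
    by (simp add: tri_mor_def tri_dir_def D_def Let_def pos_at_def)
  have D_typ: "arr (D u d) \<and> src (D u d) = src d \<and> tgt (D u d) = src (p \<triangleleft> q) \<and> (p \<triangleleft> q) \<cdot> D u d = u"
    and D_nat: "arr g \<Longrightarrow> tgt g = src d \<Longrightarrow> D u d \<cdot> g = D (u \<cdot> g) (d \<cdot> g)"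
    if o: "over (tri_pos E \<phi> \<psi>) (p' \<triangleleft> q') u d" for u d g
  proof -
    have d [simp]: "arr d" "tgt d = pb E (tri_ev E p' q') q'" "src u = src d" "arr u" "tgt u = src (tri_base E p q)"
      using o by auto
    have "(p' \<triangleleft> q') \<cdot> d = tri_pos E \<phi> \<psi> \<cdot> u"
      using o by auto
    note dd = dir_over[OF s(2) exponentiable_arr[OF s(7)] d(1,2) this]
    define y' where "y' = dir_fst E p' q' d"
    define z' where "z' = dir_snd E p' q' d"
    define y where "y = dir_at E \<phi> (tri_base E p q \<cdot> u) y'"
    have y' [simp]: "arr y'" "src y' = src d" "tgt y' = src p'" "arr z'" "src z' = src d" "tgt z' = src q'"
      by (simp_all add: y'_def z'_def)
    have "tri_base E p' q' \<cdot> (tri_pos E \<phi> \<psi> \<cdot> u) = on_pos \<phi> \<cdot> (tri_base E p q \<cdot> u)"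
      using reassoc[OF T(4), of u] by simp
    then have py: "on_pos \<phi> \<cdot> (tri_base E p q \<cdot> u) = p' \<cdot> y'"
      using dd(4) by (simp add: y'_def)
    have y [simp]: "arr y" "src y = src d" "tgt y = src p" "p \<cdot> y = tri_base E p q \<cdot> u"
      using py by (simp_all add: y_def)
    have "on_pos \<psi> \<cdot> pos_at p q u y = q' \<cdot> z'"
      using dd(5) T(5)[of u y'] py by (simp add: y'_def[symmetric] z'_def[symmetric] y_def)
    then show "arr (D u d) \<and> src (D u d) = src d \<and> tgt (D u d) = src (p \<triangleleft> q) \<and> (p \<triangleleft> q) \<cdot> D u d = u"
      "arr g \<Longrightarrow> tgt g = src d \<Longrightarrow> D u d \<cdot> g = D (u \<cdot> g) (d \<cdot> g)"
      using py by (simp_all add: D_def Let_def y_def[symmetric] y'_def[symmetric] z'_def[symmetric])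
        (simp_all add: y_def)
  qed
  show "is_poly_mor E (\<phi> \<triangleleft>m \<psi>)"
    by (rule *(1)) (use D D_typ D_nat in simp_all)
  show "dir_at E (\<phi> \<triangleleft>m \<psi>) u d =
        (let y = dir_at E \<phi> (tri_base E p q \<cdot> u) (dir_fst E p' q' d)
         in dir_pair E p q u y (dir_at E \<psi> (pos_at p q u y) (dir_snd E p' q' d)))"
    if "over (tri_pos E \<phi> \<psi>) (p' \<triangleleft> q') u d" for u d
    by (rule *(2)[unfolded D_def]) (use that D D_typ D_nat in \<open>simp_all add: D_def\<close>)
qed


section \<open>The unit polynomial, the unitors and the associator on elements\<close>

lemma y_poly_simps [simp]:
  "exponentiable E (y_poly E)" "src (y_poly E) = one" "tgt (y_poly E) = one"
  by (simp_all add: y_poly_def exponentiable_ide)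

lemma left_unitor_sel [simp]:
  "p_src (left_unitor E c) = c" "p_tgt (left_unitor E c) = y_poly E \<triangleleft> c"
  by (simp_all add: left_unitor_def Let_def)

text \<open>The function part of the position takes the value \<open>x\<close> at its only
  direction, hence the second component of a direction there lies over \<open>x\<close>. Equations
  between arrows to the terminal object are discharged by \<open>terminal_unique\<close>.\<close>

lemma left_unitor:
  assumes c: "exponentiable E c"
  defines "u \<equiv> on_pos (left_unitor E c)"
  shows "is_poly_mor E (left_unitor E c)"
    and "arr u" "src u = tgt c" "tgt u = src (tri_base E (y_poly E) c)"
    and "\<And>x z. over (bang E (tgt c)) (y_poly E) x z \<Longrightarrow> pos_at (y_poly E) c (u \<cdot> x) z = x"
    and "\<And>x d. over u (y_poly E \<triangleleft> c) x d \<Longrightarrow> dir_at E (left_unitor E c) x d = dir_snd E (y_poly E) c d"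
proof -
  note [simp] = c
  let ?y = "y_poly E"
  have u: "u = pos_pair E ?y c (bang E (tgt c)) (p1 (bang E (tgt c)) ?y)"
    by (simp add: u_def left_unitor_def Let_def)
  have u_simps [simp]: "arr u" "src u = tgt c" "tgt u = src (tri_base E ?y c)"
    by (simp_all add: u)
  then show "arr u" "src u = tgt c" "tgt u = src (tri_base E ?y c)" .
  have at: "pos_at ?y c (u \<cdot> x) z = x" if "over (bang E (tgt c)) ?y x z" for x z
  proof -
    have "pos_at ?y c (u \<cdot> x) z = p1 (bang E (tgt c)) ?y \<cdot> pair (bang E (tgt c)) ?y x z"
      unfolding u by (rule pos_pair_simps(5)) (use that in simp_all)
    then show ?thesis using that by simp
  qed
  then show "\<And>x z. over (bang E (tgt c)) ?y x z \<Longrightarrow> pos_at ?y c (u \<cdot> x) z = x" .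
  have D_ty: "c \<cdot> dir_snd E ?y c d = x" if o: "over u (?y \<triangleleft> c) x d" for x d
  proof -
    have d: "arr d" "tgt d = pb E (tri_ev E ?y c) c" "(?y \<triangleleft> c) \<cdot> d = u \<cdot> x" "src x = src d" "arr x" "tgt x = tgt c"
      using o by auto
    have "over (bang E (tgt c)) ?y x (dir_fst E ?y c d)"
      using d by (auto intro!: terminal_unique)
    from at[OF this] show ?thesis
      using dir_over(5)[OF _ _ d(1-3)] by simp
  qed
  note * = poly_mor_by_elements[of "left_unitor E c" "\<lambda>x d. dir_snd E ?y c d", unfolded left_unitor_sel u_def[symmetric]]
  have D: "on_dir (left_unitor E c) = dir_snd E ?y c (p2 u (?y \<triangleleft> c))"
    by (simp add: left_unitor_def Let_def u)
  show "is_poly_mor E (left_unitor E c)"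
    by (rule *(1)) (use D D_ty in simp_all)
  show "dir_at E (left_unitor E c) x d = dir_snd E ?y c d" if "over u (?y \<triangleleft> c) x d" for x d
    by (rule *(2)) (use that D D_ty in simp_all)
qed

lemma right_unitor_sel [simp]:
  "p_src (right_unitor E c) = c" "p_tgt (right_unitor E c) = c \<triangleleft> y_poly E"
  by (simp_all add: right_unitor_def Let_def)

lemma right_unitor:
  assumes c: "exponentiable E c"
  defines "u \<equiv> on_pos (right_unitor E c)"
  shows "is_poly_mor E (right_unitor E c)"
    and "arr u" "src u = tgt c" "tgt u = src (tri_base E c (y_poly E))"
    and "tri_base E c (y_poly E) \<cdot> u = ide (tgt c)"
    and "\<And>x d. over u (c \<triangleleft> y_poly E) x d \<Longrightarrow> dir_at E (right_unitor E c) x d = dir_fst E c (y_poly E) d"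
proof -
  note [simp] = c
  let ?y = "y_poly E"
  have u: "u = pos_pair E c ?y (ide (tgt c)) (bang E (pb E (ide (tgt c)) c))"
    by (simp add: u_def right_unitor_def Let_def)
  have u_simps [simp]: "arr u" "src u = tgt c" "tgt u = src (tri_base E c ?y)" "tri_base E c ?y \<cdot> u = ide (tgt c)"
    by (simp_all add: u)
  then show "arr u" "src u = tgt c" "tgt u = src (tri_base E c ?y)" "tri_base E c ?y \<cdot> u = ide (tgt c)" .
  have D_ty: "c \<cdot> dir_fst E c ?y d = x" if o: "over u (c \<triangleleft> ?y) x d" for x d
  proof -
    have d: "arr d" "tgt d = pb E (tri_ev E c ?y) ?y" "(c \<triangleleft> ?y) \<cdot> d = u \<cdot> x" "src x = src d" "arr x" "tgt x = tgt c"
      using o by auto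
    show ?thesis
      using dir_over(4)[OF _ _ d(1-3)] reassoc[OF u_simps(4), of x] d by simp
  qed
  note * = poly_mor_by_elements[of "right_unitor E c" "\<lambda>x d. dir_fst E c ?y d", unfolded right_unitor_sel u_def[symmetric]]
  have D: "on_dir (right_unitor E c) = dir_fst E c ?y (p2 u (c \<triangleleft> ?y))"
    by (simp add: right_unitor_def Let_def u)
  show "is_poly_mor E (right_unitor E c)"
    by (rule *(1)) (use D D_ty in simp_all)
  show "dir_at E (right_unitor E c) x d = dir_fst E c ?y d" if "over u (c \<triangleleft> ?y) x d" for x d
    by (rule *(2)) (use that D D_ty in simp_all)
qed

text \<open>The last two clauses describe the inner position attached to \<open>y\<close>: its base
  is \<open>f(y)\<close>, and its value at \<open>z\<close> is \<open>g(y, z)\<close>. The last one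
  takes \<open>z\<close> with the source of \<open>y\<close>, since any further restriction can be
  absorbed into \<open>h\<close> and \<open>y\<close>.\<close>

lemma assoc_pos:
  assumes p: "exponentiable E p" and q: "exponentiable E q" and r: "exponentiable E r"
  defines "u \<equiv> assoc_pos E p q r" and "a \<equiv> tri_base E (p \<triangleleft> q) r"
  shows "arr u" "src u = src a" "tgt u = src (tri_base E p (q \<triangleleft> r))"
    "tri_base E p (q \<triangleleft> r) \<cdot> u = tri_base E p q \<cdot> a"
    "\<And>h y. over (tri_base E p q \<cdot> a) p h y \<Longrightarrow>
      tri_base E q r \<cdot> pos_at p (q \<triangleleft> r) (u \<cdot> h) y = pos_at p q (a \<cdot> h) y"
    "\<And>h y z. over (tri_base E p q \<cdot> a) p h y \<Longrightarrow> over (pos_at p q (a \<cdot> h) y) q (ide (src y)) z \<Longrightarrow>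
      pos_at q r (pos_at p (q \<triangleleft> r) (u \<cdot> h) y) z = pos_at (p \<triangleleft> q) r h (dir_pair E p q (a \<cdot> h) y z)"
proof -
  note [simp] = p q r
  have a [simp]: "arr a" "tgt a = src (tri_base E p q)"
    by (simp_all add: a_def)
  define x where "x = tri_base E p q \<cdot> a"
  have x [simp]: "arr x" "src x = src a" "tgt x = tgt p"
    by (simp_all add: x_def)
  have bx [simp]: "tri_base E p q \<cdot> (a \<cdot> h) = x \<cdot> h" if "arr h" "tgt h = src a" for h
    using that by (simp add: x_def)
  define f where "f = pos_at p q (a \<cdot> p1 x p) (p2 x p)"
  have gen: "over (tri_base E p q) p (a \<cdot> p1 x p) (p2 x p)"
    using pb_commutes[of x p] by simp
  then have f [simp]: "arr f" "src f = pb E x p" "tgt f = tgt q"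
    unfolding f_def by simp_all
  have f_pair [simp]: "f \<cdot> pair x p h y = pos_at p q (a \<cdot> h) y" if "over x p h y" for h y
    using that gen unfolding f_def by simp
  \<comment> \<open>\<open>t\<close>, \<open>y\<close> and \<open>z\<close> are the components of
    the generic triple: a position, a direction of \<open>p\<close> there, and a direction of
    \<open>q\<close> over its value.\<close>
  define t where "t = p1 x p \<cdot> p1 f q"
  define y where "y = p2 x p \<cdot> p1 f q"
  define z where "z = p2 f q"
  have t [simp]: "arr t" "src t = pb E f q" "tgt t = src a" "arr y" "src y = pb E f q" "tgt y = src p"
    "arr z" "src z = pb E f q" "tgt z = src q"
    by (simp_all add: t_def y_def z_def)
  have ty: "x \<cdot> t = p \<cdot> y"
    using pb_commutes'[of x p "p1 f q"] by (simp add: t_def y_def)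
  have "p1 f q = pair x p t y"
    using pair_eta[of x p "p1 f q"] by (simp add: t_def y_def)
  then have fz: "pos_at p q (a \<cdot> t) y = q \<cdot> z"
    using f_pair[of t y] ty pb_commutes[of f q] by (simp add: z_def)
  define g where "g = pos_at (p \<triangleleft> q) r t (dir_pair E p q (a \<cdot> t) y z)"
  have og: "over a (p \<triangleleft> q) t (dir_pair E p q (a \<cdot> t) y z)"
    using ty fz by simp
  have g [simp]: "arr g" "src g = pb E f q" "tgt g = tgt r"
    using pos_at_simps(1-3)[OF exponentiable_tri[OF p q] exponentiable_arr[OF r] og[unfolded a_def], folded a_def]
      ty fz by (simp_all add: g_def)
  define v where "v = pos_pair E q r f g"
  have v [simp]: "arr v" "src v = pb E x p" "tgt v = src (tri_base E q r)" "tri_base E q r \<cdot> v = f"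
    by (simp_all add: v_def)
  have u: "u = pos_pair E p (q \<triangleleft> r) x v"
    unfolding u_def v_def g_def z_def y_def t_def f_def x_def a_def pos_at_def
    by (simp add: assoc_pos_def Let_def pos_fst_def pos_snd_def)
  show u_simps: "arr u" "src u = src a" "tgt u = src (tri_base E p (q \<triangleleft> r))"
    "tri_base E p (q \<triangleleft> r) \<cdot> u = tri_base E p q \<cdot> a"
    unfolding x_def[symmetric] u by simp_all
  have u_at: "pos_at p (q \<triangleleft> r) (u \<cdot> h) y' = v \<cdot> pair x p h y'" if "over x p h y'" for h y'
    unfolding u by (rule pos_pair_simps(5)) (use that in simp_all)
  fix h y' assume o': "over (tri_base E p q \<cdot> a) p h y'"
  then have o: "over x p h y'" by (simp add: x_def)
  show "tri_base E q r \<cdot> pos_at p (q \<triangleleft> r) (u \<cdot> h) y' = pos_at p q (a \<cdot> h) y'"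
    unfolding u_at[OF o] using o reassoc[OF v(4), of "pair x p h y'"] by simp
  fix z' assume oz: "over (pos_at p q (a \<cdot> h) y') q (ide (src y')) z'"
  have "arr (pos_at p q (a \<cdot> h) y')" "src (pos_at p q (a \<cdot> h) y') = src y'"
    using o by auto
  with oz have oz': "pos_at p q (a \<cdot> h) y' = q \<cdot> z'" "arr z'" "src z' = src y'" "tgt z' = src q"
    by auto
  \<comment> \<open>The arrow that restricts the generic triple to \<open>(h, y', z')\<close>;
    pushing it through \<open>g\<close> gives the formula.\<close>
  define w where "w = pair f q (pair x p h y') z'"
  have w: "arr w" "src w = src y'" "tgt w = pb E f q" "p1 f q \<cdot> w = pair x p h y'" "z \<cdot> w = z'"
    using o oz' by (simp_all add: w_def z_def)
  have tw: "t \<cdot> w = h" "y \<cdot> w = y'"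
    using w o by (simp_all add: t_def y_def)
  have "pos_at q r (pos_at p (q \<triangleleft> r) (u \<cdot> h) y') z' = g \<cdot> pair f q (pair x p h y') z'"
    unfolding u_at[OF o] v_def by (rule pos_pair_simps(5)) (use o oz' in simp_all)
  also have "\<dots> = g \<cdot> w"
    by (simp add: w_def)
  also have "\<dots> = pos_at (p \<triangleleft> q) r (t \<cdot> w) (dir_pair E p q (a \<cdot> t) y z \<cdot> w)"
    unfolding g_def
    by (rule pos_at_simps(4)[OF exponentiable_tri[OF p q] exponentiable_arr[OF r] og[unfolded a_def], folded a_def])
      (use ty fz w in \<open>simp_all flip: a_def\<close>)
  also have "dir_pair E p q (a \<cdot> t) y z \<cdot> w = dir_pair E p q ((a \<cdot> t) \<cdot> w) (y \<cdot> w) (z \<cdot> w)"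
    by (rule dir_pair_simps(7)) (use ty fz w in simp_all)
  also have "(a \<cdot> t) \<cdot> w = a \<cdot> h"
    using w tw by simp
  finally show "pos_at q r (pos_at p (q \<triangleleft> r) (u \<cdot> h) y') z' = pos_at (p \<triangleleft> q) r h (dir_pair E p q (a \<cdot> h) y' z')"
    unfolding tw w(5) .
qed

lemma associator_sel [simp]:
  "p_src (associator E p q r) = (p \<triangleleft> q) \<triangleleft> r" "p_tgt (associator E p q r) = p \<triangleleft> (q \<triangleleft> r)"
  "on_pos (associator E p q r) = assoc_pos E p q r"
  by (simp_all add: associator_def)

text \<open>To rebracket \<open>(y, (z, w))\<close> as \<open>((y, z), w)\<close>, \<open>z\<close>
  must lie over \<open>f(y)\<close> and \<open>w\<close> over \<open>g(y, z)\<close>. These are the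
  two evaluation clauses of \<open>assoc_pos\<close> combined with \<open>dir_over\<close>.\<close>

lemma associator:
  assumes p: "exponentiable E p" and q: "exponentiable E q" and r: "exponentiable E r"
  shows "is_poly_mor E (associator E p q r)"
    and "\<And>x d. over (assoc_pos E p q r) (p \<triangleleft> (q \<triangleleft> r)) x d \<Longrightarrow>
      dir_at E (associator E p q r) x d =
        (let v = dir_snd E p (q \<triangleleft> r) d in
         dir_pair E (p \<triangleleft> q) r x
           (dir_pair E p q (tri_base E (p \<triangleleft> q) r \<cdot> x) (dir_fst E p (q \<triangleleft> r) d) (dir_fst E q r v))
           (dir_snd E q r v))"
proof -
  note [simp] = p q r
  note A [simp] = assoc_pos(1-4)[OF p q r]
  define D where "D = (\<lambda>x d. let v = dir_snd E p (q \<triangleleft> r) d in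
         dir_pair E (p \<triangleleft> q) r x
           (dir_pair E p q (tri_base E (p \<triangleleft> q) r \<cdot> x) (dir_fst E p (q \<triangleleft> r) d) (dir_fst E q r v))
           (dir_snd E q r v))"
  note * = poly_mor_by_elements[of "associator E p q r" D, unfolded associator_sel]
  have D: "on_dir (associator E p q r) =
      D (p1 (assoc_pos E p q r) (p \<triangleleft> (q \<triangleleft> r))) (p2 (assoc_pos E p q r) (p \<triangleleft> (q \<triangleleft> r)))"
    by (simp add: associator_def assoc_dir_def D_def Let_def)
  have D_ty: "arr (D x d) \<and> src (D x d) = src d \<and> tgt (D x d) = src ((p \<triangleleft> q) \<triangleleft> r) \<and> ((p \<triangleleft> q) \<triangleleft> r) \<cdot> D x d = x"
    and D_nat: "arr g \<Longrightarrow> tgt g = src d \<Longrightarrow> D x d \<cdot> g = D (x \<cdot> g) (d \<cdot> g)"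
    if o: "over (assoc_pos E p q r) (p \<triangleleft> (q \<triangleleft> r)) x d" for x d g
  proof -
    define a where "a = tri_base E (p \<triangleleft> q) r"
    have a [simp]: "arr a" "tgt a = src (tri_base E p q)"
      by (simp_all add: a_def)
    have x [simp]: "arr x" "src x = src d" "tgt x = src a" "arr d" "tgt d = pb E (tri_ev E p (q \<triangleleft> r)) (q \<triangleleft> r)"
      and xd: "(p \<triangleleft> (q \<triangleleft> r)) \<cdot> d = assoc_pos E p q r \<cdot> x"
      using o by (auto simp: a_def)
    note d = dir_over[OF p tri_simps(1)[OF q exponentiable_arr[OF r]] x(4,5) xd]
    define y where "y = dir_fst E p (q \<triangleleft> r) d"
    define v where "v = dir_snd E p (q \<triangleleft> r) d"
    define z where "z = dir_fst E q r v"
    define w where "w = dir_snd E q r v"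
    have yv [simp]: "arr y" "src y = src d" "tgt y = src p" "arr v" "src v = src d" "tgt v = pb E (tri_ev E q r) r"
      "arr z" "src z = src d" "tgt z = src q" "arr w" "src w = src d" "tgt w = src r"
      using dir_simps(1-6)[OF p tri_simps(1)[OF q exponentiable_arr[OF r]] x(4,5)]
      by (simp_all add: y_def v_def z_def w_def)
    have ax: "tri_base E p q \<cdot> (a \<cdot> x) = p \<cdot> y"
      using d(4) reassoc[OF A(4), of x] by (simp add: y_def a_def)
    have oy: "over (tri_base E p q \<cdot> tri_base E (p \<triangleleft> q) r) p x y"
      using ax by (simp add: a_def)
    have "(q \<triangleleft> r) \<cdot> v = pos_at p (q \<triangleleft> r) (assoc_pos E p q r \<cdot> x) y"
      using d(5) by (simp add: y_def v_def)
    note dv = dir_over[OF q exponentiable_arr[OF r] yv(4,6) this, folded z_def w_def]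
    have az: "pos_at p q (a \<cdot> x) y = q \<cdot> z"
      using assoc_pos(5)[OF p q r oy] dv(4) by (simp add: a_def)
    have "over (pos_at p q (tri_base E (p \<triangleleft> q) r \<cdot> x) y) q (ide (src y)) z"
      using ax az by (simp add: a_def)
    from assoc_pos(6)[OF p q r oy this]
    have aw: "pos_at (p \<triangleleft> q) r x (dir_pair E p q (a \<cdot> x) y z) = r \<cdot> w"
      using dv(5) by (simp add: a_def)
    have dp: "arr (dir_pair E p q (a \<cdot> x) y z)" "src (dir_pair E p q (a \<cdot> x) y z) = src d"
      "tgt (dir_pair E p q (a \<cdot> x) y z) = src (p \<triangleleft> q)" "(p \<triangleleft> q) \<cdot> dir_pair E p q (a \<cdot> x) y z = a \<cdot> x"
      using ax az by simp_all
    have Dx: "D x d = dir_pair E (p \<triangleleft> q) r x (dir_pair E p q (a \<cdot> x) y z) w"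
      by (simp add: D_def Let_def y_def v_def z_def w_def a_def)
    show "arr (D x d) \<and> src (D x d) = src d \<and> tgt (D x d) = src ((p \<triangleleft> q) \<triangleleft> r) \<and> ((p \<triangleleft> q) \<triangleleft> r) \<cdot> D x d = x"
      unfolding Dx using dp aw by (simp add: a_def)
    assume g: "arr g" "tgt g = src d"
    have dg: "dir_pair E p q (a \<cdot> x) y z \<cdot> g = dir_pair E p q (a \<cdot> (x \<cdot> g)) (y \<cdot> g) (z \<cdot> g)"
      using ax az g by simp
    have "D x d \<cdot> g = dir_pair E (p \<triangleleft> q) r (x \<cdot> g) (dir_pair E p q (a \<cdot> (x \<cdot> g)) (y \<cdot> g) (z \<cdot> g)) (w \<cdot> g)"
      unfolding Dx dg[symmetric] by (rule dir_pair_simps(7)) (use dp aw g in \<open>simp_all add: a_def\<close>)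
    also have "\<dots> = D (x \<cdot> g) (d \<cdot> g)"
      using g by (simp add: D_def Let_def y_def v_def z_def w_def a_def)
    finally show "D x d \<cdot> g = D (x \<cdot> g) (d \<cdot> g)" .
  qed
  show "is_poly_mor E (associator E p q r)"
    by (rule *(1)) (use D D_ty D_nat in simp_all)
  show "dir_at E (associator E p q r) x d =
        (let v = dir_snd E p (q \<triangleleft> r) d in
         dir_pair E (p \<triangleleft> q) r x
           (dir_pair E p q (tri_base E (p \<triangleleft> q) r \<cdot> x) (dir_fst E p (q \<triangleleft> r) d) (dir_fst E q r v))
           (dir_snd E q r v))"
    if "over (assoc_pos E p q r) (p \<triangleleft> (q \<triangleleft> r)) x d" for x d
    by (rule *(2)[unfolded D_def]) (use that D D_ty D_nat in \<open>simp_all add: D_def\<close>)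
qed

end

section \<open>Comonoids and internal categories\<close>

text \<open>The correspondence between pairs \<open>(\<epsilon>, \<delta>)\<close> and triples \<open>(t, i, k)\<close>, before any of the laws other
  than those that determine the types of \<open>i\<close> and \<open>k\<close> are imposed.\<close>

locale comonoid_presentation = finlim E
  for E :: "('o, 'm) category" (structure) +
  fixes c t i k :: 'm and \<epsilon> \<delta> :: "'m poly_mor"
  assumes c [simp]: "exponentiable E c"
    and \<epsilon> [simp]: "is_poly_mor E \<epsilon>" "p_src \<epsilon> = c" "p_tgt \<epsilon> = y_poly E"
    and \<delta> [simp]: "is_poly_mor E \<delta>" "p_src \<delta> = c" "p_tgt \<delta> = c \<triangleleft> c"
    and t [simp]: "arr t" "src t = src c" "tgt t = tgt c"
    and i [simp]: "arr i" "src i = tgt c" "tgt i = src c" "c \<cdot> i = ide (tgt c)"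
    and k [simp]: "arr k" "src k = pb E t c" "tgt k = src c" "c \<cdot> k = c \<cdot> p1 t c"
    and base [simp]: "tri_base E c c \<cdot> on_pos \<delta> = ide (tgt c)"
    and \<delta>_pos: "\<And>y. arr y \<Longrightarrow> tgt y = src c \<Longrightarrow> pos_at c c (on_pos \<delta> \<cdot> (c \<cdot> y)) y = t \<cdot> y"
    and \<epsilon>_dir: "\<And>x z. over (on_pos \<epsilon>) (y_poly E) x z \<Longrightarrow> dir_at E \<epsilon> x z = i \<cdot> x"
    and \<delta>_dir: "\<And>x d. over (on_pos \<delta>) (c \<triangleleft> c) x d \<Longrightarrow>
      dir_at E \<delta> x d = k \<cdot> pair t c (dir_fst E c c d) (dir_snd E c c d)"
begin

lemma on_pos_simps [simp]:
  "arr (on_pos \<epsilon>)" "src (on_pos \<epsilon>) = tgt c" "tgt (on_pos \<epsilon>) = one"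
  "arr (on_pos \<delta>)" "src (on_pos \<delta>) = tgt c" "tgt (on_pos \<delta>) = src (tri_base E c c)"
  using poly_mor_simps[OF \<epsilon>(1)] poly_mor_simps[OF \<delta>(1)] by simp_all

lemmas ci' [simp] = reassoc[OF i(4)] and ck' [simp] = reassoc[OF k(4)] and base' [simp] = reassoc[OF base]

lemma \<delta>_at [simp]:
  "arr y \<Longrightarrow> tgt y = src c \<Longrightarrow> x = c \<cdot> y \<Longrightarrow> pos_at c c (on_pos \<delta> \<cdot> x) y = t \<cdot> y"
  using \<delta>_pos by simp

lemma id_c [simp]: "is_poly_mor E (poly_id E c)"
  by (rule poly_id(1)) simp

lemma id_at [simp]: "over (ide (tgt c)) c x y \<Longrightarrow> dir_at E (poly_id E c) x y = y"
  by (rule poly_id(2)) simp_all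

lemma \<delta>_dir_pair:
  assumes "arr a" "tgt a = src c" "arr b" "src b = src a" "tgt b = src c" "t \<cdot> a = c \<cdot> b" "x = c \<cdot> a"
  shows "dir_at E \<delta> x (dir_pair E c c (on_pos \<delta> \<cdot> x) a b) = k \<cdot> pair t c a b"
  using assms by (subst \<delta>_dir) simp_all

section \<open>The counit laws\<close>

lemma left_counit_pos:
  assumes x: "arr x" "tgt x = tgt c" and z: "arr z" "src z = src x" "tgt z = one"
  shows "pos_at (y_poly E) c ((tri_pos E \<epsilon> (poly_id E c) \<cdot> on_pos \<delta>) \<cdot> x) z = t \<cdot> (i \<cdot> x)"
proof -
  note T = tri_pos[OF \<epsilon>(1) id_c \<epsilon>(2,3) poly_id_sel(1,2)]
  have eq: "on_pos \<epsilon> \<cdot> x = y_poly E \<cdot> z"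
    using x z by (intro terminal_unique) simp_all
  have o: "over (on_pos \<epsilon> \<cdot> tri_base E c c) (y_poly E) (on_pos \<delta> \<cdot> x) z"
    using x z eq by simp
  show ?thesis
    \<comment> \<open>The position \<open>(x, t)\<close> is evaluated at the direction that
      \<open>\<epsilon>\<close> assigns to \<open>x\<close>, namely \<open>i(x)\<close>.\<close>
    using T(5)[OF o] T(1-3) x z eq by (simp add: \<epsilon>_dir)
qed

text \<open>Pulling a direction back along the tensor of \<open>\<epsilon>\<close> with the identity
  replaces its component in the unit by \<open>i(x)\<close> and keeps the other one;
  \<open>\<delta>\<close> then composes the two by \<open>k\<close>.\<close>

lemma left_counit_dir:
  assumes o: "over (tri_pos E \<epsilon> (poly_id E c) \<cdot> on_pos \<delta>) (y_poly E \<triangleleft> c) x d"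
  shows "dir_at E (poly_comp E (\<epsilon> \<triangleleft>m poly_id E c) \<delta>) x d
    = k \<cdot> pair t c (i \<cdot> x) (dir_snd E (y_poly E) c d)"
proof -
  let ?y = "y_poly E"
  note T [simp] = tri_pos(1-3)[OF \<epsilon>(1) id_c \<epsilon>(2,3) poly_id_sel(1,2)]
  note M = tri_mor[OF \<epsilon>(1) id_c \<epsilon>(2,3) poly_id_sel(1,2)]
  have d [simp]: "arr x" "tgt x = tgt c" "arr d" "tgt d = pb E (tri_ev E ?y c) c" "src x = src d"
    and xd: "(?y \<triangleleft> c) \<cdot> d = (tri_pos E \<epsilon> (poly_id E c) \<cdot> on_pos \<delta>) \<cdot> x"
    using o by auto
  note D = dir_over[OF y_poly_simps(1) exponentiable_arr[OF c] d(3,4) xd]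
  have w: "t \<cdot> (i \<cdot> x) = c \<cdot> dir_snd E ?y c d"
    using D(5) left_counit_pos[of x "dir_fst E ?y c d"] by simp
  have y: "on_pos \<epsilon> \<cdot> x = ?y \<cdot> dir_fst E ?y c d"
    by (intro terminal_unique) simp_all
  have "dir_at E (\<epsilon> \<triangleleft>m poly_id E c) (on_pos \<delta> \<cdot> x) d
      = dir_pair E c c (on_pos \<delta> \<cdot> x) (i \<cdot> x) (dir_snd E ?y c d)"
    using M(2)[of "on_pos \<delta> \<cdot> x" d] o xd w y by (simp add: Let_def \<epsilon>_dir)
  moreover have "dir_at E (poly_comp E (\<epsilon> \<triangleleft>m poly_id E c) \<delta>) x d
      = dir_at E \<delta> x (dir_at E (\<epsilon> \<triangleleft>m poly_id E c) (on_pos \<delta> \<cdot> x) d)"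
    by (rule poly_comp(2)) (use M(1) o in simp_all)
  ultimately show ?thesis
    using w by (simp add: \<delta>_dir_pair)
qed

lemma left_counit_iff:
  "poly_comp E (\<epsilon> \<triangleleft>m poly_id E c) \<delta> = left_unitor E c \<longleftrightarrow>
    t \<cdot> i = ide (tgt c) \<and> k \<cdot> pair t c (i \<cdot> c) (ide (src c)) = ide (src c)"
proof -
  let ?y = "y_poly E" and ?L = "poly_comp E (\<epsilon> \<triangleleft>m poly_id E c) \<delta>"
  note T [simp] = tri_pos(1-3)[OF \<epsilon>(1) id_c \<epsilon>(2,3) poly_id_sel(1,2)]
  have L: "is_poly_mor E ?L"
    using tri_mor(1)[OF \<epsilon>(1) id_c \<epsilon>(2,3) poly_id_sel(1,2)] by (intro poly_comp(1)) simp_all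
  define u where "u = on_pos (left_unitor E c)"
  note U = left_unitor[OF c, folded u_def]
  note [simp] = U(2-4)
  have ud: "c \<cdot> dir_snd E ?y c d = x" if o: "over u (?y \<triangleleft> c) x d" for x d
  proof -
    have d: "arr d" "tgt d = pb E (tri_ev E ?y c) c" "(?y \<triangleleft> c) \<cdot> d = u \<cdot> x" "src x = src d" "arr x" "tgt x = tgt c"
      using o by auto
    have "over (bang E (tgt c)) ?y x (dir_fst E ?y c d)"
      using d by (auto intro!: terminal_unique)
    from U(5)[OF this] show ?thesis
      using dir_over(5)[OF _ _ d(1-3)] by simp
  qed
  show ?thesis
  proof
    assume eq: "?L = left_unitor E c"
    then have pos: "tri_pos E \<epsilon> (poly_id E c) \<cdot> on_pos \<delta> = u"
      unfolding u_def by (metis poly_comp_sel(3) tri_mor_sel(3))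
    have "over (bang E (tgt c)) ?y (ide (tgt c)) (bang E (tgt c))"
      by (auto intro!: terminal_unique)
    from U(5)[OF this] have ti: "t \<cdot> i = ide (tgt c)"
      using left_counit_pos[of "ide (tgt c)" "bang E (tgt c)"] by (simp add: pos)
    \<comment> \<open>The generic direction: the position is \<open>c\<close> itself, and the
      component in \<open>c\<close> is the identity of its source.\<close>
    define d where "d = dir_pair E ?y c (u \<cdot> c) (bang E (src c)) (ide (src c))"
    have b: "tri_base E ?y c \<cdot> (u \<cdot> c) = ?y \<cdot> bang E (src c)"
      by (intro terminal_unique) simp_all
    have "over (bang E (tgt c)) ?y c (bang E (src c))"
      by (auto intro!: terminal_unique)
    from U(5)[OF this] have d: "over u (?y \<triangleleft> c) c d" "dir_snd E ?y c d = ide (src c)"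
      using b by (simp_all add: d_def)
    have "k \<cdot> pair t c (i \<cdot> c) (ide (src c)) = dir_at E ?L c d"
      using left_counit_dir[of c d] d by (simp add: pos)
    also have "\<dots> = ide (src c)"
      using U(6)[OF d(1)] d(2) eq by simp
    finally show "t \<cdot> i = ide (tgt c) \<and> k \<cdot> pair t c (i \<cdot> c) (ide (src c)) = ide (src c)"
      using ti by simp
  next
    assume A: "t \<cdot> i = ide (tgt c) \<and> k \<cdot> pair t c (i \<cdot> c) (ide (src c)) = ide (src c)"
    then have ti: "t \<cdot> i = ide (tgt c)" and unit: "k \<cdot> pair t c (i \<cdot> c) (ide (src c)) = ide (src c)"
      by auto
    note [simp] = reassoc[OF ti]
    have pos: "tri_pos E \<epsilon> (poly_id E c) \<cdot> on_pos \<delta> = u"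
    proof (rule position_eqI[of ?y c])
      show "tri_base E ?y c \<cdot> (tri_pos E \<epsilon> (poly_id E c) \<cdot> on_pos \<delta>) = tri_base E ?y c \<cdot> u"
        by (intro terminal_unique) simp_all
      fix g z assume o: "over (tri_base E ?y c \<cdot> u) ?y g z"
      then have "over (bang E (tgt c)) ?y g z"
        by (auto intro!: terminal_unique)
      from U(5)[OF this] show "pos_at ?y c ((tri_pos E \<epsilon> (poly_id E c) \<cdot> on_pos \<delta>) \<cdot> g) z = pos_at ?y c (u \<cdot> g) z"
        using left_counit_pos[of g z] o by simp
    qed simp_all
    show "?L = left_unitor E c"
    proof (rule poly_mor_eqI[OF L U(1)])
      fix x d assume "over (on_pos (left_unitor E c)) (p_tgt (left_unitor E c)) x d"
      then have o: "over u (?y \<triangleleft> c) x d"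
        by (simp only: u_def left_unitor_sel)
      define w where "w = dir_snd E ?y c d"
      have w: "arr w" "tgt w = src c" "c \<cdot> w = x"
        using o ud[OF o] by (auto simp: w_def)
      have "dir_at E ?L x d = k \<cdot> pair t c (i \<cdot> x) w"
        using left_counit_dir[of x d] o by (simp add: pos w_def)
      \<comment> \<open>Conversely, an arbitrary direction \<open>w\<close> is the generic one
        restricted along \<open>w\<close>, since \<open>c \<cdot> w = x\<close>.\<close>
      also have "\<dots> = (k \<cdot> pair t c (i \<cdot> c) (ide (src c))) \<cdot> w"
        using w by simp
      also have "\<dots> = dir_at E (left_unitor E c) x d"
        using U(6)[OF o] unit w by (simp add: w_def)
      finally show "dir_at E ?L x d = dir_at E (left_unitor E c) x d" .
    qed (simp_all add: pos u_def)
  qed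
qed

text \<open>Now \<open>\<epsilon>\<close> acts at the position \<open>t(v)\<close> reached by the
  first direction \<open>v\<close>, so the identity that it inserts is
  \<open>i(t(v))\<close>.\<close>

lemma right_counit_dir:
  assumes o: "over (tri_pos E (poly_id E c) \<epsilon> \<cdot> on_pos \<delta>) (c \<triangleleft> y_poly E) x d"
  shows "dir_at E (poly_comp E (poly_id E c \<triangleleft>m \<epsilon>) \<delta>) x d
    = k \<cdot> pair t c (dir_fst E c (y_poly E) d) (i \<cdot> (t \<cdot> dir_fst E c (y_poly E) d))"
    "c \<cdot> dir_fst E c (y_poly E) d = x"
proof -
  let ?y = "y_poly E"
  note T [simp] = tri_pos(1-3)[OF id_c \<epsilon>(1) poly_id_sel(1,2) \<epsilon>(2,3)]
  note T4 = tri_pos(4)[OF id_c \<epsilon>(1) poly_id_sel(1,2) \<epsilon>(2,3)]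
  note M = tri_mor[OF id_c \<epsilon>(1) poly_id_sel(1,2) \<epsilon>(2,3)]
  have d [simp]: "arr x" "tgt x = tgt c" "arr d" "tgt d = pb E (tri_ev E c ?y) ?y" "src x = src d"
    and xd: "(c \<triangleleft> ?y) \<cdot> d = (tri_pos E (poly_id E c) \<epsilon> \<cdot> on_pos \<delta>) \<cdot> x"
    using o by auto
  note D = dir_over[OF c exponentiable_arr[OF y_poly_simps(1)] d(3,4) xd]
  define v where "v = dir_fst E c ?y d"
  have v [simp]: "arr v" "src v = src d" "tgt v = src c"
    by (simp_all add: v_def)
  have cv: "c \<cdot> v = x"
    using D(4) reassoc[OF T4, of "on_pos \<delta> \<cdot> x"] by (simp add: v_def)
  then show "c \<cdot> dir_fst E c ?y d = x"
    by (simp add: v_def)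
  have y: "on_pos \<epsilon> \<cdot> (t \<cdot> v) = ?y \<cdot> dir_snd E c ?y d"
    by (intro terminal_unique) simp_all
  have "dir_at E (poly_id E c \<triangleleft>m \<epsilon>) (on_pos \<delta> \<cdot> x) d
      = dir_pair E c c (on_pos \<delta> \<cdot> x) v (i \<cdot> (t \<cdot> v))"
    using M(2)[of "on_pos \<delta> \<cdot> x" d] xd y by (simp add: Let_def \<epsilon>_dir v_def[symmetric] flip: cv)
  moreover have "dir_at E (poly_comp E (poly_id E c \<triangleleft>m \<epsilon>) \<delta>) x d
      = dir_at E \<delta> x (dir_at E (poly_id E c \<triangleleft>m \<epsilon>) (on_pos \<delta> \<cdot> x) d)"
    by (rule poly_comp(2)) (use M(1) o in simp_all)
  ultimately show "dir_at E (poly_comp E (poly_id E c \<triangleleft>m \<epsilon>) \<delta>) x d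
    = k \<cdot> pair t c (dir_fst E c (y_poly E) d) (i \<cdot> (t \<cdot> dir_fst E c (y_poly E) d))"
    using cv by (simp add: \<delta>_dir_pair v_def[symmetric])
qed

text \<open>The position parts agree outright: both have the identity as base, by
  \<open>base\<close>, and their values lie in the terminal object. What remains is the equation of
  directions, tested on the generic direction.\<close>

lemma right_counit_iff:
  "poly_comp E (poly_id E c \<triangleleft>m \<epsilon>) \<delta> = right_unitor E c \<longleftrightarrow>
    k \<cdot> pair t c (ide (src c)) (i \<cdot> t) = ide (src c)"
proof -
  let ?y = "y_poly E" and ?R = "poly_comp E (poly_id E c \<triangleleft>m \<epsilon>) \<delta>"
  note T [simp] = tri_pos(1-3)[OF id_c \<epsilon>(1) poly_id_sel(1,2) \<epsilon>(2,3)]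
  note T4 = tri_pos(4)[OF id_c \<epsilon>(1) poly_id_sel(1,2) \<epsilon>(2,3)]
  have R: "is_poly_mor E ?R"
    using tri_mor(1)[OF id_c \<epsilon>(1) poly_id_sel(1,2) \<epsilon>(2,3)] by (intro poly_comp(1)) simp_all
  define u where "u = on_pos (right_unitor E c)"
  note U = right_unitor[OF c, folded u_def]
  note [simp] = U(2-5)
  have pos: "tri_pos E (poly_id E c) \<epsilon> \<cdot> on_pos \<delta> = u"
  proof (rule position_eqI[of c ?y])
    show "tri_base E c ?y \<cdot> (tri_pos E (poly_id E c) \<epsilon> \<cdot> on_pos \<delta>) = tri_base E c ?y \<cdot> u"
      using reassoc[OF T4, of "on_pos \<delta>"] by simp
    fix g z assume o: "over (tri_base E c ?y \<cdot> u) c g z"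
    then show "pos_at c ?y ((tri_pos E (poly_id E c) \<epsilon> \<cdot> on_pos \<delta>) \<cdot> g) z = pos_at c ?y (u \<cdot> g) z"
      using reassoc[OF T4, of "on_pos \<delta> \<cdot> g"] reassoc[OF U(5), of g]
      by (auto intro!: terminal_unique)
  qed simp_all
  show ?thesis
  proof
    assume eq: "?R = right_unitor E c"
    define d where "d = dir_pair E c ?y (u \<cdot> c) (ide (src c)) (bang E (src c))"
    have b: "tri_base E c ?y \<cdot> (u \<cdot> c) = c"
      using reassoc[OF U(5), of c] by simp
    then have "pos_at c ?y (u \<cdot> c) (ide (src c)) = ?y \<cdot> bang E (src c)"
      by (intro terminal_unique) simp_all
    then have d: "over u (c \<triangleleft> ?y) c d" "dir_fst E c ?y d = ide (src c)"
      using b by (simp_all add: d_def)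
    have "k \<cdot> pair t c (ide (src c)) (i \<cdot> t) = dir_at E ?R c d"
      using right_counit_dir[of c d] d by (simp add: pos)
    then show "k \<cdot> pair t c (ide (src c)) (i \<cdot> t) = ide (src c)"
      using U(6)[OF d(1)] d(2) eq by simp
  next
    assume unit: "k \<cdot> pair t c (ide (src c)) (i \<cdot> t) = ide (src c)"
    show "?R = right_unitor E c"
    proof (rule poly_mor_eqI[OF R U(1)])
      fix x d assume "over (on_pos (right_unitor E c)) (p_tgt (right_unitor E c)) x d"
      then have o: "over u (c \<triangleleft> ?y) x d"
        by (simp only: u_def right_unitor_sel)
      define v where "v = dir_fst E c ?y d"
      have v: "arr v" "tgt v = src c"
        using o by (auto simp: v_def)
      have "dir_at E ?R x d = k \<cdot> pair t c v (i \<cdot> (t \<cdot> v))"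
        using right_counit_dir(1)[of x d] o by (simp add: pos v_def)
      also have "\<dots> = (k \<cdot> pair t c (ide (src c)) (i \<cdot> t)) \<cdot> v"
        using v by simp
      also have "\<dots> = dir_at E (right_unitor E c) x d"
        using U(6)[OF o] unit v by (simp add: v_def)
      finally show "dir_at E ?R x d = dir_at E (right_unitor E c) x d" .
    qed (simp_all add: pos u_def)
  qed
qed


section \<open>Coassociativity\<close>

abbreviation "lhs \<equiv> poly_comp E (associator E c c c) (poly_comp E (\<delta> \<triangleleft>m poly_id E c) \<delta>)"
abbreviation "rhs \<equiv> poly_comp E (poly_id E c \<triangleleft>m \<delta>) \<delta>"
abbreviation "cc \<equiv> c \<triangleleft> c"

lemma \<delta>id [simp]:
  "is_poly_mor E (\<delta> \<triangleleft>m poly_id E c)" "is_poly_mor E (poly_id E c \<triangleleft>m \<delta>)"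
  "arr (tri_pos E \<delta> (poly_id E c))" "src (tri_pos E \<delta> (poly_id E c)) = src (tri_base E c c)"
  "tgt (tri_pos E \<delta> (poly_id E c)) = src (tri_base E cc c)"
  "arr (tri_pos E (poly_id E c) \<delta>)" "src (tri_pos E (poly_id E c) \<delta>) = src (tri_base E c c)"
  "tgt (tri_pos E (poly_id E c) \<delta>) = src (tri_base E c cc)"
  using tri_mor(1)[OF \<delta>(1) id_c \<delta>(2,3) poly_id_sel(1,2)] tri_mor(1)[OF id_c \<delta>(1) poly_id_sel(1,2) \<delta>(2,3)]
    tri_pos(1-3)[OF \<delta>(1) id_c \<delta>(2,3) poly_id_sel(1,2)] tri_pos(1-3)[OF id_c \<delta>(1) poly_id_sel(1,2) \<delta>(2,3)]
  by simp_all

lemma lhs_rhs_mor: "is_poly_mor E lhs" "is_poly_mor E rhs"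
  using associator(1)[OF c c c] by (auto intro!: poly_comp(1))

text \<open>In the bracketing \<open>(c \<triangleleft> c) \<triangleleft> c\<close> this is the
  position with base \<open>\<delta>\<close> and value \<open>t(k(a, b))\<close> at the direction
  \<open>(a, b)\<close>.\<close>

definition W where "W = tri_pos E \<delta> (poly_id E c) \<cdot> on_pos \<delta>"

lemma W_simps [simp]:
  "arr W" "src W = tgt c" "tgt W = src (tri_base E cc c)" "tri_base E cc c \<cdot> W = on_pos \<delta>"
  using reassoc[OF tri_pos(4)[OF \<delta>(1) id_c \<delta>(2,3) poly_id_sel(1,2)], of "on_pos \<delta>"]
  by (simp_all add: W_def)

lemmas W' [simp] = reassoc[OF W_simps(4)]

lemma W_at:
  assumes "arr a" "tgt a = src c" "arr b" "src b = src a" "tgt b = src c" "t \<cdot> a = c \<cdot> b" "x = c \<cdot> a"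
  shows "pos_at cc c (W \<cdot> x) (dir_pair E c c (on_pos \<delta> \<cdot> x) a b) = t \<cdot> (k \<cdot> pair t c a b)"
proof -
  have "over (on_pos \<delta> \<cdot> tri_base E c c) cc (on_pos \<delta> \<cdot> x) (dir_pair E c c (on_pos \<delta> \<cdot> x) a b)"
    using assms by simp
  from tri_pos(5)[OF \<delta>(1) id_c \<delta>(2,3) poly_id_sel(1,2) this] show ?thesis
    using assms by (simp add: W_def \<delta>_dir_pair)
qed

lemma assoc_pos_simps [simp]:
  "arr (assoc_pos E c c c)" "src (assoc_pos E c c c) = src (tri_base E cc c)"
  "tgt (assoc_pos E c c c) = src (tri_base E c cc)"
  using assoc_pos(1-3)[OF c c c] by simp_all

lemma lhs_pos: "on_pos lhs = assoc_pos E c c c \<cdot> W"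
  by (simp add: W_def)

lemma lhs_base: "tri_base E c cc \<cdot> (assoc_pos E c c c \<cdot> W) = ide (tgt c)"
  using reassoc[OF assoc_pos(4)[OF c c c], of W] by simp

text \<open>After rebracketing, the value at \<open>a\<close> is itself a position of
  \<open>c \<triangleleft> c\<close>. Its base \<open>t(a)\<close> and its values at
  \<open>b\<close> determine it by \<open>position_eqI\<close>.\<close>

lemma lhs_at:
  assumes a: "arr a" "tgt a = src c" "x = c \<cdot> a"
  defines "v \<equiv> pos_at c cc (assoc_pos E c c c \<cdot> (W \<cdot> x)) a"
  shows "arr v" "src v = src a" "tgt v = src (tri_base E c c)" "tri_base E c c \<cdot> v = t \<cdot> a"
    "\<lbrakk>arr b; src b = src a; tgt b = src c; t \<cdot> a = c \<cdot> b\<rbrakk> \<Longrightarrow> pos_at c c v b = t \<cdot> (k \<cdot> pair t c a b)"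
proof -
  have x: "arr x" "src x = src a" "tgt x = tgt c"
    using a by simp_all
  have o: "over (tri_base E c c \<cdot> tri_base E cc c) c (W \<cdot> x) a"
    using a by simp
  have bx: "tri_base E c cc \<cdot> (assoc_pos E c c c \<cdot> (W \<cdot> x)) = x"
    using reassoc[OF lhs_base, of x] x by simp
  show "arr v" "src v = src a" "tgt v = src (tri_base E c c)"
    unfolding v_def using a bx by simp_all
  show "tri_base E c c \<cdot> v = t \<cdot> a"
    unfolding v_def using assoc_pos(5)[OF c c c o] a by simp
  assume b: "arr b" "src b = src a" "tgt b = src c" "t \<cdot> a = c \<cdot> b"
  have "over (pos_at c c (tri_base E cc c \<cdot> (W \<cdot> x)) a) c (ide (src a)) b"
    using a b by simp
  from assoc_pos(6)[OF c c c o this] show "pos_at c c v b = t \<cdot> (k \<cdot> pair t c a b)"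
    unfolding v_def using a b by (simp add: W_at)
qed

definition V where "V = tri_pos E (poly_id E c) \<delta> \<cdot> on_pos \<delta>"

lemma V_simps [simp]:
  "arr V" "src V = tgt c" "tgt V = src (tri_base E c cc)" "tri_base E c cc \<cdot> V = ide (tgt c)"
  using reassoc[OF tri_pos(4)[OF id_c \<delta>(1) poly_id_sel(1,2) \<delta>(2,3)], of "on_pos \<delta>"]
  by (simp_all add: V_def)

lemmas V' [simp] = reassoc[OF V_simps(4)]

lemma rhs_pos: "on_pos rhs = V"
  by (simp add: V_def)

text \<open>On this side the inner position at \<open>a\<close> is \<open>\<delta>\<close> at
  \<open>t(a)\<close>, whose value at \<open>b\<close> is \<open>t(b)\<close>. Comparison with
  \<open>lhs_at\<close> yields the codomain law of \<open>k\<close>.\<close>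

lemma V_at:
  assumes a: "arr a" "tgt a = src c" "x = c \<cdot> a"
  shows "pos_at c cc (V \<cdot> x) a = on_pos \<delta> \<cdot> (t \<cdot> a)"
proof -
  have "over (on_pos (poly_id E c) \<cdot> tri_base E c c) c (on_pos \<delta> \<cdot> x) a"
    using a by simp
  from tri_pos(5)[OF id_c \<delta>(1) poly_id_sel(1,2) \<delta>(2,3) this] show ?thesis
    using a by (simp add: V_def)
qed

text \<open>The direction supplies \<open>t(a) = c(b)\<close> and, because of the bracketing to the
  left, \<open>t(k(a, b)) = c(w)\<close>. These make both uses of \<open>\<delta>\<close>
  well-typed.\<close>

lemma lhs_dir:
  assumes o: "over (assoc_pos E c c c \<cdot> W) (c \<triangleleft> cc) x d"
  defines "a \<equiv> dir_fst E c cc d" and "b \<equiv> dir_fst E c c (dir_snd E c cc d)"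
    and "w \<equiv> dir_snd E c c (dir_snd E c cc d)"
  shows "dir_at E lhs x d = k \<cdot> pair t c (k \<cdot> pair t c a b) w"
proof -
  note M = tri_mor[OF \<delta>(1) id_c \<delta>(2,3) poly_id_sel(1,2)]
  define v where "v = dir_snd E c cc d"
  have d [simp]: "arr x" "tgt x = tgt c" "arr d" "tgt d = pb E (tri_ev E c cc) cc" "src x = src d"
    and xd: "(c \<triangleleft> cc) \<cdot> d = assoc_pos E c c c \<cdot> (W \<cdot> x)"
    using o by auto
  have av [simp]: "arr a" "src a = src d" "tgt a = src c" "arr v" "src v = src d" "tgt v = pb E (tri_ev E c c) c"
    using dir_simps(1-6)[OF c tri_simps(1)[OF c exponentiable_arr[OF c]] d(3,4)]
    by (simp_all add: a_def v_def)
  have bw [simp]: "arr b" "src b = src d" "tgt b = src c" "arr w" "src w = src d" "tgt w = src c"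
    unfolding b_def w_def v_def[symmetric] by simp_all
  note D = dir_over[OF c tri_simps(1)[OF c exponentiable_arr[OF c]] d(3,4) xd, folded a_def v_def]
  have xa: "x = c \<cdot> a"
    using D(4) reassoc[OF lhs_base, of x] by simp
  note D' = dir_over[OF c exponentiable_arr[OF c] av(4,6) D(5)[symmetric], unfolded v_def, folded b_def w_def]
  have ab: "t \<cdot> a = c \<cdot> b"
    using D'(4) lhs_at(4)[of a x] xa by simp
  have kw: "t \<cdot> (k \<cdot> pair t c a b) = c \<cdot> w"
    using D'(5) lhs_at(5)[of a x b] xa ab by simp
  define e where "e = dir_pair E c c (on_pos \<delta> \<cdot> x) a b"
  have e [simp]: "arr e" "src e = src d" "tgt e = src cc" "cc \<cdot> e = on_pos \<delta> \<cdot> x"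
    "pos_at cc c (W \<cdot> x) e = t \<cdot> (k \<cdot> pair t c a b)" "dir_at E \<delta> x e = k \<cdot> pair t c a b"
    using xa ab by (simp_all add: e_def W_at \<delta>_dir_pair)
  \<comment> \<open>The triple rebracketed as \<open>((a, b), w)\<close>, which is what the
    associator makes of \<open>d\<close>.\<close>
  define f where "f = dir_pair E cc c (W \<cdot> x) e w"
  have e_over: "over (tri_base E cc c) cc (W \<cdot> x) e"
    by simp
  have e_w: "pos_at cc c (W \<cdot> x) e = c \<cdot> w"
    using kw by simp
  have ew: "src w = src e"
    by simp
  have f: "arr f" "src f = src d" "tgt f = pb E (tri_ev E cc c) c" "(cc \<triangleleft> c) \<cdot> f = W \<cdot> x"
      "dir_fst E cc c f = e" "dir_snd E cc c f = w"
    unfolding f_def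
    using dir_pair_simps(1-6)[OF exponentiable_tri[OF c c] exponentiable_arr[OF c] e_over bw(4) ew bw(6) e_w]
    by simp_all
  have "dir_at E lhs x d = dir_at E (poly_comp E (\<delta> \<triangleleft>m poly_id E c) \<delta>) x (dir_at E (associator E c c c) (W \<cdot> x) d)"
    using poly_comp(2)[of "poly_comp E (\<delta> \<triangleleft>m poly_id E c) \<delta>" "associator E c c c" x d]
      poly_comp(1)[OF \<delta>(1) \<delta>id(1)] associator(1)[OF c c c] o by (simp add: W_def)
  also have "dir_at E (associator E c c c) (W \<cdot> x) d = f"
    using associator(2)[OF c c c, of "W \<cdot> x" d] xd
    by (simp add: Let_def f_def e_def a_def b_def w_def)
  also have "dir_at E (poly_comp E (\<delta> \<triangleleft>m poly_id E c) \<delta>) x f = dir_at E \<delta> x (dir_at E (\<delta> \<triangleleft>m poly_id E c) (on_pos \<delta> \<cdot> x) f)"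
    using poly_comp(2)[OF \<delta>(1) \<delta>id(1), of x f] f(1-4) by (simp add: W_def)
  also have "dir_at E (\<delta> \<triangleleft>m poly_id E c) (on_pos \<delta> \<cdot> x) f = dir_pair E c c (on_pos \<delta> \<cdot> x) (k \<cdot> pair t c a b) w"
    using M(2)[of "on_pos \<delta> \<cdot> x" f] f xa e(6)[unfolded xa] ab kw by (simp add: Let_def W_def)
  also have "dir_at E \<delta> x \<dots> = k \<cdot> pair t c (k \<cdot> pair t c a b) w"
    using xa ab kw by (simp add: \<delta>_dir_pair)
  finally show ?thesis .
qed

text \<open>Here the second condition reads \<open>t(b) = c(w)\<close>. The additional conclusions
  record that \<open>(a, b, w)\<close> is a composable triple in the sense of
  \<open>coassoc_iff\<close>.\<close>

lemma rhs_dir: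
  assumes o: "over V (c \<triangleleft> cc) x d"
  defines "a \<equiv> dir_fst E c cc d" and "b \<equiv> dir_fst E c c (dir_snd E c cc d)"
    and "w \<equiv> dir_snd E c c (dir_snd E c cc d)"
  shows "dir_at E rhs x d = k \<cdot> pair t c a (k \<cdot> pair t c b w)"
    "arr a" "src a = src d" "tgt a = src c" "arr b" "src b = src d" "tgt b = src c"
    "arr w" "src w = src d" "tgt w = src c" "t \<cdot> a = c \<cdot> b" "t \<cdot> b = c \<cdot> w"
proof -
  note M = tri_mor[OF id_c \<delta>(1) poly_id_sel(1,2) \<delta>(2,3)]
  define v where "v = dir_snd E c cc d"
  have d [simp]: "arr x" "tgt x = tgt c" "arr d" "tgt d = pb E (tri_ev E c cc) cc" "src x = src d"
    and xd: "(c \<triangleleft> cc) \<cdot> d = V \<cdot> x"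
    using o by auto
  have av [simp]: "arr a" "src a = src d" "tgt a = src c" "arr v" "src v = src d" "tgt v = pb E (tri_ev E c c) c"
    using dir_simps(1-6)[OF c tri_simps(1)[OF c exponentiable_arr[OF c]] d(3,4)]
    by (simp_all add: a_def v_def)
  have bw [simp]: "arr b" "src b = src d" "tgt b = src c" "arr w" "src w = src d" "tgt w = src c"
    unfolding b_def w_def v_def[symmetric] by simp_all
  show "arr a" "src a = src d" "tgt a = src c" "arr b" "src b = src d" "tgt b = src c"
    "arr w" "src w = src d" "tgt w = src c"
    by simp_all
  note D = dir_over[OF c tri_simps(1)[OF c exponentiable_arr[OF c]] d(3,4) xd, folded a_def v_def]
  have xa: "x = c \<cdot> a"
    using D(4) by simp
  have cv: "cc \<cdot> v = on_pos \<delta> \<cdot> (t \<cdot> a)"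
    using D(5) V_at[of a x] xa by simp
  note D' = dir_over[OF c exponentiable_arr[OF c] av(4,6) cv, unfolded v_def, folded b_def w_def]
  show ab: "t \<cdot> a = c \<cdot> b"
    using D'(4) by simp
  show bw': "t \<cdot> b = c \<cdot> w"
    using D'(5) ab by simp
  have "dir_at E rhs x d = dir_at E \<delta> x (dir_at E (poly_id E c \<triangleleft>m \<delta>) (on_pos \<delta> \<cdot> x) d)"
    by (rule poly_comp(2)) (use xd in \<open>simp_all add: V_def\<close>)
  also have "dir_at E (poly_id E c \<triangleleft>m \<delta>) (on_pos \<delta> \<cdot> x) d = dir_pair E c c (on_pos \<delta> \<cdot> x) a (dir_at E \<delta> (t \<cdot> a) v)"
    using M(2)[of "on_pos \<delta> \<cdot> x" d] xd xa by (simp add: Let_def V_def a_def[symmetric] v_def[symmetric])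
  also have "dir_at E \<delta> (t \<cdot> a) v = k \<cdot> pair t c b w"
    using \<delta>_dir[of "t \<cdot> a" v] cv by (simp add: b_def w_def v_def)
  also have "dir_at E \<delta> x (dir_pair E c c (on_pos \<delta> \<cdot> x) a (k \<cdot> pair t c b w)) = k \<cdot> pair t c a (k \<cdot> pair t c b w)"
    using xa ab bw' by (simp add: \<delta>_dir_pair)
  finally show "dir_at E rhs x d = k \<cdot> pair t c a (k \<cdot> pair t c b w)" .
qed

text \<open>Agreement of positions is the equation \<open>t(k(a, b)) = t(b)\<close>. It identifies
  the two notions of composable triple, so that the direction parts can be compared on the same
  triples, where they become associativity.\<close>

lemma coassoc_iff:
  "lhs = rhs \<longleftrightarrow> t \<cdot> k = t \<cdot> p2 t c \<and>
    (\<forall>a b w. arr a \<and> arr b \<and> arr w \<and> src a = src w \<and> src b = src w \<and> tgt a = src c \<and> tgt b = src c \<and>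
       tgt w = src c \<and> t \<cdot> a = c \<cdot> b \<and> t \<cdot> b = c \<cdot> w \<longrightarrow>
       k \<cdot> pair t c (k \<cdot> pair t c a b) w = k \<cdot> pair t c a (k \<cdot> pair t c b w))"
    (is "_ \<longleftrightarrow> _ \<and> ?assoc")
proof
  assume eq: "lhs = rhs"
  then have pos: "assoc_pos E c c c \<cdot> W = V"
    using lhs_pos rhs_pos by metis
  have tk: "t \<cdot> (k \<cdot> pair t c a b) = t \<cdot> b"
    if ab: "arr a" "arr b" "src a = src b" "tgt a = src c" "tgt b = src c" "t \<cdot> a = c \<cdot> b" for a b
  proof -
    have "assoc_pos E c c c \<cdot> (W \<cdot> (c \<cdot> a)) = V \<cdot> (c \<cdot> a)"
      using reassoc[OF pos, of "c \<cdot> a"] ab by simp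
    then have "t \<cdot> (k \<cdot> pair t c a b) = pos_at c c (pos_at c cc (V \<cdot> (c \<cdot> a)) a) b"
      using lhs_at(5)[of a "c \<cdot> a" b] ab by simp
    then show ?thesis
      using ab by (simp add: V_at)
  qed
  \<comment> \<open>The generic composable pair gives the equation of arrows.\<close>
  have "t \<cdot> k = t \<cdot> p2 t c"
    using tk[of "p1 t c" "p2 t c"] pb_commutes[of t c] by simp
  moreover have ?assoc
  proof (intro allI impI, elim conjE)
    fix a b w assume abw: "arr a" "arr b" "arr w" "src a = src w" "src b = src w" "tgt a = src c" "tgt b = src c"
       "tgt w = src c" "t \<cdot> a = c \<cdot> b" "t \<cdot> b = c \<cdot> w"
    \<comment> \<open>Each composable triple comes from a direction: \<open>v\<close> encodes
      \<open>(b, w)\<close> and \<open>d\<close> encodes \<open>(a, (b, w))\<close>.\<close>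
    define v where "v = dir_pair E c c (on_pos \<delta> \<cdot> (t \<cdot> a)) b w"
    have v [simp]: "arr v" "src v = src w" "tgt v = src cc" "cc \<cdot> v = on_pos \<delta> \<cdot> (t \<cdot> a)"
      "dir_fst E c c v = b" "dir_snd E c c v = w"
      using abw by (simp_all add: v_def)
    define d where "d = dir_pair E c cc (V \<cdot> (c \<cdot> a)) a v"
    have o: "over (tri_base E c cc) c (V \<cdot> (c \<cdot> a)) a"
      using abw by simp
    have va: "src v = src a" "pos_at c cc (V \<cdot> (c \<cdot> a)) a = cc \<cdot> v"
      using abw v(2,4) by (simp_all add: V_at)
    note d = dir_pair_simps(1-6)[OF c tri_simps(1)[OF c exponentiable_arr[OF c]] o v(1) va(1) v(3) va(2), folded d_def]
    have od: "over V (c \<triangleleft> cc) (c \<cdot> a) d"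
      using d abw by simp
    have "k \<cdot> pair t c (k \<cdot> pair t c a b) w = dir_at E lhs (c \<cdot> a) d"
      using lhs_dir[of "c \<cdot> a" d] od d(5,6) by (simp add: pos)
    also have "\<dots> = k \<cdot> pair t c a (k \<cdot> pair t c b w)"
      unfolding eq using rhs_dir(1)[OF od] d(5,6) by simp
    finally show "k \<cdot> pair t c (k \<cdot> pair t c a b) w = k \<cdot> pair t c a (k \<cdot> pair t c b w)" .
  qed
  ultimately show "t \<cdot> k = t \<cdot> p2 t c \<and> ?assoc" by blast
next
  assume R: "t \<cdot> k = t \<cdot> p2 t c \<and> ?assoc"
  then have tk: "t \<cdot> k = t \<cdot> p2 t c" and assoc: ?assoc by blast+
  note tk' = reassoc[OF tk]
  have pos: "assoc_pos E c c c \<cdot> W = V"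
  proof (rule position_eqI[of c cc])
    show "tri_base E c cc \<cdot> (assoc_pos E c c c \<cdot> W) = tri_base E c cc \<cdot> V"
      using lhs_base by simp
    fix x a assume "over (tri_base E c cc \<cdot> V) c x a"
    then have a: "arr a" "tgt a = src c" "x = c \<cdot> a" "arr x" "src x = src a" "tgt x = tgt c"
      by auto
    \<comment> \<open>The values at \<open>a\<close> are positions again, so extensionality is
      applied a second time, now testing at \<open>b\<close>.\<close>
    have "pos_at c cc (assoc_pos E c c c \<cdot> (W \<cdot> x)) a = on_pos \<delta> \<cdot> (t \<cdot> a)"
    proof (rule position_eqI[of c c])
      show "tri_base E c c \<cdot> pos_at c cc (assoc_pos E c c c \<cdot> (W \<cdot> x)) a = tri_base E c c \<cdot> (on_pos \<delta> \<cdot> (t \<cdot> a))"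
        using lhs_at(4)[OF a(1-3)] a by simp
      fix h b assume "over (tri_base E c c \<cdot> (on_pos \<delta> \<cdot> (t \<cdot> a))) c h b"
      then have hb: "arr h" "arr b" "src h = src b" "tgt h = src a" "tgt b = src c" "t \<cdot> (a \<cdot> h) = c \<cdot> b"
        using a by auto
      have bx: "tri_base E c cc \<cdot> (assoc_pos E c c c \<cdot> (W \<cdot> x)) = x"
        using reassoc[OF lhs_base, of x] a(4-6) by simp
      have "pos_at c cc (assoc_pos E c c c \<cdot> (W \<cdot> x)) a \<cdot> h = pos_at c cc (assoc_pos E c c c \<cdot> (W \<cdot> (x \<cdot> h))) (a \<cdot> h)"
        using a(1-2,4-6) hb bx by (simp add: a(3)[symmetric])
      moreover have "pos_at c c (pos_at c cc (assoc_pos E c c c \<cdot> (W \<cdot> (x \<cdot> h))) (a \<cdot> h)) b = t \<cdot> (k \<cdot> pair t c (a \<cdot> h) b)"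
        by (rule lhs_at(5)) (use a hb in simp_all)
      moreover have "\<dots> = t \<cdot> b"
        using tk'[of "pair t c (a \<cdot> h) b"] a hb by simp
      moreover have "pos_at c c ((on_pos \<delta> \<cdot> (t \<cdot> a)) \<cdot> h) b = t \<cdot> b"
        using a hb by simp
      ultimately show "pos_at c c (pos_at c cc (assoc_pos E c c c \<cdot> (W \<cdot> x)) a \<cdot> h) b
          = pos_at c c ((on_pos \<delta> \<cdot> (t \<cdot> a)) \<cdot> h) b"
        by simp
    qed (use lhs_at(1-3)[OF a(1-3)] a in simp_all)
    then show "pos_at c cc ((assoc_pos E c c c \<cdot> W) \<cdot> x) a = pos_at c cc (V \<cdot> x) a"
      using a by (simp add: V_at)
  qed simp_all
  show "lhs = rhs"
  proof (rule poly_mor_eqI[OF lhs_rhs_mor])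
    show "on_pos lhs = on_pos rhs"
      unfolding lhs_pos rhs_pos by (rule pos)
    fix x d assume "over (on_pos rhs) (p_tgt rhs) x d"
    then have o: "over V (c \<triangleleft> cc) x d"
      unfolding rhs_pos by simp
    note r = rhs_dir[OF o]
    show "dir_at E lhs x d = dir_at E rhs x d"
      unfolding r(1) using lhs_dir[of x d, unfolded pos, OF o] assoc r(2-) by simp
  qed simp_all
qed


section \<open>Associativity on the object of composable triples\<close>

lemma internal_category_iff:
  "is_internal_category E (tgt c) (src c) c t i k \<longleftrightarrow>
    (t \<cdot> i = ide (tgt c) \<and> k \<cdot> pair t c (i \<cdot> c) (ide (src c)) = ide (src c)) \<and>
    k \<cdot> pair t c (ide (src c)) (i \<cdot> t) = ide (src c) \<and>
    t \<cdot> k = t \<cdot> p2 t c \<and>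
    (\<forall>a b w. arr a \<and> arr b \<and> arr w \<and> src a = src w \<and> src b = src w \<and> tgt a = src c \<and> tgt b = src c \<and>
       tgt w = src c \<and> t \<cdot> a = c \<cdot> b \<and> t \<cdot> b = c \<cdot> w \<longrightarrow>
       k \<cdot> pair t c (k \<cdot> pair t c a b) w = k \<cdot> pair t c a (k \<cdot> pair t c b w))"
    (is "?I \<longleftrightarrow> ?L \<and> ?R \<and> ?T \<and> ?assoc")
proof -
  define ab where "ab = p1 (t \<cdot> p2 t c) c"
  define w where "w = p2 (t \<cdot> p2 t c) c"
  define a where "a = p1 t c \<cdot> ab"
  define b where "b = p2 t c \<cdot> ab"
  have [simp]: "arr ab" "arr w" "arr a" "arr b" "src ab = src w" "src a = src w" "src b = src w"
    "tgt ab = pb E t c" "tgt w = src c" "tgt a = src c" "tgt b = src c"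
    by (simp_all add: ab_def w_def a_def b_def)
  have tab [simp]: "t \<cdot> a = c \<cdot> b"
    using pb_commutes'[of t c ab] by (simp add: a_def b_def)
  have tbw [simp]: "t \<cdot> b = c \<cdot> w"
    using pb_commutes[of "t \<cdot> p2 t c" c] by (simp add: b_def w_def ab_def)
  have ab: "pair t c a b = ab"
    using pair_eta[of t c ab] by (simp add: a_def b_def)
  \<comment> \<open>Associativity of an internal category is stated for the generic triple; others
    are restrictions of it. The law \<open>?T\<close> ensures that \<open>k(a, b)\<close> is
    composable with \<open>w\<close>.\<close>
  have "?assoc \<longleftrightarrow> k \<cdot> pair t c (k \<cdot> ab) w = k \<cdot> pair t c a (k \<cdot> pair t c b w)" if T: ?T
  proof
    note tk [simp] = T reassoc[OF T]
    show "k \<cdot> pair t c (k \<cdot> ab) w = k \<cdot> pair t c a (k \<cdot> pair t c b w)" if A: ?assoc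
      using A[rule_format, of a b w] by (simp add: ab)
    assume gen: "k \<cdot> pair t c (k \<cdot> ab) w = k \<cdot> pair t c a (k \<cdot> pair t c b w)"
    show ?assoc
    proof (intro allI impI, elim conjE)
      fix a' b' w' assume prem [simp]: "arr a'" "arr b'" "arr w'" "src a' = src w'" "src b' = src w'" "tgt a' = src c" "tgt b' = src c"
         "tgt w' = src c" "t \<cdot> a' = c \<cdot> b'" "t \<cdot> b' = c \<cdot> w'"
      \<comment> \<open>The arrow classifying the given triple.\<close>
      define u where "u = pair (t \<cdot> p2 t c) c (pair t c a' b') w'"
      have u [simp]: "arr u" "src u = src w'" "tgt u = src w" "ab \<cdot> u = pair t c a' b'" "w \<cdot> u = w'"
        by (simp_all add: u_def ab_def w_def)
      have [simp]: "a \<cdot> u = a'" "b \<cdot> u = b'"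
        by (simp_all add: a_def b_def)
      \<comment> \<open>The side condition that allows the outer pair to be restricted along
        \<open>u\<close>.\<close>
      have o: "t \<cdot> (k \<cdot> ab) = c \<cdot> w"
        by (simp add: b_def[symmetric])
      have "k \<cdot> pair t c (k \<cdot> pair t c a' b') w' = (k \<cdot> pair t c (k \<cdot> ab) w) \<cdot> u"
        using o by (simp del: tk)
      also have "\<dots> = k \<cdot> pair t c a' (k \<cdot> pair t c b' w')"
        unfolding gen by simp
      finally show "k \<cdot> pair t c (k \<cdot> pair t c a' b') w' = k \<cdot> pair t c a' (k \<cdot> pair t c b' w')" .
    qed
  qed
  moreover have "?I \<longleftrightarrow> ?L \<and> ?R \<and> ?T \<and> k \<cdot> pair t c (k \<cdot> ab) w = k \<cdot> pair t c a (k \<cdot> pair t c b w)"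
    unfolding is_internal_category_def Let_def ab_def[symmetric] w_def[symmetric] a_def[symmetric] b_def[symmetric]
    by (auto simp: Hom_def)
  ultimately show ?thesis by blast
qed

lemma comonoid_iff:
  "(\<epsilon>, \<delta>) \<in> comonoid_structures E c \<longleftrightarrow> (t, i, k) \<in> internal_categories_with_source E c"
proof -
  have "(\<epsilon>, \<delta>) \<in> comonoid_structures E c \<longleftrightarrow>
      poly_comp E (\<epsilon> \<triangleleft>m poly_id E c) \<delta> = left_unitor E c \<and>
      poly_comp E (poly_id E c \<triangleleft>m \<epsilon>) \<delta> = right_unitor E c \<and> lhs = rhs"
    by (simp add: comonoid_structures_def Poly_def Hom_def)
  also have "\<dots> \<longleftrightarrow> is_internal_category E (tgt c) (src c) c t i k"
    unfolding left_counit_iff right_counit_iff coassoc_iff internal_category_iff ..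
  also have "\<dots> \<longleftrightarrow> (t, i, k) \<in> internal_categories_with_source E c"
    by (simp add: internal_categories_with_source_def)
  finally show ?thesis .
qed

text \<open>Together with \<open>i_eq\<close> and \<open>k_eq\<close> this recovers the data by
  evaluating the comonoid on generic elements, which makes \<open>(t, i, k)\<close> unique.\<close>

lemma t_eq: "t = pos_at c c (on_pos \<delta> \<cdot> c) (ide (src c))"
  by simp

lemma i_eq: "i = dir_at E \<epsilon> (ide (tgt c)) (bang E (tgt c))"
proof -
  have "over (on_pos \<epsilon>) (y_poly E) (ide (tgt c)) (bang E (tgt c))"
    by (auto intro!: terminal_unique)
  then show ?thesis by (subst \<epsilon>_dir) simp_all
qed

lemma k_eq: "k = dir_at E \<delta> (c \<cdot> p1 t c) (dir_pair E c c (on_pos \<delta> \<cdot> (c \<cdot> p1 t c)) (p1 t c) (p2 t c))"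
  using pb_commutes[of t c] by (subst \<delta>_dir_pair) simp_all

end

section \<open>Existence and uniqueness of the two sides of a presentation\<close>

context finlim
begin

lemma presentation_unique_data:
  assumes "comonoid_presentation E c t i k \<epsilon> \<delta>" "comonoid_presentation E c t' i' k' \<epsilon> \<delta>"
  shows "t = t'" "i = i'" "k = k'"
proof -
  interpret A: comonoid_presentation E c t i k \<epsilon> \<delta> by fact
  interpret B: comonoid_presentation E c t' i' k' \<epsilon> \<delta> by fact
  show t: "t = t'" by (rule trans[OF A.t_eq B.t_eq[symmetric]])
  show "i = i'" by (rule trans[OF A.i_eq B.i_eq[symmetric]])
  \<comment> \<open>The formula for \<open>k\<close> uses the pullback of \<open>t\<close>, so
    \<open>t\<close> has to be identified first.\<close>
  show "k = k'" using A.k_eq B.k_eq by (simp only: t)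
qed

text \<open>\<open>\<epsilon>\<close> has only one possible map on positions,
  \<open>\<delta>\<close> has prescribed base and values there, and both direction parts are
  prescribed by \<open>i\<close> and \<open>k\<close>.\<close>

lemma presentation_unique_comonoid:
  assumes "comonoid_presentation E c t i k \<epsilon> \<delta>" "comonoid_presentation E c t i k \<epsilon>' \<delta>'"
  shows "\<epsilon> = \<epsilon>'" "\<delta> = \<delta>'"
proof -
  interpret A: comonoid_presentation E c t i k \<epsilon> \<delta> by fact
  interpret B: comonoid_presentation E c t i k \<epsilon>' \<delta>' by fact
  have e: "on_pos \<epsilon> = on_pos \<epsilon>'"
    by (intro terminal_unique) simp_all
  show "\<epsilon> = \<epsilon>'"
  proof (rule poly_mor_eqI[OF A.\<epsilon>(1) B.\<epsilon>(1) _ _ e])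
    fix x z assume "over (on_pos \<epsilon>') (p_tgt \<epsilon>') x z"
    then show "dir_at E \<epsilon> x z = dir_at E \<epsilon>' x z"
      using A.\<epsilon>_dir[of x z] B.\<epsilon>_dir[of x z] e by simp
  qed simp_all
  have d: "on_pos \<delta> = on_pos \<delta>'"
  proof (rule position_eqI[OF A.c exponentiable_arr[OF A.c]])
    fix g y assume "over (tri_base E c c \<cdot> on_pos \<delta>') c g y"
    then show "pos_at c c (on_pos \<delta> \<cdot> g) y = pos_at c c (on_pos \<delta>' \<cdot> g) y"
      by auto
  qed simp_all
  show "\<delta> = \<delta>'"
  proof (rule poly_mor_eqI[OF A.\<delta>(1) B.\<delta>(1) _ _ d])
    fix x z assume "over (on_pos \<delta>') (p_tgt \<delta>') x z"
    then show "dir_at E \<delta> x z = dir_at E \<delta>' x z"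
      using A.\<delta>_dir[of x z] B.\<delta>_dir[of x z] d by simp
  qed simp_all
qed

lemma presentation_of_data:
  assumes c: "exponentiable E c"
    and t: "arr t" "src t = src c" "tgt t = tgt c"
    and i: "arr i" "src i = tgt c" "tgt i = src c" "c \<cdot> i = ide (tgt c)"
    and k: "arr k" "src k = pb E t c" "tgt k = src c" "c \<cdot> k = c \<cdot> p1 t c"
  shows "\<exists>\<epsilon> \<delta>. comonoid_presentation E c t i k \<epsilon> \<delta>"
proof -
  note [simp] = c t i k reassoc[OF i(4)] reassoc[OF k(4)]
  define \<epsilon> where "\<epsilon> = \<lparr>p_src = c, p_tgt = y_poly E, on_pos = bang E (tgt c), on_dir = i \<cdot> p1 (bang E (tgt c)) (y_poly E)\<rparr>"
  have \<epsilon>_sel [simp]: "p_src \<epsilon> = c" "p_tgt \<epsilon> = y_poly E" "on_pos \<epsilon> = bang E (tgt c)"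
    by (simp_all add: \<epsilon>_def)
  note \<epsilon>_el = poly_mor_by_elements[of \<epsilon> "\<lambda>x z. i \<cdot> x", unfolded \<epsilon>_sel]
  have \<epsilon>: "is_poly_mor E \<epsilon>"
    by (rule \<epsilon>_el(1)) (auto simp: \<epsilon>_def)
  have \<epsilon>_dir: "dir_at E \<epsilon> x z = i \<cdot> x" if "over (bang E (tgt c)) (y_poly E) x z" for x z
    by (rule \<epsilon>_el(2)) (use that in \<open>auto simp: \<epsilon>_def\<close>)
  \<comment> \<open>The position \<open>(x, t)\<close>: the function part is \<open>t\<close>,
    transported to the pullback of \<open>c\<close> along the identity.\<close>
  define u where "u = pos_pair E c c (ide (tgt c)) (t \<cdot> p2 (ide (tgt c)) c)"
  have u [simp]: "arr u" "src u = tgt c" "tgt u = src (tri_base E c c)" "tri_base E c c \<cdot> u = ide (tgt c)"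
    by (simp_all add: u_def)
  have u_at: "pos_at c c (u \<cdot> x) y = t \<cdot> y" if "over (ide (tgt c)) c x y" for x y
  proof -
    have "pos_at c c (u \<cdot> x) y = (t \<cdot> p2 (ide (tgt c)) c) \<cdot> pair (ide (tgt c)) c x y"
      unfolding u_def by (rule pos_pair_simps(5)) (use that in simp_all)
    then show ?thesis using that by simp
  qed
  define D where "D = (\<lambda>(x :: 'm) (d :: 'm). k \<cdot> pair t c (dir_fst E c c d) (dir_snd E c c d))"
  define \<delta> where "\<delta> = \<lparr>p_src = c, p_tgt = c \<triangleleft> c, on_pos = u, on_dir = D (p1 u (c \<triangleleft> c)) (p2 u (c \<triangleleft> c))\<rparr>"
  have \<delta>_sel [simp]: "p_src \<delta> = c" "p_tgt \<delta> = c \<triangleleft> c" "on_pos \<delta> = u"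
    by (simp_all add: \<delta>_def)
  note \<delta>_el = poly_mor_by_elements[of \<delta> D, unfolded \<delta>_sel]
  have D_ty: "arr (D x d) \<and> src (D x d) = src d \<and> tgt (D x d) = src c \<and> c \<cdot> D x d = x"
    and D_nat: "arr g \<Longrightarrow> tgt g = src d \<Longrightarrow> D x d \<cdot> g = D (x \<cdot> g) (d \<cdot> g)"
    if o: "over u (c \<triangleleft> c) x d" for x d g
  proof -
    have d [simp]: "arr x" "tgt x = tgt c" "arr d" "tgt d = pb E (tri_ev E c c) c" "src x = src d"
      and xd: "(c \<triangleleft> c) \<cdot> d = u \<cdot> x"
      using o by auto
    note dd = dir_over[OF c exponentiable_arr[OF c] d(3,4) xd]
    have x: "c \<cdot> dir_fst E c c d = x"
      using dd(4) reassoc[OF u(4), of x] by simp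
    \<comment> \<open>A direction over \<open>u\<close> is thus a composable pair, which is what
      \<open>k\<close> needs as argument.\<close>
    then have "t \<cdot> dir_fst E c c d = c \<cdot> dir_snd E c c d"
      using dd(5) u_at[of x "dir_fst E c c d"] by simp
    then show "arr (D x d) \<and> src (D x d) = src d \<and> tgt (D x d) = src c \<and> c \<cdot> D x d = x"
      "arr g \<Longrightarrow> tgt g = src d \<Longrightarrow> D x d \<cdot> g = D (x \<cdot> g) (d \<cdot> g)"
      using x by (simp_all add: D_def)
  qed
  have \<delta>: "is_poly_mor E \<delta>"
    by (rule \<delta>_el(1)) (use D_ty D_nat in \<open>simp_all add: \<delta>_def\<close>)
  have \<delta>_dir: "dir_at E \<delta> x d = D x d" if "over u (c \<triangleleft> c) x d" for x d
    by (rule \<delta>_el(2)) (use that D_ty D_nat in \<open>simp_all add: \<delta>_def\<close>)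
  have "comonoid_presentation E c t i k \<epsilon> \<delta>"
  proof unfold_locales
    show "pos_at c c (on_pos \<delta> \<cdot> (c \<cdot> y)) y = t \<cdot> y" if "arr y" "tgt y = src c" for y
      using u_at[of "c \<cdot> y" y] that by simp
    show "dir_at E \<epsilon> x z = i \<cdot> x" if "over (on_pos \<epsilon>) (y_poly E) x z" for x z
      using \<epsilon>_dir[of x z] that by simp
    show "dir_at E \<delta> x d = k \<cdot> pair t c (dir_fst E c c d) (dir_snd E c c d)"
      if "over (on_pos \<delta>) (c \<triangleleft> c) x d" for x d
      using \<delta>_dir[of x d] that by (simp add: D_def)
  qed (simp_all add: \<epsilon> \<delta>)
  then show ?thesis by blast
qed

text \<open>The right counit law supplies \<open>base\<close>; then \<open>t\<close>,
  \<open>i\<close> and \<open>k\<close> are defined by evaluating at generic elements, and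
  naturality extends the formulas to all elements.\<close>

lemma presentation_of_comonoid:
  assumes c: "exponentiable E c" and com: "(\<epsilon>, \<delta>) \<in> comonoid_structures E c"
  shows "\<exists>t i k. comonoid_presentation E c t i k \<epsilon> \<delta>"
proof -
  note [simp] = c
  have \<epsilon> [simp]: "is_poly_mor E \<epsilon>" "p_src \<epsilon> = c" "p_tgt \<epsilon> = y_poly E"
    and \<delta> [simp]: "is_poly_mor E \<delta>" "p_src \<delta> = c" "p_tgt \<delta> = c \<triangleleft> c"
    and R: "poly_comp E (poly_id E c \<triangleleft>m \<epsilon>) \<delta> = right_unitor E c"
    using com by (auto simp: comonoid_structures_def Poly_def Hom_def)
  have id_c: "is_poly_mor E (poly_id E c)"
    by (rule poly_id(1)) simp
  have [simp]: "arr (on_pos \<epsilon>)" "src (on_pos \<epsilon>) = tgt c" "tgt (on_pos \<epsilon>) = one"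
    "arr (on_pos \<delta>)" "src (on_pos \<delta>) = tgt c" "tgt (on_pos \<delta>) = src (tri_base E c c)"
    using poly_mor_simps[OF \<epsilon>(1)] poly_mor_simps[OF \<delta>(1)] by simp_all
  note T = tri_pos[OF id_c \<epsilon>(1) poly_id_sel(1,2) \<epsilon>(2,3)]
  \<comment> \<open>Tensoring with the identity on the left preserves the base, so the base of
    \<open>\<delta>\<close> equals that of the right unitor.\<close>
  have "tri_base E c (y_poly E) \<cdot> on_pos (right_unitor E c) = tri_base E c c \<cdot> on_pos \<delta>"
    using reassoc[OF T(4), of "on_pos \<delta>"] T(1-3) unfolding R[symmetric] by simp
  then have base [simp]: "tri_base E c c \<cdot> on_pos \<delta> = ide (tgt c)"
    using right_unitor(5)[OF c] by simp
  note base' [simp] = reassoc[OF base]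
  define t where "t = pos_at c c (on_pos \<delta> \<cdot> c) (ide (src c))"
  have t [simp]: "arr t" "src t = src c" "tgt t = tgt c"
    by (simp_all add: t_def)
  have at [simp]: "pos_at c c (on_pos \<delta> \<cdot> x) y = t \<cdot> y" if "arr y" "tgt y = src c" "x = c \<cdot> y" for x y
    using that by (simp add: t_def)
  define i where "i = dir_at E \<epsilon> (ide (tgt c)) (bang E (tgt c))"
  have eb: "over (on_pos \<epsilon>) (y_poly E) (ide (tgt c)) (bang E (tgt c))"
    by (auto intro!: terminal_unique)
  have i: "arr i" "src i = tgt c" "tgt i = src c" "c \<cdot> i = ide (tgt c)"
    using dir_at_simps(1-4)[of \<epsilon> "ide (tgt c)" "bang E (tgt c)"] eb by (simp_all add: i_def)
  have i_dir: "dir_at E \<epsilon> x z = i \<cdot> x" if o: "over (on_pos \<epsilon>) (y_poly E) x z" for x z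
  proof -
    have "z = bang E (src x)"
      using o by (auto intro!: terminal_unique)
    then show ?thesis
      using o eb dir_at_simps(5)[of \<epsilon> "ide (tgt c)" "bang E (tgt c)" x] by (simp add: i_def)
  qed
  define k where "k = dir_at E \<delta> (c \<cdot> p1 t c) (dir_pair E c c (on_pos \<delta> \<cdot> (c \<cdot> p1 t c)) (p1 t c) (p2 t c))"
  have gen [simp]: "t \<cdot> p1 t c = c \<cdot> p2 t c"
    using pb_commutes[of t c] by simp
  have k: "arr k" "src k = pb E t c" "tgt k = src c" "c \<cdot> k = c \<cdot> p1 t c"
    using dir_at_simps(4)[OF \<delta>(1), of "c \<cdot> p1 t c", unfolded \<delta>(2)] by (simp_all add: k_def)
  have k_dir: "dir_at E \<delta> x d = k \<cdot> pair t c (dir_fst E c c d) (dir_snd E c c d)"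
    if o: "over (on_pos \<delta>) (c \<triangleleft> c) x d" for x d
  proof -
    have d [simp]: "arr x" "tgt x = tgt c" "arr d" "tgt d = pb E (tri_ev E c c) c" "src x = src d"
      and xd: "(c \<triangleleft> c) \<cdot> d = on_pos \<delta> \<cdot> x"
      using o by auto
    note dd = dir_over[OF c exponentiable_arr[OF c] d(3,4) xd]
    define a where "a = dir_fst E c c d"
    define b where "b = dir_snd E c c d"
    have ab [simp]: "arr a" "src a = src d" "tgt a = src c" "arr b" "src b = src d" "tgt b = src c"
      by (simp_all add: a_def b_def)
    have x: "x = c \<cdot> a"
      using dd(4) by (simp add: a_def)
    have tab: "t \<cdot> a = c \<cdot> b"
      using dd(5) x by (simp add: a_def b_def)
    \<comment> \<open>Every direction is the pair of its components, hence a restriction of the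
      generic direction that defines \<open>k\<close>.\<close>
    have dab: "dir_pair E c c (on_pos \<delta> \<cdot> x) a b = d"
      using dir_eta[OF c exponentiable_arr[OF c] d(3,4) xd] by (simp add: a_def b_def)
    have "k \<cdot> pair t c a b = dir_at E \<delta> x (dir_pair E c c (on_pos \<delta> \<cdot> x) a b)"
      unfolding k_def using tab x by simp
    then show ?thesis
      unfolding dab by (simp add: a_def b_def)
  qed
  have "comonoid_presentation E c t i k \<epsilon> \<delta>"
    by unfold_locales (use i k i_dir k_dir in simp_all)
  then show ?thesis by blast
qed

end

text \<open>Allows the bijection to come from the symmetric relation of being presented by the same
  data, without defining two maps and checking that they are inverse.\<close>

lemma bij_betw_of_relation:
  assumes "\<And>x. x \<in> A \<Longrightarrow> \<exists>y \<in> B. R x y" "\<And>y. y \<in> B \<Longrightarrow> \<exists>x \<in> A. R x y"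
    and "\<And>x y y'. R x y \<Longrightarrow> R x y' \<Longrightarrow> y = y'" "\<And>x x' y. R x y \<Longrightarrow> R x' y \<Longrightarrow> x = x'"
  shows "\<exists>\<Phi>. bij_betw \<Phi> A B"
proof -
  obtain \<Phi> where \<Phi>: "\<And>x. x \<in> A \<Longrightarrow> \<Phi> x \<in> B \<and> R x (\<Phi> x)"
    using assms(1) by metis
  have "\<Phi> ` A = B"
    using \<Phi> assms(2,3) by blast
  moreover have "inj_on \<Phi> A"
    using \<Phi> assms(4) unfolding inj_on_def by metis
  ultimately show ?thesis
    unfolding bij_betw_def by blast
qed

theorem theorem5p6:
  fixes E :: "('o, 'm) category" and c :: 'm
  assumes "is_category E"
    and "has_finite_limits E"
    and "exponentiable E c"
  shows "\<exists>\<Phi>. bij_betw \<Phi> (comonoid_structures E c) (internal_categories_with_source E c)"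
proof -
  interpret finlim E
    using assms(1,2) by unfold_locales
  \<comment> \<open>The relation contains pairs that satisfy none of the remaining laws;
    \<open>comonoid_iff\<close> shows that related pairs lie in the two sets simultaneously.\<close>
  define R where "R = (\<lambda>(\<epsilon>, \<delta>) (t, i, k). comonoid_presentation E c t i k \<epsilon> \<delta>)"
  show ?thesis
  proof (rule bij_betw_of_relation[of _ _ R])
    fix x assume x: "x \<in> comonoid_structures E c"
    obtain \<epsilon> \<delta> where x': "x = (\<epsilon>, \<delta>)" by (cases x)
    obtain t i k where P: "comonoid_presentation E c t i k \<epsilon> \<delta>"
      using presentation_of_comonoid[OF assms(3)] x x' by blast
    then show "\<exists>y \<in> internal_categories_with_source E c. R x y"
      using comonoid_presentation.comonoid_iff[OF P] x x'
      by (intro bexI[of _ "(t, i, k)"]) (simp_all add: R_def)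
  next
    fix y assume y: "y \<in> internal_categories_with_source E c"
    obtain t i k where y': "y = (t, i, k)" by (cases y)
    have "is_internal_category E (tgt c) (src c) c t i k"
      using y y' by (simp add: internal_categories_with_source_def)
    then obtain \<epsilon> \<delta> where P: "comonoid_presentation E c t i k \<epsilon> \<delta>"
      using presentation_of_data[OF assms(3), of t i k] by (auto simp: is_internal_category_def Hom_def)
    then show "\<exists>x \<in> comonoid_structures E c. R x y"
      using comonoid_presentation.comonoid_iff[OF P] y y'
      by (intro bexI[of _ "(\<epsilon>, \<delta>)"]) (simp_all add: R_def)
  next
    fix x y y' assume "R x y" "R x y'"
    then show "y = y'"
      unfolding R_def by (auto dest: presentation_unique_data split: prod.splits)
  next
    fix x x' y assume "R x y" "R x' y"
    then show "x = x'"
      unfolding R_def by (auto dest: presentation_unique_comonoid split: prod.splits)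
  qed
qed

end
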